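(* For every $C_0>0$ there is a constant $C>0$ depending only on $C_0$ such that the following holds. Let $d\ge2$, let $\mathcal{N}$ be a unitary invariant norm on $\mathbb{R}^{d\times d}$ with unit ball $B_{\mathcal{N}}$ and associated $1$-symmetric norm $\tau$ on $\mathbb{R}^d$, and put $u:=\sum_{i=1}^d e_i\in\mathbb{R}^d$. Let $L\subset\mathbb{R}^{d^2}$ be a centrally symmetric convex body in Rudelson position with constant $C_0$, and let $A=(g_{ij})_{1\le i,j\le d^2}\in\mathbb{R}^{d^2\times d^2}$ be a random matrix with independent Gaussian entries $g_{ij}\sim N(0,1)$. Then with probability greater than $1-2e^{-d}$ the body $$\tilde L:=\frac{1}{\tau(u)}\,\frac{A(L)}{\|A:X_L\to\mathcal{S}_\infty^d\|}$$ satisfies $\tilde L\subset B_{\mathcal{N}}$ and $$\frac{|B_{\mathcal{N}}|^{1/d^2}}{|\tilde L|^{1/d^2}}\le C\,d .$$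
   Context: A convex body is a compact convex set with non-empty interior; $|\cdot|$ denotes Lebesgue measure. For a centrally symmetric convex body $W\subset\mathbb{R}^n$, $X_W$ is the normed space $(\mathbb{R}^n,\|\cdot\|_{X_W})$ with unit ball $W$; $W^\circ=\{x:\langle x,y\rangle\le1\ \forall y\in W\}$ is its polar; $\|T:X\to Y\|$ is the operator norm; $\ell(W):=\int_{\mathbb{R}^n}\|x\|_{X_W}\,d\gamma(x)$ with $\gamma$ the standard Gaussian measure on $\mathbb{R}^n$. For $n\ge2$, a centrally symmetric convex body $W\subset\mathbb{R}^n$ is in Rudelson position with constant $C_0$ if $$\ell(W)\le C_0\sqrt n\log n,\qquad \ell(W^\circ)\le C_0\sqrt n,\qquad \|\mathrm{id}:\ell_2^n\to X_{W^\circ}\|\le C_0\frac{\sqrt n}{\log n}.$$ $\mathbb{R}^{d\times d}$ is identified with $\mathbb{R}^{d^2}$ (so here $n=d^2$), and $\mathcal{S}_\infty^d$ is $\mathbb{R}^{d\times d}$ with the norm given by the largest singular value. A norm $\mathcal{N}$ on $\mathbb{R}^{d\times d}$ is unitary invariant if $\mathcal{N}(UTV)=\mathcal{N}(T)$ for all orthogonal $U,V\in O(d)$ and all $T$. Such a norm has the form $\mathcal{N}(T)=\tau(s_1(T),\dots,s_d(T))$, with $s_i(T)$ the singular values of $T$, for a unique $1$-symmetric norm $\tau$ on $\mathbb{R}^d$ (invariant under permutations and sign changes of coordinates); this is the $\tau$ associated to $\mathcal{N}$. *)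

theory Defs
  imports "HOL-Probability.Probability" "Jordan_Normal_Form.Char_Poly"
begin

text \<open>
  The dimension is quantified inside the theorem (the constant must not depend on it), so it
  cannot be a type. For a finite index set I, the space of real vectors indexed by I
  is the set \<open>coord_space I\<close> of extensional functions, i.e. the carrier of the library's product
  topology \<open>powertop_real I\<close> and of its product measures \<open>PiM I\<close>. Vectors of length d are
  indexed by \<open>{..<d}\<close> (so coordinates start at 0) and d-by-d matrices by \<open>mat_idx d\<close>; a subset of
  the matrix space is thereby literally a subset of a coordinate space of dimension d * d.
\<close>

definition coord_space :: "'i set \<Rightarrow> ('i \<Rightarrow> real) set" where
  "coord_space I = (I \<rightarrow>\<^sub>E UNIV)"

abbreviation mat_idx :: "nat \<Rightarrow> (nat \<times> nat) set" where
  "mat_idx d \<equiv> {..<d} \<times> {..<d}"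

definition vadd :: "'i set \<Rightarrow> ('i \<Rightarrow> real) \<Rightarrow> ('i \<Rightarrow> real) \<Rightarrow> 'i \<Rightarrow> real" where
  "vadd I x y = (\<lambda>i\<in>I. x i + y i)"

definition vscale :: "'i set \<Rightarrow> real \<Rightarrow> ('i \<Rightarrow> real) \<Rightarrow> 'i \<Rightarrow> real" where
  "vscale I c x = (\<lambda>i\<in>I. c * x i)"

definition vinner :: "'i set \<Rightarrow> ('i \<Rightarrow> real) \<Rightarrow> ('i \<Rightarrow> real) \<Rightarrow> real" where
  "vinner I x y = (\<Sum>i\<in>I. x i * y i)"

definition norm_on :: "'i set \<Rightarrow> (('i \<Rightarrow> real) \<Rightarrow> real) \<Rightarrow> bool" where
  "norm_on I N \<longleftrightarrow>
     (\<forall>x\<in>coord_space I. 0 \<le> N x) \<and>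
     (\<forall>x\<in>coord_space I. N x = 0 \<longleftrightarrow> (\<forall>i\<in>I. x i = 0)) \<and>
     (\<forall>c. \<forall>x\<in>coord_space I. N (vscale I c x) = \<bar>c\<bar> * N x) \<and>
     (\<forall>x\<in>coord_space I. \<forall>y\<in>coord_space I. N (vadd I x y) \<le> N x + N y)"

definition unit_ball :: "'i set \<Rightarrow> (('i \<Rightarrow> real) \<Rightarrow> real) \<Rightarrow> ('i \<Rightarrow> real) set" where
  "unit_ball I N = {x \<in> coord_space I. N x \<le> 1}"

definition convex_body :: "'i set \<Rightarrow> ('i \<Rightarrow> real) set \<Rightarrow> bool" where
  "convex_body I K \<longleftrightarrow>
     compactin (powertop_real I) K \<and>
     powertop_real I interior_of K \<noteq> {} \<and>
     (\<forall>x\<in>K. \<forall>y\<in>K. \<forall>t\<in>{0..1}. vadd I (vscale I (1 - t) x) (vscale I t y) \<in> K)"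

definition centrally_symmetric :: "'i set \<Rightarrow> ('i \<Rightarrow> real) set \<Rightarrow> bool" where
  "centrally_symmetric I K \<longleftrightarrow> (\<forall>x\<in>K. vscale I (-1) x \<in> K)"

text \<open>The norm with unit ball W, i.e. the Minkowski functional of W.\<close>

definition body_norm :: "'i set \<Rightarrow> ('i \<Rightarrow> real) set \<Rightarrow> ('i \<Rightarrow> real) \<Rightarrow> real" where
  "body_norm I W x = Inf {t. 0 < t \<and> x \<in> vscale I t ` W}"

definition polar :: "'i set \<Rightarrow> ('i \<Rightarrow> real) set \<Rightarrow> ('i \<Rightarrow> real) set" where
  "polar I W = {x \<in> coord_space I. \<forall>y\<in>W. vinner I x y \<le> 1}"

text \<open>Operator norm of a linear map from (coord_space I, NX) into a space normed by NY.\<close>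

definition op_norm ::
  "'i set \<Rightarrow> (('i \<Rightarrow> real) \<Rightarrow> real) \<Rightarrow> (('j \<Rightarrow> real) \<Rightarrow> real) \<Rightarrow> (('i \<Rightarrow> real) \<Rightarrow> ('j \<Rightarrow> real)) \<Rightarrow> real" where
  "op_norm I NX NY T = (SUP x\<in>unit_ball I NX. NY (T x))"

definition lebesgue_vol :: "'i set \<Rightarrow> ('i \<Rightarrow> real) set \<Rightarrow> real" where
  "lebesgue_vol I K = measure (PiM I (\<lambda>_. lborel)) K"

definition gaussian :: "'i set \<Rightarrow> ('i \<Rightarrow> real) measure" where
  "gaussian I = PiM I (\<lambda>_. std_normal_distribution)"

definition ell :: "'i set \<Rightarrow> ('i \<Rightarrow> real) set \<Rightarrow> real" where
  "ell I W = (LINT x|gaussian I. body_norm I W x)"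

definition rudelson_position :: "'i set \<Rightarrow> real \<Rightarrow> ('i \<Rightarrow> real) set \<Rightarrow> bool" where
  "rudelson_position I C0 W \<longleftrightarrow>
     (let n = real (card I) in
        ell I W \<le> C0 * sqrt n * ln n \<and>
        ell I (polar I W) \<le> C0 * sqrt n \<and>
        op_norm I (\<lambda>x. L2_set x I) (body_norm I (polar I W)) (\<lambda>x. x) \<le> C0 * (sqrt n / ln n))"

text \<open>
  Singular values of T: square roots of the eigenvalues of the transpose of T times T, with
  multiplicity and in decreasing order. As this matrix is symmetric, its characteristic polynomial
  has d real roots, so the list has length d.
\<close>

definition singular_values :: "nat \<Rightarrow> (nat \<times> nat \<Rightarrow> real) \<Rightarrow> real list" where
  "singular_values d T =
     (let M = Matrix.mat d d T in
        rev (sorted_list_of_multiset (image_mset sqrt (proots (char_poly (transpose_mat M * M))))))"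

definition singular_vector :: "nat \<Rightarrow> (nat \<times> nat \<Rightarrow> real) \<Rightarrow> nat \<Rightarrow> real" where
  "singular_vector d T = (\<lambda>i\<in>{..<d}. singular_values d T ! i)"

definition schatten_inf :: "nat \<Rightarrow> (nat \<times> nat \<Rightarrow> real) \<Rightarrow> real" where
  "schatten_inf d T = Max (set (singular_values d T))"

definition orthogonal_group :: "nat \<Rightarrow> real mat set" where
  "orthogonal_group d = {U \<in> carrier_mat d d. U * transpose_mat U = 1\<^sub>m d \<and> transpose_mat U * U = 1\<^sub>m d}"

definition unitary_invariant_norm :: "nat \<Rightarrow> ((nat \<times> nat \<Rightarrow> real) \<Rightarrow> real) \<Rightarrow> bool" where
  "unitary_invariant_norm d N \<longleftrightarrow>
     norm_on (mat_idx d) N \<and>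
     (\<forall>U\<in>orthogonal_group d. \<forall>V\<in>orthogonal_group d. \<forall>T\<in>coord_space (mat_idx d).
        N (restrict (index_mat (U * Matrix.mat d d T * V)) (mat_idx d)) = N T)"

definition one_symmetric_norm :: "nat \<Rightarrow> ((nat \<Rightarrow> real) \<Rightarrow> real) \<Rightarrow> bool" where
  "one_symmetric_norm d \<tau> \<longleftrightarrow>
     norm_on {..<d} \<tau> \<and>
     (\<forall>x\<in>coord_space {..<d}. \<forall>p. p permutes {..<d} \<longrightarrow> \<tau> (\<lambda>i\<in>{..<d}. x (p i)) = \<tau> x) \<and>
     (\<forall>x\<in>coord_space {..<d}. \<forall>s. (\<forall>i<d. s i \<in> {-1, 1}) \<longrightarrow> \<tau> (\<lambda>i\<in>{..<d}. s i * x i) = \<tau> x)"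

definition associated_norm ::
  "nat \<Rightarrow> ((nat \<times> nat \<Rightarrow> real) \<Rightarrow> real) \<Rightarrow> ((nat \<Rightarrow> real) \<Rightarrow> real) \<Rightarrow> bool" where
  "associated_norm d N \<tau> \<longleftrightarrow>
     one_symmetric_norm d \<tau> \<and> (\<forall>T\<in>coord_space (mat_idx d). N T = \<tau> (singular_vector d T))"

definition ones :: "nat \<Rightarrow> nat \<Rightarrow> real" where
  "ones d = (\<lambda>i\<in>{..<d}. 1)"

definition lin_map :: "'i set \<Rightarrow> ('i \<times> 'i \<Rightarrow> real) \<Rightarrow> ('i \<Rightarrow> real) \<Rightarrow> 'i \<Rightarrow> real" where
  "lin_map I A x = (\<lambda>i\<in>I. \<Sum>j\<in>I. A (i, j) * x j)"

definition random_body ::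
  "nat \<Rightarrow> ((nat \<Rightarrow> real) \<Rightarrow> real) \<Rightarrow> (nat \<times> nat \<Rightarrow> real) set
     \<Rightarrow> ((nat \<times> nat) \<times> (nat \<times> nat) \<Rightarrow> real) \<Rightarrow> (nat \<times> nat \<Rightarrow> real) set" where
  "random_body d \<tau> L A =
     (let I = mat_idx d;
          c = 1 / \<tau> (ones d) * (1 / op_norm I (body_norm I L) (schatten_inf d) (lin_map I A))
      in vscale I c ` lin_map I A ` L)"

end

theory Submission
  imports Defs
begin

text \<open>
  Put \<open>n = d\<^sup>2\<close>. The inclusion is \<open>N(T) \<le> \<tau>(u) s\<^sub>1(T)\<close>. For the volume ratio, four estimates are
  combined; \<open>c\<close> denotes constants depending only on \<open>C0\<close>.

  Averaging and trace duality give \<open>\<Sum> s\<^sub>i(T) \<le> (d / \<tau>(u)) N(T)\<close>, so the unit ball of \<open>N\<close> lies in a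
  trace norm ball. Covering that ball by Euclidean balls centred at averages of \<open>d\<close> rank one matrices
  from a net yields a volume radius of at most \<open>c / (\<tau>(u) sqrt d)\<close>.

  The norm of \<open>A\<close> is, up to a factor, the maximum over \<open>e\<^bsup>O(d)\<^esup>\<close> pairs \<open>(v, w)\<close> from a net of the support
  function of \<open>L\<close> at the Gaussian vector obtained by applying the transpose of \<open>A\<close> to the rank one
  matrix of \<open>v\<close> and \<open>w\<close>. This support function has mean at most \<open>C0 d\<close> and Lipschitz constant at most
  \<open>C0 d / ln n\<close>, so Gaussian concentration and a union bound give at most \<open>c d sqrt d / ln n\<close>, which
  also absorbs the mean.

  By Markov's inequality for \<open>ell(L)\<close> the volume radius of \<open>L\<close> is at least \<open>c / (d ln n)\<close>, and the two
  logarithms cancel in the quotient.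

  The matrix \<open>A\<close> multiplies the volume radius by at least \<open>c d\<close>. Instead of \<open>det A\<close>, the integral of
  \<open>exp (- |A x|\<^sup>2 / 2)\<close> over all \<open>x\<close> is used, which is inversely proportional to the volume factor of \<open>A\<close>.
  Its expectation diverges; but if \<open>|A x| \<ge> \<delta> |x|\<close> for all \<open>x\<close>, then inserting the factor
  \<open>exp (- \<delta>\<^sup>2 |x|\<^sup>2 / 2)\<close> costs at most \<open>2\<^bsup>n/2\<^esup>\<close>, and the damped expectation is bounded by Fubini.
\<close>

subsection \<open>Inner products and spectral theory\<close>

text \<open>Gaussian concentration is needed only up to constant factors, even in front of the mean,
  so a bound for the Laplace transform of the support function F suffices. For independent x and y
  the difference F x - F y is split at w = (x + y) / sqrt 2. By rotation invariance both halves have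
  the form F x - F ((x + y) / sqrt 2) or F x - F ((x - y) / sqrt 2) for an independent pair, and
  there F is linearised at the maximiser belonging to x; no derivative of F occurs. What remains is
  the Laplace transform at 3/5 of the parameter. As 3/5 < 1, Jensen's inequality bounds it by a
  power below 1 of the original one, and the estimate closes.

  The expectation of exp (- |A x|^2 / 2) is (1 + |x|^2) to the power - n / 2, exactly at the edge of
  integrability over n dimensions. The damping supplies one more factor (1 + |x|^2) to the power - 1
  / 2 at the price 2 / \<delta>. Volume factors matter only through their n-th roots, so \<delta> =
  exp (- 3 n) is affordable, and for such a \<delta> a crude union bound over the columns excludes
  the matrices with too small a stretch.\<close>

lemma vinner_cong:
  "(\<And>i. i \<in> I \<Longrightarrow> x i = x' i) \<Longrightarrow> (\<And>i. i \<in> I \<Longrightarrow> y i = y' i) \<Longrightarrow> vinner I x y = vinner I x' y'"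
  by (simp add: vinner_def cong: sum.cong)

lemma vinner_commute: "vinner I x y = vinner I y x"
  by (simp add: vinner_def mult.commute)

lemma vinner_add_left: "vinner I (\<lambda>i. x i + y i) z = vinner I x z + vinner I y z"
  by (simp add: vinner_def algebra_simps sum.distrib)

lemma vinner_diff_left: "vinner I (\<lambda>i. x i - y i) z = vinner I x z - vinner I y z"
  by (simp add: vinner_def algebra_simps sum_subtractf)

lemma vinner_scale_left: "vinner I (\<lambda>i. c * x i) z = c * vinner I x z"
  by (simp add: vinner_def sum_distrib_left mult.assoc)

lemma vinner_add_right: "vinner I z (\<lambda>i. x i + y i) = vinner I z x + vinner I z y"
  by (simp add: vinner_def algebra_simps sum.distrib)

lemma vinner_diff_right: "vinner I z (\<lambda>i. x i - y i) = vinner I z x - vinner I z y"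
  by (simp add: vinner_def algebra_simps sum_subtractf)

lemma vinner_scale_right: "vinner I z (\<lambda>i. c * x i) = c * vinner I z x"
  by (simp add: vinner_def sum_distrib_left mult_ac)

lemma vinner_sum_right: "vinner I z (\<lambda>i. \<Sum>a\<in>S. f a i) = (\<Sum>a\<in>S. vinner I z (f a))"
  unfolding vinner_def sum_distrib_left by (rule sum.swap)

lemmas vinner_linear = vinner_add_left vinner_diff_left vinner_scale_left
  vinner_add_right vinner_diff_right vinner_scale_right

lemma vinner_self_nonneg: "0 \<le> vinner I x x"
  by (simp add: vinner_def sum_nonneg)

lemma vinner_self_eq_0_iff: "finite I \<Longrightarrow> vinner I x x = 0 \<longleftrightarrow> (\<forall>i\<in>I. x i = 0)"
  by (simp add: vinner_def sum_nonneg_eq_0_iff)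

lemma vinner_self_L2: "vinner I x x = (L2_set x I)\<^sup>2"
  by (simp add: vinner_def L2_set_def sum_nonneg power2_eq_square[symmetric])

lemma vinner_cauchy_schwarz: "\<bar>vinner I x y\<bar> \<le> L2_set x I * L2_set y I"
  unfolding vinner_def by (rule order_trans[OF sum_abs]) (simp only: abs_mult L2_set_mult_ineq)

text \<open>Only the expansion in t is assumed, so the rule can be used for
  \<open>vinner I (lin_map I B x) y\<close> directly. The general case is the discriminant argument
  at its optimal t.\<close>

lemma psd_cauchy_schwarz:
  fixes B :: "('i \<Rightarrow> real) \<Rightarrow> ('i \<Rightarrow> real) \<Rightarrow> real"
  assumes expand: "\<And>x y t. B (\<lambda>i. x i + t * y i) (\<lambda>i. x i + t * y i) = B x x + 2 * t * B x y + t\<^sup>2 * B y y"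
    and pos: "\<And>x. 0 \<le> B x x"
  shows "(B x y)\<^sup>2 \<le> B x x * B y y"
proof (cases "B y y = 0")
  case False
  then have p: "B y y > 0" using pos[of y] by simp
  have "0 \<le> B x x + 2 * (- B x y / B y y) * B x y + (- B x y / B y y)\<^sup>2 * B y y"
    using pos[of "\<lambda>i. x i + (- B x y / B y y) * y i"] unfolding expand .
  also have "\<dots> = B x x - (B x y)\<^sup>2 / B y y"
    using p by (simp add: power2_eq_square field_simps)
  finally show ?thesis using p by (simp add: field_simps)
next
  case True
  have "B x y = 0"
  proof (rule ccontr)
    assume n: "B x y \<noteq> 0"
    \<comment> \<open>In a null direction the quadratic form is affine in t; this t would give it
      the value -1.\<close>
    have "0 \<le> B x x + 2 * (- (B x x + 1) / (2 * B x y)) * B x y"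
      using pos[of "\<lambda>i. x i + (- (B x x + 1) / (2 * B x y)) * y i"] unfolding expand True by simp
    also have "\<dots> = - 1" using n by (simp add: field_simps)
    finally show False by simp
  qed
  then show ?thesis using True by simp
qed

text \<open>The alternative for square systems over an arbitrary finite index set, which is
  enumerated only in order to use determinants. Kernel vectors are provided on both sides:
  \<open>v\<close> is orthogonal to all rows, \<open>w\<close> to all columns.\<close>

lemma square_system_cases:
  fixes A :: "'i \<times> 'i \<Rightarrow> real"
  assumes I: "finite I"
  obtains (inverse) B where
      "\<And>i k. i \<in> I \<Longrightarrow> k \<in> I \<Longrightarrow> (\<Sum>j\<in>I. A (i, j) * B (j, k)) = (if i = k then 1 else 0)"
      "\<And>i k. i \<in> I \<Longrightarrow> k \<in> I \<Longrightarrow> (\<Sum>j\<in>I. B (i, j) * A (j, k)) = (if i = k then 1 else 0)"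
  | (singular) v w where
      "\<exists>i\<in>I. v i \<noteq> 0" "\<And>i. i \<in> I \<Longrightarrow> (\<Sum>j\<in>I. A (i, j) * v j) = 0"
      "\<exists>i\<in>I. w i \<noteq> 0" "\<And>j. j \<in> I \<Longrightarrow> (\<Sum>i\<in>I. A (i, j) * w i) = 0"
proof -
  define n where "n = card I"
  obtain h where h: "bij_betw h {0..<n} I"
    using ex_bij_betw_nat_finite[OF I] unfolding n_def by blast
  define g where "g = the_inv_into {0..<n} h"
  have hI: "a < n \<Longrightarrow> h a \<in> I" for a using bij_betwE[OF h] by auto
  have gh: "a < n \<Longrightarrow> g (h a) = a" for a
    unfolding g_def using the_inv_into_f_f[OF bij_betw_imp_inj_on[OF h]] by auto
  have hg: "i \<in> I \<Longrightarrow> h (g i) = i" for i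
    unfolding g_def by (rule f_the_inv_into_f_bij_betw[OF h])
  have gI: "i \<in> I \<Longrightarrow> g i < n" for i
    using the_inv_into_into[OF bij_betw_imp_inj_on[OF h], of i "{0..<n}"] bij_betw_imp_surj_on[OF h]
    by (auto simp: g_def)
  have sm: "(\<Sum>j\<in>I. f j) = (\<Sum>b = 0..<n. f (h b))" for f :: "'i \<Rightarrow> real"
    by (rule sum.reindex_bij_betw[OF h, symmetric])
  define M where "M = Matrix.mat n n (\<lambda>(a, b). A (h a, h b))"
  have M: "M \<in> carrier_mat n n" by (simp add: M_def)
  show thesis
  proof (cases "det M = 0")
    case True
    obtain v where v: "v \<in> carrier_vec n" "v \<noteq> 0\<^sub>v n" "M *\<^sub>v v = 0\<^sub>v n"
      using det_0_iff_vec_prod_zero_field[OF M] True by auto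
    obtain w where w: "w \<in> carrier_vec n" "w \<noteq> 0\<^sub>v n" "transpose_mat M *\<^sub>v w = 0\<^sub>v n"
      using det_0_iff_vec_prod_zero_field[of "transpose_mat M" n] True M det_transpose[OF M] by auto
    have nz: "\<exists>i\<in>I. (\<lambda>i. u $ g i) i \<noteq> 0" if "u \<in> carrier_vec n" "u \<noteq> 0\<^sub>v n" for u :: "real vec"
    proof -
      have "\<exists>a<n. u $ a \<noteq> 0"
      proof (rule ccontr)
        assume "\<not> ?thesis"
        then have "u = 0\<^sub>v n" using that(1) by (intro eq_vecI) auto
        then show False using that(2) by simp
      qed
      then obtain a where "a < n" "u $ a \<noteq> 0" by blast
      then show ?thesis using hI gh by (intro bexI[of _ "h a"]) auto
    qed
    show thesis
    proof (rule singular)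
      show "\<exists>i\<in>I. (\<lambda>i. v $ g i) i \<noteq> 0" "\<exists>i\<in>I. (\<lambda>i. w $ g i) i \<noteq> 0"
        using nz v w by blast+
      fix i assume i: "i \<in> I"
      have "(M *\<^sub>v v) $ g i = 0" using v gI[OF i] by simp
      then show "(\<Sum>j\<in>I. A (i, j) * v $ g j) = 0"
        using v gI[OF i] gh hg[OF i] unfolding sm by (simp add: M_def scalar_prod_def)
      have "(transpose_mat M *\<^sub>v w) $ g i = 0" using w gI[OF i] by simp
      then show "(\<Sum>k\<in>I. A (k, i) * w $ g k) = 0"
        using w gI[OF i] gh hg[OF i] unfolding sm by (simp add: M_def scalar_prod_def)
    qed
  next
    case False
    obtain B where B: "B \<in> carrier_mat n n" "B * M = 1\<^sub>m n" "M * B = 1\<^sub>m n"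
      using det_non_zero_imp_unit[OF M False, of "()"] unfolding Units_def ring_mat_def by auto
    show thesis
    proof (rule inverse[of "\<lambda>(i, j). B $$ (g i, g j)"])
      fix i k assume i: "i \<in> I" "k \<in> I"
      have ne: "g i = g k \<longleftrightarrow> i = k" using hg i by metis
      have "(M * B) $$ (g i, g k) = (if i = k then 1 else 0)" using B gI i ne by simp
      then show "(\<Sum>j\<in>I. A (i, j) * (case (j, k) of (i, j) \<Rightarrow> B $$ (g i, g j))) = (if i = k then 1 else 0)"
        using B(1) gI i gh hg unfolding sm by (simp add: M_def scalar_prod_def)
      have "(B * M) $$ (g i, g k) = (if i = k then 1 else 0)" using B gI i ne by simp
      then show "(\<Sum>j\<in>I. (case (i, j) of (i, j) \<Rightarrow> B $$ (g i, g j)) * A (j, k)) = (if i = k then 1 else 0)"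
        using B(1) gI i gh hg unfolding sm by (simp add: M_def scalar_prod_def)
    qed
  qed
qed

lemma vinner_lin_map_left: "vinner I (lin_map I A x) y = (\<Sum>i\<in>I. \<Sum>j\<in>I. A (i, j) * x j * y i)"
  by (simp add: vinner_def lin_map_def sum_distrib_right)

lemma lin_map_adjoint:
  "vinner I (lin_map I A x) y = vinner I x (lin_map I (\<lambda>(i, j). A (j, i)) y)"
  unfolding vinner_lin_map_left by (subst sum.swap) (simp add: vinner_def lin_map_def sum_distrib_left mult_ac)

lemma lin_map_add: "lin_map I A (\<lambda>i. x i + t * y i) = (\<lambda>i\<in>I. lin_map I A x i + t * lin_map I A y i)"
  by (auto simp: lin_map_def restrict_def algebra_simps sum.distrib sum_distrib_left)

lemma L2_lin_map_le:
  "(L2_set (lin_map I A x) I)\<^sup>2 \<le> (\<Sum>i\<in>I. \<Sum>j\<in>I. (A (i, j))\<^sup>2) * (L2_set x I)\<^sup>2"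
proof -
  have "(L2_set (lin_map I A x) I)\<^sup>2 = (\<Sum>i\<in>I. (vinner I (\<lambda>j. A (i, j)) x)\<^sup>2)"
    by (simp add: L2_set_def sum_nonneg lin_map_def vinner_def)
  also have "\<dots> \<le> (\<Sum>i\<in>I. (L2_set (\<lambda>j. A (i, j)) I)\<^sup>2 * (L2_set x I)\<^sup>2)"
  proof (rule sum_mono)
    fix i show "(vinner I (\<lambda>j. A (i, j)) x)\<^sup>2 \<le> (L2_set (\<lambda>j. A (i, j)) I)\<^sup>2 * (L2_set x I)\<^sup>2"
      using power_mono[OF vinner_cauchy_schwarz, of I "\<lambda>j. A (i, j)" x 2] by (simp add: power_mult_distrib)
  qed
  finally show ?thesis by (simp add: sum_distrib_right L2_set_def sum_nonneg)
qed

lemma L2_lin_map_le_sqrt: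
  "L2_set (lin_map I A x) I \<le> sqrt (\<Sum>i\<in>I. \<Sum>j\<in>I. (A (i, j))\<^sup>2) * L2_set x I"
proof -
  have "L2_set (lin_map I A x) I = sqrt ((L2_set (lin_map I A x) I)\<^sup>2)" by simp
  also have "\<dots> \<le> sqrt ((\<Sum>i\<in>I. \<Sum>j\<in>I. (A (i, j))\<^sup>2) * (L2_set x I)\<^sup>2)"
    using L2_lin_map_le by (rule real_sqrt_le_mono)
  also have "\<dots> = sqrt (\<Sum>i\<in>I. \<Sum>j\<in>I. (A (i, j))\<^sup>2) * L2_set x I"
    by (simp add: real_sqrt_mult)
  finally show ?thesis .
qed

lemma vinner_self_L2_mult: "vinner I x x = L2_set x I * L2_set x I"
  by (simp add: vinner_self_L2 power2_eq_square)

lemma quadratic_form_le: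
  "vinner I (lin_map I A x) x \<le> sqrt (\<Sum>i\<in>I. \<Sum>j\<in>I. (A (i, j))\<^sup>2) * vinner I x x"
proof -
  have "vinner I (lin_map I A x) x \<le> L2_set (lin_map I A x) I * L2_set x I"
    using vinner_cauchy_schwarz[of I "lin_map I A x" x] by linarith
  also have "\<dots> \<le> (sqrt (\<Sum>i\<in>I. \<Sum>j\<in>I. (A (i, j))\<^sup>2) * L2_set x I) * L2_set x I"
    by (rule mult_right_mono[OF L2_lin_map_le_sqrt]) simp
  finally show ?thesis by (simp add: vinner_self_L2_mult mult.assoc)
qed

text \<open>Instead of a compactness argument for the maximum of the quadratic form on the sphere,
  let \<open>l\<close> be its supremum and \<open>B\<close> = l - S, a positive semidefinite matrix.
  If \<open>B\<close> is singular, a kernel vector is the eigenvector. If it were invertible, its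
  form would be bounded below by 1 / (c b) on the sphere, and the supremum would be at most l - 1 /
  (c b).\<close>

lemma top_eigenvector:
  fixes S :: "'i \<times> 'i \<Rightarrow> real"
  assumes I: "finite I" "I \<noteq> {}"
    and sym: "\<And>i j. i \<in> I \<Longrightarrow> j \<in> I \<Longrightarrow> S (i, j) = S (j, i)"
  obtains v l where "vinner I v v = 1" "\<And>i. i \<in> I \<Longrightarrow> lin_map I S v i = l * v i"
    "\<And>x. vinner I (lin_map I S x) x \<le> l * vinner I x x"
proof -
  define U where "U = {x. vinner I x x = (1::real)}"
  define q where "q = (\<lambda>x. vinner I (lin_map I S x) x)"
  define c0 where "c0 = sqrt (\<Sum>i\<in>I. \<Sum>j\<in>I. (S (i, j))\<^sup>2)"
  have qle: "q x \<le> c0 * vinner I x x" for x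
    unfolding q_def c0_def by (rule quadratic_form_le)
  define l where "l = (SUP x\<in>U. q x)"
  obtain i0 where i0: "i0 \<in> I" using I by auto
  have U0: "(\<lambda>i. if i = i0 then 1 else 0) \<in> U"
    using i0 I by (simp add: U_def vinner_def if_distrib[of "\<lambda>a. a * _"] cong: if_cong)
  have bdd: "bdd_above (q ` U)"
  proof (rule bdd_aboveI)
    fix y assume "y \<in> q ` U"
    then obtain x where "y = q x" "vinner I x x = 1" by (auto simp: U_def)
    then show "y \<le> c0" using qle[of x] by simp
  qed
  have q_scale: "q (\<lambda>i. c * x i) = c\<^sup>2 * q x" for c x
    unfolding q_def vinner_lin_map_left by (simp add: sum_distrib_left power2_eq_square mult_ac)
  have ql: "q x \<le> l * vinner I x x" for x
  proof (cases "vinner I x x = 0")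
    case True
    then have "\<forall>i\<in>I. x i = 0" using I by (simp add: vinner_self_eq_0_iff)
    then have "q x = 0" unfolding q_def vinner_lin_map_left by (intro sum.neutral ballI) auto
    then show ?thesis using True by simp
  next
    case False
    define r where "r = sqrt (vinner I x x)"
    have r: "r > 0" "r\<^sup>2 = vinner I x x" using False vinner_self_nonneg[of I x] by (auto simp: r_def)
    have "(\<lambda>i. (1/r) * x i) \<in> U"
      unfolding U_def using r(1) by (simp only: mem_Collect_eq vinner_scale_left vinner_scale_right r(2)[symmetric]) (simp add: power2_eq_square)
    then have "q (\<lambda>i. (1/r) * x i) \<le> l" unfolding l_def by (intro cSUP_upper bdd) auto
    then have "q x / r\<^sup>2 \<le> l" unfolding q_scale by (simp add: power_divide)
    then show ?thesis using r(1) unfolding r(2)[symmetric] by (simp add: field_simps)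
  qed
  define B where "B = (\<lambda>(i, j). (if i = j then l else 0) - S (i, j))"
  have Bx: "lin_map I B x i = l * x i - lin_map I S x i" if "i \<in> I" for x i
    using that I by (simp add: lin_map_def B_def left_diff_distrib sum_subtractf if_distrib[of "\<lambda>a. a * _"] cong: if_cong)
  have form: "vinner I (lin_map I B x) x = l * vinner I x x - q x" for x
  proof -
    have "vinner I (lin_map I B x) x = vinner I (\<lambda>i. l * x i - lin_map I S x i) x"
      by (rule vinner_cong) (auto simp: Bx)
    then show ?thesis by (simp add: vinner_linear q_def)
  qed
  have Bsym: "vinner I (lin_map I B x) y = vinner I (lin_map I B y) x" for x y
  proof -
    have "vinner I (lin_map I B y) x = (\<Sum>i\<in>I. \<Sum>j\<in>I. B (j, i) * y i * x j)"
      unfolding vinner_lin_map_left by (rule sum.swap)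
    then show ?thesis unfolding vinner_lin_map_left
      by (auto intro!: sum.cong simp: B_def sym)
  qed
  show thesis
  proof (cases rule: square_system_cases[OF I(1), where A = B, case_names inverse singular])
    case (singular v w)
    define r where "r = sqrt (vinner I v v)"
    have "vinner I v v \<noteq> 0" using singular(1) I by (simp add: vinner_self_eq_0_iff)
    then have r: "r > 0" "r\<^sup>2 = vinner I v v" using vinner_self_nonneg[of I v] by (auto simp: r_def)
    show thesis
    proof (rule that)
      show "vinner I (\<lambda>i. (1/r) * v i) (\<lambda>i. (1/r) * v i) = 1"
        using r(1) by (simp only: vinner_scale_left vinner_scale_right r(2)[symmetric]) (simp add: power2_eq_square)
      fix i assume i: "i \<in> I"
      have "lin_map I B v i = 0" using singular(2) i by (simp add: lin_map_def)
      then have "lin_map I S v i = l * v i" using Bx[OF i] by simp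
      moreover have "lin_map I S (\<lambda>i. (1/r) * v i) i = (1/r) * lin_map I S v i"
        using i by (simp add: lin_map_def sum_distrib_left mult_ac)
      ultimately show "lin_map I S (\<lambda>i. (1/r) * v i) i = l * ((1/r) * v i)" by simp
    next
      fix x show "vinner I (lin_map I S x) x \<le> l * vinner I x x" using ql unfolding q_def .
    qed
  next
    case (inverse C)
    define c where "c = (\<Sum>i\<in>I. \<Sum>j\<in>I. (C (i, j))\<^sup>2)"
    define b where "b = 1 + sqrt (\<Sum>i\<in>I. \<Sum>j\<in>I. (B (i, j))\<^sup>2)"
    have b: "b > 0" by (simp add: b_def sum_nonneg add_pos_nonneg)
    have xB: "vinner I x x \<le> c * vinner I (lin_map I B x) (lin_map I B x)" for x
    proof -
      have "lin_map I C (lin_map I B x) i = x i" if i: "i \<in> I" for i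
      proof -
        have "lin_map I C (lin_map I B x) i = (\<Sum>j\<in>I. \<Sum>k\<in>I. C (i, j) * B (j, k) * x k)"
          using i by (simp add: lin_map_def sum_distrib_left mult.assoc)
        also have "\<dots> = (\<Sum>k\<in>I. (\<Sum>j\<in>I. C (i, j) * B (j, k)) * x k)"
          by (subst sum.swap) (simp add: sum_distrib_right)
        also have "\<dots> = x i" using inverse(2)[OF i] i I
          by (simp add: if_distrib[of "\<lambda>a. a * _"] cong: if_cong)
        finally show ?thesis .
      qed
      then have "vinner I x x = (L2_set (lin_map I C (lin_map I B x)) I)\<^sup>2"
        unfolding vinner_self_L2[symmetric] by (intro vinner_cong) auto
      then show ?thesis using L2_lin_map_le[of I C "lin_map I B x"] by (simp add: c_def vinner_self_L2)
    qed
    have Bb: "vinner I (lin_map I B x) (lin_map I B x) \<le> b * vinner I (lin_map I B x) x" for x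
    proof -
      let ?y = "lin_map I B x"
      have ps: "0 \<le> vinner I (lin_map I B x) x" for x using ql form by simp
      \<comment> \<open>Cauchy-Schwarz for the form of \<open>B\<close>, at the vectors x and B x.
        The form at B x is at most b |B x|^2, so one factor |B x|^2 cancels and |B x|^2 is
        controlled by the form at x.\<close>
      have cs: "(vinner I ?y ?y)\<^sup>2 \<le> vinner I ?y x * vinner I (lin_map I B ?y) ?y"
      proof (rule psd_cauchy_schwarz[where B="\<lambda>x y. vinner I (lin_map I B x) y"])
        fix x y :: "'i \<Rightarrow> real" and t
        have "vinner I (lin_map I B (\<lambda>i. x i + t * y i)) (\<lambda>i. x i + t * y i)
            = vinner I (\<lambda>i. lin_map I B x i + t * lin_map I B y i) (\<lambda>i. x i + t * y i)"
          by (rule vinner_cong) (auto simp: lin_map_add)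
        then show "vinner I (lin_map I B (\<lambda>i. x i + t * y i)) (\<lambda>i. x i + t * y i)
          = vinner I (lin_map I B x) x + 2 * t * vinner I (lin_map I B x) y + t\<^sup>2 * vinner I (lin_map I B y) y"
          using Bsym[of y x] by (simp add: vinner_linear algebra_simps power2_eq_square)
      qed (rule ps)
      have "vinner I (lin_map I B ?y) ?y \<le> b * vinner I ?y ?y"
        by (rule order_trans[OF quadratic_form_le]) (simp add: b_def mult_right_mono vinner_self_nonneg)
      then have "(vinner I ?y ?y)\<^sup>2 \<le> vinner I ?y x * (b * vinner I ?y ?y)"
        by (rule order_trans[OF cs mult_left_mono[OF _ ps]])
      then show ?thesis
        using vinner_self_nonneg[of I ?y] ps[of x] b
        by (cases "vinner I ?y ?y = 0") (auto simp: power2_eq_square mult_ac)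
    qed
    have c: "c > 0"
    proof (rule ccontr)
      assume "\<not> c > 0"
      then have "c * vinner I y y \<le> 0" for y
        by (simp add: mult_nonpos_nonneg vinner_self_nonneg)
      from order_trans[OF xB this, of "\<lambda>i. if i = i0 then 1 else 0"] U0
      show False by (simp add: U_def)
    qed
    have "q x \<le> l - 1 / (c * b)" if "x \<in> U" for x
    proof -
      have "1 \<le> c * (b * vinner I (lin_map I B x) x)"
        using order_trans[OF xB[of x] mult_left_mono[OF Bb[of x] less_imp_le[OF c]]] that
        unfolding U_def by simp
      then have "1 / (c * b) \<le> l - q x" using form[of x] that b c by (simp add: U_def field_simps)
      then show ?thesis by simp
    qed
    then have "l \<le> l - 1 / (c * b)" unfolding l_def[symmetric]
      by (subst l_def) (intro cSUP_least, use U0 in auto)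
    then have "1 / (c * b) \<le> 0" by simp
    moreover have "1 / (c * b) > 0" using b c by simp
    ultimately show thesis by simp
  qed
qed

text \<open>Eigenvectors are found one at a time by deflation: subtracting a large multiple of the
  projection onto those already found pushes their eigenvalues below the top of the rest, so the new
  top eigenvector is orthogonal to them. Indexing them by \<open>I\<close> itself makes the final
  family a square matrix.\<close>

lemma spectral_basis:
  fixes S :: "'i \<times> 'i \<Rightarrow> real"
  assumes I: "finite I"
    and sym: "\<And>i j. i \<in> I \<Longrightarrow> j \<in> I \<Longrightarrow> S (i, j) = S (j, i)"
  obtains e l where
    "\<And>a b. a \<in> I \<Longrightarrow> b \<in> I \<Longrightarrow> vinner I (e a) (e b) = (if a = b then 1 else 0)"
    "\<And>i k. i \<in> I \<Longrightarrow> k \<in> I \<Longrightarrow> (\<Sum>a\<in>I. e a i * e a k) = (if i = k then 1 else 0)"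
    "\<And>a i. a \<in> I \<Longrightarrow> i \<in> I \<Longrightarrow> lin_map I S (e a) i = l a * e a i"
proof -
  define good where "good = (\<lambda>J (e :: 'i \<Rightarrow> 'i \<Rightarrow> real) l.
      (\<forall>a\<in>J. \<forall>b\<in>J. vinner I (e a) (e b) = (if a = b then 1 else 0)) \<and>
      (\<forall>a\<in>J. \<forall>i\<in>I. lin_map I S (e a) i = l a * e a i))"
  have "\<exists>e l. good J e l" if "finite J" "J \<subseteq> I" for J
    using that
  proof (induction J rule: finite_subset_induct')
    case empty
    then show ?case by (simp add: good_def)
  next
    case (insert b J)
    then obtain e l where g: "good J e l" by blast
    have orth: "vinner I (e a) (e a') = (if a = a' then 1 else 0)" if "a \<in> J" "a' \<in> J" for a a'
      using g that by (simp add: good_def)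
    have eig: "lin_map I S (e a) i = l a * e a i" if "a \<in> J" "i \<in> I" for a i
      using g that by (simp add: good_def)
    \<comment> \<open>The vectors of \<open>J\<close> are the rows of a square matrix padded with
      zero rows. Row b is zero, so there is no inverse, and a kernel vector is orthogonal to all of
      \<open>J\<close>.\<close>
    obtain x0 where x0: "vinner I x0 x0 \<noteq> 0" "\<And>a. a \<in> J \<Longrightarrow> vinner I (e a) x0 = 0"
    proof (cases rule: square_system_cases[OF I, where A = "\<lambda>(i, j). if i \<in> J then e i j else 0", case_names inverse singular])
      case (inverse B)
      from inverse(1)[of b b] insert show thesis by simp
    next
      case (singular v w)
      show thesis
      proof (rule that)
        show "vinner I v v \<noteq> 0" using singular(1) I by (simp add: vinner_self_eq_0_iff)
        fix a assume "a \<in> J"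
        then show "vinner I (e a) v = 0" using singular(2)[of a] insert by (auto simp: vinner_def)
      qed
    qed
    define q0 where "q0 = vinner I (lin_map I S x0) x0 / vinner I x0 x0"
    \<comment> \<open>This makes l a - c < q0 for every a in \<open>J\<close>, whereas q0 is a value
      that the deflated form still attains on the normalised x0.\<close>
    define c where "c = (\<Sum>a\<in>J. \<bar>l a\<bar>) + \<bar>q0\<bar> + 1"
    define S' where "S' = (\<lambda>(i, j). S (i, j) - c * (\<Sum>a\<in>J. e a i * e a j))"
    have S': "lin_map I S' x i = lin_map I S x i - c * (\<Sum>a\<in>J. vinner I (e a) x * e a i)" if "i \<in> I" for x i
    proof -
      have "(\<Sum>j\<in>I. (\<Sum>a\<in>J. e a i * e a j) * x j) = (\<Sum>a\<in>J. vinner I (e a) x * e a i)"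
        unfolding vinner_def sum_distrib_right by (subst sum.swap) (simp add: mult_ac)
      moreover have "lin_map I S' x i = (\<Sum>j\<in>I. S (i, j) * x j - c * ((\<Sum>a\<in>J. e a i * e a j) * x j))"
        using that by (simp add: lin_map_def S'_def left_diff_distrib mult.assoc)
      moreover have "\<dots> = lin_map I S x i - c * (\<Sum>j\<in>I. (\<Sum>a\<in>J. e a i * e a j) * x j)"
        using that by (simp only: sum_subtractf sum_distrib_left[symmetric]) (simp add: lin_map_def)
      ultimately show ?thesis by simp
    qed
    have sym': "S' (i, j) = S' (j, i)" if "i \<in> I" "j \<in> I" for i j
      using sym[OF that] by (simp add: S'_def mult.commute)
    obtain v m where v: "vinner I v v = 1" "\<And>i. i \<in> I \<Longrightarrow> lin_map I S' v i = m * v i"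
        "\<And>x. vinner I (lin_map I S' x) x \<le> m * vinner I x x"
      using top_eigenvector[OF I, of S'] insert sym' by blast
    have "vinner I (lin_map I S' x0) x0 = vinner I (lin_map I S x0) x0"
      by (rule vinner_cong) (auto simp: S' x0)
    then have "vinner I (lin_map I S x0) x0 \<le> m * vinner I x0 x0" using v(3)[of x0] by simp
    then have q0: "q0 \<le> m" using x0(1) vinner_self_nonneg[of I x0] by (simp add: q0_def divide_le_eq)
    have vorth: "vinner I (e a) v = 0" if a: "a \<in> J" for a
    proof -
      have "vinner I (lin_map I S' (e a)) v = vinner I (\<lambda>i. (l a - c) * e a i) v"
      proof (rule vinner_cong)
        fix i assume i: "i \<in> I"
        have "(\<Sum>a'\<in>J. vinner I (e a') (e a) * e a' i) = e a i"
          using a insert(1) by (simp add: orth if_distrib[of "\<lambda>x. x * _"] cong: if_cong)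
        then show "lin_map I S' (e a) i = (l a - c) * e a i"
          unfolding S'[OF i] eig[OF a i] by (simp add: algebra_simps)
      qed simp
      moreover have "vinner I (lin_map I S' (e a)) v = m * vinner I (e a) v"
      proof -
        have "vinner I (lin_map I S' (e a)) v = vinner I (e a) (lin_map I (\<lambda>(i, j). S' (j, i)) v)"
          by (rule lin_map_adjoint)
        also have "\<dots> = vinner I (e a) (\<lambda>i. m * v i)"
        proof (rule vinner_cong)
          fix i assume i: "i \<in> I"
          have "lin_map I (\<lambda>(i, j). S' (j, i)) v i = lin_map I S' v i"
            using i sym' by (auto simp: lin_map_def intro!: sum.cong)
          then show "lin_map I (\<lambda>(i, j). S' (j, i)) v i = m * v i" using v(2)[OF i] by simp
        qed simp
        finally show ?thesis by (simp add: vinner_linear)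
      qed
      ultimately have "(m - l a + c) * vinner I (e a) v = 0"
        unfolding vinner_scale_left by (simp add: left_diff_distrib distrib_right)
      moreover have "m - l a + c > 0"
      proof -
        have "\<bar>l a\<bar> \<le> (\<Sum>a\<in>J. \<bar>l a\<bar>)" using a insert(1) by (intro member_le_sum) auto
        then show ?thesis using q0 unfolding c_def by linarith
      qed
      ultimately show ?thesis by simp
    qed
    have "good (insert b J) (e(b := v)) (l(b := m))"
      unfolding good_def
    proof (intro conjI ballI)
      fix x y assume "x \<in> insert b J" "y \<in> insert b J"
      then show "vinner I ((e(b := v)) x) ((e(b := v)) y) = (if x = y then 1 else 0)"
        using v(1) vorth orth insert.hyps vorth[unfolded vinner_commute[of I _ v]] by (auto split: if_splits)
    next
      fix a i assume a: "a \<in> insert b J" and i: "i \<in> I"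
      have "lin_map I S v i = m * v i" using S'[OF i, of v] v(2)[OF i] by (simp add: vorth)
      then show "lin_map I S ((e(b := v)) a) i = (l(b := m)) a * (e(b := v)) a i"
        using a i eig by auto
    qed
    then show ?case by blast
  qed
  from this[of I] I obtain e l where g: "good I e l" by auto
  have orth: "(\<Sum>j\<in>I. e a j * e a' j) = (if a = a' then 1 else 0)" if "a \<in> I" "a' \<in> I" for a a'
    using g that by (simp add: good_def vinner_def)
  \<comment> \<open>Orthonormal rows imply orthonormal columns: the inverse of the matrix with rows
    \<open>e a\<close> must be its transpose, and a left kernel vector would have zero
    coefficients.\<close>
  have compl: "(\<Sum>a\<in>I. e a i * e a k) = (if i = k then 1 else 0)" if ik: "i \<in> I" "k \<in> I" for i k
  proof (cases rule: square_system_cases[OF I, where A = "\<lambda>(i, j). e i j", case_names inverse singular])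
    case (inverse B)
    have B: "B (j, b) = e b j" if "j \<in> I" "b \<in> I" for j b
    proof -
      have "B (j, b) = (\<Sum>a\<in>I. B (j, a) * (\<Sum>k\<in>I. e a k * e b k))"
        using that I by (simp add: orth if_distrib[of "\<lambda>x. _ * x"] cong: if_cong)
      also have "\<dots> = (\<Sum>k\<in>I. (\<Sum>a\<in>I. B (j, a) * e a k) * e b k)"
        unfolding sum_distrib_left sum_distrib_right by (subst sum.swap) (simp add: mult_ac)
      also have "\<dots> = (\<Sum>k\<in>I. (if j = k then 1 else 0) * e b k)"
        by (intro sum.cong) (use inverse(2)[OF that(1)] in auto)
      also have "\<dots> = e b j" using that I by (simp add: if_distrib[of "\<lambda>x. x * _"] cong: if_cong)
      finally show ?thesis .
    qed
    show ?thesis using inverse(2)[OF ik] by (simp add: B ik)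
  next
    case (singular v w)
    have "w b = 0" if b: "b \<in> I" for b
    proof -
      have "w b = (\<Sum>a\<in>I. w a * (\<Sum>j\<in>I. e a j * e b j))"
        using b I by (simp add: orth if_distrib[of "\<lambda>x. _ * x"] cong: if_cong)
      also have "\<dots> = (\<Sum>j\<in>I. (\<Sum>a\<in>I. e a j * w a) * e b j)"
        unfolding sum_distrib_left sum_distrib_right by (subst sum.swap) (simp add: mult_ac)
      also have "\<dots> = 0" using singular(4) by (intro sum.neutral) auto
      finally show ?thesis .
    qed
    then show ?thesis using singular(3) by auto
  qed
  show thesis
  proof (rule that)
    show "vinner I (e a) (e b) = (if a = b then 1 else 0)" if "a \<in> I" "b \<in> I" for a b
      using g that by (simp add: good_def)
    show "lin_map I S (e a) i = l a * e a i" if "a \<in> I" "i \<in> I" for a i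
      using g that by (simp add: good_def)
  qed (rule compl)
qed

section \<open>Singular values and the geometry of a matrix\<close>

lemma proots_prod_linear: "proots (\<Prod>a\<leftarrow>xs. [:- a, 1:]) = mset (xs :: real list)"
proof (induction xs)
  case (Cons a xs)
  have "(\<Prod>a\<leftarrow>xs. [:- a, 1:]) \<noteq> 0" by (auto simp: prod_list_zero_iff)
  moreover have "proots [:- a, 1:] = {#a#}"
    by (rule multiset_eqI) (simp add: order_linear' split: if_splits)
  ultimately show ?case using Cons by (simp add: proots_mult del: mult_pCons_left)
qed simp

text \<open>\<open>e\<close> is an eigenbasis of the transpose of T times T; its image under T is
  orthogonal, and the lengths of the images are the square roots of the eigenvalues. The equality is
  one of multisets because \<open>e\<close> is not ordered by eigenvalue. Later facts on singular
  values come from this basis and not from the characteristic polynomial.\<close>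

lemma singular_values_basis:
  obtains e where
    "\<And>a b. a < d \<Longrightarrow> b < d \<Longrightarrow> vinner {..<d} (e a) (e b) = (if a = b then 1 else 0)"
    "\<And>i k. i < d \<Longrightarrow> k < d \<Longrightarrow> (\<Sum>a<d. e a i * e a k) = (if i = k then 1 else 0)"
    "\<And>a b. a < d \<Longrightarrow> b < d \<Longrightarrow> a \<noteq> b \<Longrightarrow> vinner {..<d} (lin_map {..<d} T (e a)) (lin_map {..<d} T (e b)) = 0"
    "mset (singular_values d T) = mset (map (\<lambda>a. L2_set (lin_map {..<d} T (e a)) {..<d}) [0..<d])"
proof -
  define S where "S = (\<lambda>(i, j). \<Sum>k<d. T (k, i) * T (k, j) :: real)"
  obtain e l where e: "\<And>a b. a \<in> {..<d} \<Longrightarrow> b \<in> {..<d} \<Longrightarrow> vinner {..<d} (e a) (e b) = (if a = b then 1 else 0)"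
    "\<And>i k. i \<in> {..<d} \<Longrightarrow> k \<in> {..<d} \<Longrightarrow> (\<Sum>a<d. e a i * e a k) = (if i = k then 1 else 0)"
    "\<And>a i. a \<in> {..<d} \<Longrightarrow> i \<in> {..<d} \<Longrightarrow> lin_map {..<d} S (e a) i = l a * e a i"
    by (rule spectral_basis[of "{..<d}" S]) (auto simp: S_def mult.commute)
  have TT: "vinner {..<d} (lin_map {..<d} T x) (lin_map {..<d} T y) = vinner {..<d} x (lin_map {..<d} S y)" for x y
  proof -
    have "lin_map {..<d} (\<lambda>(i, j). T (j, i)) (lin_map {..<d} T y) i = lin_map {..<d} S y i" if "i < d" for i
    proof -
      have "(\<Sum>j<d. T (j, i) * (\<Sum>k<d. T (j, k) * y k)) = (\<Sum>k<d. (\<Sum>j<d. T (j, i) * T (j, k)) * y k)"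
        unfolding sum_distrib_left sum_distrib_right by (subst sum.swap) (simp add: mult_ac)
      then show ?thesis using that by (simp add: lin_map_def S_def)
    qed
    then show ?thesis unfolding lin_map_adjoint by (intro vinner_cong) auto
  qed
  have Te: "vinner {..<d} (lin_map {..<d} T (e a)) (lin_map {..<d} T (e b)) = (if a = b then l a else 0)"
    if "a < d" "b < d" for a b
  proof -
    have "vinner {..<d} (lin_map {..<d} T (e a)) (lin_map {..<d} T (e b)) = vinner {..<d} (e a) (\<lambda>i. l b * e b i)"
      unfolding TT by (rule vinner_cong) (use e that in auto)
    then show ?thesis using e(1)[of a b] that by (simp add: vinner_linear)
  qed
  have l: "L2_set (lin_map {..<d} T (e a)) {..<d} = sqrt (l a)" if "a < d" for a
    using Te[OF that that] vinner_self_L2[of "{..<d}" "lin_map {..<d} T (e a)"]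
    by (metis L2_set_nonneg real_sqrt_unique)
  define M where "M = Matrix.mat d d T"
  define P where "P = Matrix.mat d d (\<lambda>(i, a). e a i)"
  define D where "D = Matrix.mat d d (\<lambda>(a, b). if a = b then l a else 0)"
  have car: "M \<in> carrier_mat d d" "P \<in> carrier_mat d d" "D \<in> carrier_mat d d" "transpose_mat P \<in> carrier_mat d d"
      "transpose_mat M * M \<in> carrier_mat d d"
    by (auto simp: M_def P_def D_def)
  have PP: "transpose_mat P * P = 1\<^sub>m d"
    by (rule eq_matI) (auto simp: P_def scalar_prod_def lessThan_atLeast0[symmetric] e(1)[unfolded vinner_def])
  have PP': "P * transpose_mat P = 1\<^sub>m d"
    by (rule eq_matI) (auto simp: P_def scalar_prod_def lessThan_atLeast0[symmetric] e(2))
  have MM: "transpose_mat M * M * P = P * D"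
  proof (rule eq_matI)
    fix i a assume "i < dim_row (P * D)" "a < dim_col (P * D)"
    then have ia: "i < d" "a < d" by (auto simp: P_def D_def)
    have "(transpose_mat M * M * P) $$ (i, a) = (\<Sum>k<d. S (i, k) * e a k)"
      using ia by (simp add: P_def M_def S_def scalar_prod_def lessThan_atLeast0)
    also have "\<dots> = l a * e a i" using e(3)[of a i] ia by (simp add: lin_map_def)
    also have "\<dots> = (P * D) $$ (i, a)"
      using ia by (simp add: P_def D_def scalar_prod_def if_distrib[of "\<lambda>x. _ * x"] mult.commute cong: if_cong)
    finally show "(transpose_mat M * M * P) $$ (i, a) = (P * D) $$ (i, a)" .
  qed (auto simp: P_def D_def M_def)
  have "transpose_mat M * M = transpose_mat M * M * (P * transpose_mat P)"
    using car(5) unfolding PP' by (rule right_mult_one_mat[symmetric])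
  also have "\<dots> = (transpose_mat M * M * P) * transpose_mat P"
    using car by (simp add: assoc_mult_mat[of _ d d _ d _ d])
  finally have "transpose_mat M * M = P * D * transpose_mat P" unfolding MM .
  then have "similar_mat (transpose_mat M * M) D"
    by (intro similar_matI[of _ _ P "transpose_mat P" d]) (use car PP PP' in auto)
  then have "char_poly (transpose_mat M * M) = char_poly D" by (rule char_poly_similar)
  also have "\<dots> = (\<Prod>a\<leftarrow>diag_mat D. [:- a, 1:])"
    by (rule char_poly_upper_triangular[OF car(3)]) (auto simp: D_def upper_triangular_def)
  also have "diag_mat D = map l [0..<d]" by (auto simp: diag_mat_def D_def)
  finally have "proots (char_poly (transpose_mat M * M)) = mset (map l [0..<d])"
    by (simp only: proots_prod_linear)
  then have "mset (singular_values d T) = mset (map (\<lambda>a. sqrt (l a)) [0..<d])"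
    by (simp add: singular_values_def M_def[symmetric] Let_def image_mset.compositionality o_def)
  also have "map (\<lambda>a. sqrt (l a)) [0..<d] = map (\<lambda>a. L2_set (lin_map {..<d} T (e a)) {..<d}) [0..<d]"
    using l by auto
  finally have ms: "mset (singular_values d T) = mset (map (\<lambda>a. L2_set (lin_map {..<d} T (e a)) {..<d}) [0..<d])" .
  show thesis
  proof (rule that)
    show "vinner {..<d} (e a) (e b) = (if a = b then 1 else 0)" if "a < d" "b < d" for a b
      using e(1) that by simp
    show "(\<Sum>a<d. e a i * e a k) = (if i = k then 1 else 0)" if "i < d" "k < d" for i k
      using e(2) that by simp
    show "vinner {..<d} (lin_map {..<d} T (e a)) (lin_map {..<d} T (e b)) = 0"
      if "a < d" "b < d" "a \<noteq> b" for a b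
      using Te[OF that(1,2)] that(3) by simp
  qed (rule ms)
qed

lemma length_singular_values: "length (singular_values d T) = d"
proof -
  obtain e where e: "mset (singular_values d T) = mset (map (\<lambda>a. L2_set (lin_map {..<d} T (e a)) {..<d}) [0..<d])"
    by (rule singular_values_basis[of d T]) blast
  from arg_cong[OF this, of size] show ?thesis by simp
qed

lemma sum_list_singular_values: "sum_list (singular_values d T) = (\<Sum>i<d. singular_vector d T i)"
  by (simp add: sum_list_sum_nth length_singular_values singular_vector_def atLeast0LessThan)

lemma expand_in_basis:
  fixes d :: nat
  assumes "\<And>i k. i < d \<Longrightarrow> k < d \<Longrightarrow> (\<Sum>a<d. e a i * e a k) = (if i = k then 1 else (0::real))"
    and "i < d"
  shows "v i = (\<Sum>a<d. vinner {..<d} (e a) v * e a i)"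
proof -
  have "(\<Sum>a<d. vinner {..<d} (e a) v * e a i) = (\<Sum>k<d. (\<Sum>a<d. e a i * e a k) * v k)"
    unfolding vinner_def sum_distrib_left sum_distrib_right by (subst sum.swap) (simp add: mult_ac)
  also have "\<dots> = (\<Sum>k<d. if i = k then v k else 0)"
    by (intro sum.cong refl) (use assms in auto)
  also have "\<dots> = v i" using assms(2) by simp
  finally show ?thesis by simp
qed

text \<open>Pythagoras: in the basis of right singular vectors the images of the components of v are
  orthogonal. For d = 0 the maximum of the empty list of singular values is multiplied by 0.\<close>

lemma schatten_inf_upper: "L2_set (lin_map {..<d} T v) {..<d} \<le> schatten_inf d T * L2_set v {..<d}"
proof (cases "d = 0")
  case False
  let ?I = "{..<d}"
  obtain e where e: "\<And>a b. a < d \<Longrightarrow> b < d \<Longrightarrow> vinner ?I (e a) (e b) = (if a = b then 1 else 0)"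
    "\<And>i k. i < d \<Longrightarrow> k < d \<Longrightarrow> (\<Sum>a<d. e a i * e a k) = (if i = k then 1 else 0)"
    "\<And>a b. a < d \<Longrightarrow> b < d \<Longrightarrow> a \<noteq> b \<Longrightarrow> vinner ?I (lin_map ?I T (e a)) (lin_map ?I T (e b)) = 0"
    "mset (singular_values d T) = mset (map (\<lambda>a. L2_set (lin_map ?I T (e a)) ?I) [0..<d])"
    by (rule singular_values_basis[of d T]) blast
  define m where "m = schatten_inf d T"
  have set: "set (singular_values d T) = (\<lambda>a. L2_set (lin_map ?I T (e a)) ?I) ` ?I"
    using arg_cong[OF e(4), of set_mset] by (simp add: lessThan_atLeast0)
  have m: "L2_set (lin_map ?I T (e a)) ?I \<le> m" if "a < d" for a
    unfolding m_def schatten_inf_def using that set by (intro Max_ge) auto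
  have m0: "0 \<le> m" using order_trans[OF L2_set_nonneg m[of 0]] False by simp
  define c where "c = (\<lambda>a. vinner ?I (e a) v)"
  have Tv: "lin_map ?I T v i = (\<Sum>a<d. c a * lin_map ?I T (e a) i)" if "i < d" for i
  proof -
    have "lin_map ?I T v i = (\<Sum>j<d. T (i, j) * (\<Sum>a<d. c a * e a j))"
      using that expand_in_basis[OF e(2), of _ v] by (simp add: lin_map_def c_def)
    also have "\<dots> = (\<Sum>a<d. c a * (\<Sum>j<d. T (i, j) * e a j))"
      unfolding sum_distrib_left by (subst sum.swap) (simp add: mult_ac)
    finally show ?thesis using that by (simp add: lin_map_def)
  qed
  have "vinner ?I (lin_map ?I T v) (lin_map ?I T v)
      = vinner ?I (\<lambda>i. \<Sum>a<d. c a * lin_map ?I T (e a) i) (\<lambda>i. \<Sum>a<d. c a * lin_map ?I T (e a) i)"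
    by (rule vinner_cong) (auto simp: Tv)
  also have "\<dots> = (\<Sum>a<d. \<Sum>b<d. c a * c b * vinner ?I (lin_map ?I T (e a)) (lin_map ?I T (e b)))"
    unfolding vinner_sum_right
    by (subst vinner_commute, unfold vinner_sum_right) (simp add: vinner_linear sum_distrib_left mult_ac vinner_commute[of _ "lin_map _ _ _" "lin_map _ _ _"])
  also have "\<dots> = (\<Sum>a<d. \<Sum>b<d. if a = b then (c a)\<^sup>2 * (L2_set (lin_map ?I T (e a)) ?I)\<^sup>2 else 0)"
    by (intro sum.cong refl) (auto simp: e(3) vinner_self_L2 power2_eq_square)
  also have "\<dots> = (\<Sum>a<d. (c a)\<^sup>2 * (L2_set (lin_map ?I T (e a)) ?I)\<^sup>2)" by simp
  also have "\<dots> \<le> (\<Sum>a<d. (c a)\<^sup>2 * m\<^sup>2)"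
    by (intro sum_mono mult_left_mono power_mono) (auto simp: m)
  also have "\<dots> = m\<^sup>2 * vinner ?I v v"
  proof -
    have "vinner ?I v v = vinner ?I v (\<lambda>i. \<Sum>a<d. c a * e a i)"
      by (rule vinner_cong) (use expand_in_basis[OF e(2), of _ v] in \<open>auto simp: c_def\<close>)
    also have "\<dots> = (\<Sum>a<d. (c a)\<^sup>2)"
      by (simp add: vinner_sum_right vinner_linear c_def vinner_commute[of _ v] power2_eq_square)
    finally show ?thesis by (simp only: sum_distrib_left mult.commute[of _ "m\<^sup>2"])
  qed
  finally have "(L2_set (lin_map ?I T v) ?I)\<^sup>2 \<le> (m * L2_set v ?I)\<^sup>2"
    by (simp add: vinner_self_L2 power_mult_distrib)
  then show ?thesis unfolding m_def[symmetric]
    by (rule power2_le_imp_le) (simp add: m0)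
qed simp

lemma L2_set_eq_1: "vinner I x x = 1 \<Longrightarrow> L2_set x I = 1"
  using vinner_self_L2[of I x] L2_set_nonneg[of x I] by (simp add: power2_eq_1_iff)

lemma schatten_inf_attained:
  assumes "d > 0"
  obtains v where "L2_set v {..<d} = 1" "L2_set (lin_map {..<d} T v) {..<d} = schatten_inf d T"
proof -
  obtain e where e: "\<And>a b. a < d \<Longrightarrow> b < d \<Longrightarrow> vinner {..<d} (e a) (e b) = (if a = b then 1 else 0)"
    "mset (singular_values d T) = mset (map (\<lambda>a. L2_set (lin_map {..<d} T (e a)) {..<d}) [0..<d])"
    by (rule singular_values_basis[of d T]) blast
  have set: "set (singular_values d T) = (\<lambda>a. L2_set (lin_map {..<d} T (e a)) {..<d}) ` {..<d}"
    using arg_cong[OF e(2), of set_mset] by (simp add: lessThan_atLeast0)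
  have "schatten_inf d T \<in> set (singular_values d T)"
    unfolding schatten_inf_def using length_singular_values[of d T] assms by (intro Max_in) auto
  then obtain a where "a < d" "schatten_inf d T = L2_set (lin_map {..<d} T (e a)) {..<d}"
    unfolding set by auto
  then show thesis using e(1)[of a a]
    by (intro that[of "e a"]) (auto intro: L2_set_eq_1)
qed

lemma singular_vector_bounds:
  assumes "i < d"
  shows "0 \<le> singular_vector d T i" "singular_vector d T i \<le> schatten_inf d T"
proof -
  obtain e where e: "mset (singular_values d T) = mset (map (\<lambda>a. L2_set (lin_map {..<d} T (e a)) {..<d}) [0..<d])"
    by (rule singular_values_basis[of d T]) blast
  have set: "set (singular_values d T) = (\<lambda>a. L2_set (lin_map {..<d} T (e a)) {..<d}) ` {..<d}"
    using arg_cong[OF e, of set_mset] by (simp add: lessThan_atLeast0)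
  have mem: "singular_vector d T i \<in> set (singular_values d T)"
    using assms by (simp add: singular_vector_def length_singular_values)
  then show "0 \<le> singular_vector d T i" unfolding set by auto
  show "singular_vector d T i \<le> schatten_inf d T"
    unfolding schatten_inf_def using mem by (intro Max_ge) auto
qed

text \<open>The inner product of two matrices may be computed in any orthonormal basis. In the basis
  of right singular vectors of T each term is at most |Y e| |T e| \<le> c |T e|, and the lengths |T
  e| are the singular values.\<close>

lemma trace_duality:
  assumes Y: "\<And>v. L2_set (lin_map {..<d} Y v) {..<d} \<le> c * L2_set v {..<d}"
  shows "vinner (mat_idx d) Y T \<le> c * (\<Sum>i<d. singular_vector d T i)"
proof -
  let ?I = "{..<d}"
  obtain e where e: "\<And>a b. a < d \<Longrightarrow> b < d \<Longrightarrow> vinner ?I (e a) (e b) = (if a = b then 1 else 0)"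
    "\<And>i k. i < d \<Longrightarrow> k < d \<Longrightarrow> (\<Sum>a<d. e a i * e a k) = (if i = k then 1 else 0)"
    "mset (singular_values d T) = mset (map (\<lambda>a. L2_set (lin_map ?I T (e a)) ?I) [0..<d])"
    by (rule singular_values_basis[of d T]) blast
  have "(\<Sum>a<d. vinner ?I (lin_map ?I Y (e a)) (lin_map ?I T (e a)))
      = (\<Sum>a<d. \<Sum>i<d. (\<Sum>j<d. Y (i, j) * e a j) * (\<Sum>k<d. T (i, k) * e a k))"
    by (simp add: vinner_def lin_map_def)
  also have "\<dots> = (\<Sum>i<d. \<Sum>a<d. \<Sum>j<d. \<Sum>k<d. Y (i, j) * T (i, k) * (e a j * e a k))"
    by (subst sum.swap, unfold sum_product) (simp only: mult_ac)
  also have "\<dots> = (\<Sum>i<d. \<Sum>j<d. \<Sum>k<d. Y (i, j) * T (i, k) * (\<Sum>a<d. e a j * e a k))"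
  proof (rule sum.cong[OF refl])
    fix i
    have "(\<Sum>a<d. \<Sum>j<d. \<Sum>k<d. Y (i, j) * T (i, k) * (e a j * e a k))
        = (\<Sum>j<d. \<Sum>a<d. \<Sum>k<d. Y (i, j) * T (i, k) * (e a j * e a k))" by (rule sum.swap)
    also have "\<dots> = (\<Sum>j<d. \<Sum>k<d. \<Sum>a<d. Y (i, j) * T (i, k) * (e a j * e a k))"
      by (intro sum.cong refl sum.swap)
    finally show "(\<Sum>a<d. \<Sum>j<d. \<Sum>k<d. Y (i, j) * T (i, k) * (e a j * e a k))
        = (\<Sum>j<d. \<Sum>k<d. Y (i, j) * T (i, k) * (\<Sum>a<d. e a j * e a k))"
      by (simp add: sum_distrib_left)
  qed
  also have "\<dots> = (\<Sum>i<d. \<Sum>j<d. Y (i, j) * T (i, j))"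
    by (simp add: e(2) if_distrib[of "\<lambda>x. _ * x"] cong: if_cong)
  also have "\<dots> = vinner (mat_idx d) Y T"
    by (simp add: vinner_def sum.cartesian_product)
  finally have "vinner (mat_idx d) Y T = (\<Sum>a<d. vinner ?I (lin_map ?I Y (e a)) (lin_map ?I T (e a)))" ..
  also have "\<dots> \<le> (\<Sum>a<d. c * L2_set (lin_map ?I T (e a)) ?I)"
  proof (rule sum_mono)
    fix a assume "a \<in> ?I"
    then have "L2_set (e a) ?I = 1" using e(1)[of a a] by (auto intro: L2_set_eq_1)
    then have "L2_set (lin_map ?I Y (e a)) ?I \<le> c" using Y[of "e a"] by simp
    then have "L2_set (lin_map ?I Y (e a)) ?I * L2_set (lin_map ?I T (e a)) ?I \<le> c * L2_set (lin_map ?I T (e a)) ?I"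
      by (intro mult_right_mono) auto
    then show "vinner ?I (lin_map ?I Y (e a)) (lin_map ?I T (e a)) \<le> c * L2_set (lin_map ?I T (e a)) ?I"
      using vinner_cauchy_schwarz[of ?I "lin_map ?I Y (e a)" "lin_map ?I T (e a)"] by linarith
  qed
  also have "\<dots> = c * sum_list (map (\<lambda>a. L2_set (lin_map ?I T (e a)) ?I) [0..<d])"
    by (simp only: sum_distrib_left[symmetric] interv_sum_list_conv_sum_set_nat set_upt atLeast0LessThan)
  also have "\<dots> = c * sum_list (singular_values d T)"
    by (simp only: sum_mset_sum_list[symmetric] e(3))
  also have "\<dots> = c * (\<Sum>i<d. singular_vector d T i)"
    by (simp only: sum_list_singular_values)
  finally show ?thesis .
qed

subsection \<open>Unitary invariant norms and nets\<close>

lemma coord_space_iff: "x \<in> coord_space I \<longleftrightarrow> (\<forall>i. i \<notin> I \<longrightarrow> x i = undefined)"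
  by (auto simp: coord_space_def PiE_iff extensional_def)

lemma restrict_coord_space [simp]: "restrict x I \<in> coord_space I"
  by (simp add: coord_space_iff)

lemma vadd_coord_space [simp]: "vadd I x y \<in> coord_space I"
  by (simp add: vadd_def)

lemma vscale_coord_space [simp]: "vscale I c x \<in> coord_space I"
  by (simp add: vscale_def)

lemma singular_vector_coord_space [simp]: "singular_vector d T \<in> coord_space {..<d}"
  by (simp add: singular_vector_def)

lemma ones_coord_space [simp]: "ones d \<in> coord_space {..<d}"
  by (simp add: ones_def)

lemma coord_space_eqI: "x \<in> coord_space I \<Longrightarrow> y \<in> coord_space I \<Longrightarrow> (\<And>i. i \<in> I \<Longrightarrow> x i = y i) \<Longrightarrow> x = y"
  unfolding coord_space_def by (rule PiE_ext)

lemma norm_on_sum: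
  assumes N: "norm_on I N" and K: "finite K" and f: "\<And>k. k \<in> K \<Longrightarrow> f k \<in> coord_space I"
  shows "N (\<lambda>i\<in>I. \<Sum>k\<in>K. f k i) \<le> (\<Sum>k\<in>K. N (f k))"
  using K f
proof (induction K rule: finite_induct)
  case empty
  have "N (\<lambda>i\<in>I. 0) = 0" using N by (simp add: norm_on_def)
  then show ?case by (simp only: sum.empty)
next
  case (insert k K)
  have eq: "(\<lambda>i\<in>I. \<Sum>k\<in>insert k K. f k i) = vadd I (f k) (\<lambda>i\<in>I. \<Sum>k\<in>K. f k i)"
    using insert by (auto simp: vadd_def)
  have "N (vadd I (f k) (\<lambda>i\<in>I. \<Sum>k\<in>K. f k i)) \<le> N (f k) + N (\<lambda>i\<in>I. \<Sum>k\<in>K. f k i)"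
    using N insert.prems by (simp add: norm_on_def)
  moreover have "N (\<lambda>i\<in>I. \<Sum>k\<in>K. f k i) \<le> (\<Sum>k\<in>K. N (f k))"
    using insert.IH insert.prems by blast
  ultimately have "N (\<lambda>i\<in>I. \<Sum>k\<in>insert k K. f k i) \<le> N (f k) + (\<Sum>k\<in>K. N (f k))"
    unfolding eq by linarith
  also have "\<dots> = (\<Sum>k\<in>insert k K. N (f k))" using insert.hyps by simp
  finally show ?case .
qed

text \<open>The coordinates of x are replaced by those of y one at a time. Each intermediate vector
  is a convex combination, with weights (1 + t) / 2 and (1 - t) / 2, of its successor and the
  reflection of the successor in one coordinate; both have the same norm.\<close>

lemma one_symmetric_norm_mono:
  assumes tau: "one_symmetric_norm d \<tau>"
    and x: "x \<in> coord_space {..<d}" and y: "y \<in> coord_space {..<d}"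
    and le: "\<And>i. i < d \<Longrightarrow> \<bar>x i\<bar> \<le> \<bar>y i\<bar>"
  shows "\<tau> x \<le> \<tau> y"
proof -
  have N: "norm_on {..<d} \<tau>" using tau by (simp add: one_symmetric_norm_def)
  define z where "z = (\<lambda>k. \<lambda>i\<in>{..<d}. if i < k then y i else x i)"
  have zc: "z k \<in> coord_space {..<d}" for k by (simp add: z_def)
  have step: "\<tau> (z k) \<le> \<tau> (z (Suc k))" if k: "k < d" for k
  proof -
    \<comment> \<open>If y k = 0, then x k = 0 as well, and division by zero gives t = 0, which is
      the right value.\<close>
    define t where "t = x k / y k"
    have t: "\<bar>t\<bar> \<le> 1" "x k = t * y k"
      using le[OF k] by (auto simp: t_def abs_divide divide_le_eq)
    define w where "w = (\<lambda>i\<in>{..<d}. (if i = k then -1 else 1) * z (Suc k) i)"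
    have sgn: "\<tau> (\<lambda>i\<in>{..<d}. s i * z (Suc k) i) = \<tau> (z (Suc k))" if "\<forall>i<d. s i \<in> {-1, 1}" for s
      using tau zc that unfolding one_symmetric_norm_def by blast
    have w: "\<tau> w = \<tau> (z (Suc k))"
      unfolding w_def by (rule sgn) simp
    have wc: "w \<in> coord_space {..<d}" by (simp add: w_def)
    have eq: "z k = vadd {..<d} (vscale {..<d} ((1 + t) / 2) (z (Suc k))) (vscale {..<d} ((1 - t) / 2) w)"
    proof (rule coord_space_eqI[OF zc vadd_coord_space])
      fix i assume "i \<in> {..<d}"
      then show "z k i = vadd {..<d} (vscale {..<d} ((1 + t) / 2) (z (Suc k))) (vscale {..<d} ((1 - t) / 2) w) i"
        using k by (cases "i = k") (auto simp: z_def w_def vadd_def vscale_def t(2) field_simps)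
    qed
    have "\<tau> (z k) \<le> \<tau> (vscale {..<d} ((1 + t) / 2) (z (Suc k))) + \<tau> (vscale {..<d} ((1 - t) / 2) w)"
      unfolding eq using N by (simp only: norm_on_def vscale_coord_space)
    also have "\<dots> = \<bar>(1 + t) / 2\<bar> * \<tau> (z (Suc k)) + \<bar>(1 - t) / 2\<bar> * \<tau> w"
      using N zc wc by (simp only: norm_on_def)
    also have "\<dots> = (\<bar>(1 + t) / 2\<bar> + \<bar>(1 - t) / 2\<bar>) * \<tau> (z (Suc k))"
      by (simp only: w distrib_right)
    also have "\<dots> = \<tau> (z (Suc k))"
    proof -
      have "0 \<le> (1 + t) / 2" "0 \<le> (1 - t) / 2" using t(1) by (auto simp: abs_le_iff)
      then show ?thesis by (simp only: abs_of_nonneg) (simp add: field_simps)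
    qed
    finally show ?thesis .
  qed
  have "\<tau> (z 0) \<le> \<tau> (z k)" if "k \<le> d" for k
    using that
  proof (induction k)
    case (Suc k)
    then show ?case using order_trans[OF _ step[of k]] by simp
  qed simp
  moreover have "z 0 = x" by (rule coord_space_eqI[of _ "{..<d}"]) (use x in \<open>auto simp: z_def\<close>)
  moreover have "z d = y" by (rule coord_space_eqI[of _ "{..<d}"]) (use y in \<open>auto simp: z_def\<close>)
  ultimately show ?thesis by auto
qed

lemma cyclic_shift_bij: "i < d \<Longrightarrow> bij_betw (\<lambda>k. (i + k) mod d) {..<d} {..<(d::nat)}"
proof -
  assume i: "i < d"
  have eq: "(i + k) mod d = (if i + k < d then i + k else i + k - d)" if "k < d" for k
    using i that by (simp add: le_mod_geq)
  have "inj_on (\<lambda>k. (i + k) mod d) {..<d}"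
    using i by (intro inj_onI) (auto simp: eq split: if_splits)
  moreover have "(\<lambda>k. (i + k) mod d) ` {..<d} = {..<d}"
    by (rule endo_inj_surj[OF _ _ calculation]) (use i in auto)
  ultimately show ?thesis by (simp add: bij_betw_def)
qed

text \<open>It suffices to average over the d cyclic shifts: their sum is the constant vector with
  entries \<open>\<Sum>i<d. s i\<close>, and every shift has the norm of s.\<close>

lemma one_symmetric_norm_average:
  assumes tau: "one_symmetric_norm d \<tau>" and s: "s \<in> coord_space {..<d}" and d: "d > 0"
  shows "\<bar>\<Sum>i<d. s i\<bar> * \<tau> (ones d) \<le> real d * \<tau> s"
proof -
  have N: "norm_on {..<d} \<tau>" using tau by (simp add: one_symmetric_norm_def)
  define p where "p = (\<lambda>k i. if i < d then (k + i) mod d else i)"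
  have p: "p k permutes {..<d}" if "k < d" for k
  proof (rule bij_imp_permutes)
    show "bij_betw (p k) {..<d} {..<d}"
      using cyclic_shift_bij[OF that] by (rule iffD1[OF bij_betw_cong, rotated]) (simp add: p_def)
  qed (simp add: p_def)
  define f where "f = (\<lambda>k. \<lambda>i\<in>{..<d}. s (p k i))"
  have f: "\<tau> (f k) = \<tau> s" if "k < d" for k
    using tau s p[OF that] by (simp add: one_symmetric_norm_def f_def)
  have "vscale {..<d} (\<Sum>i<d. s i) (ones d) = (\<lambda>i\<in>{..<d}. \<Sum>k<d. f k i)"
  proof (rule coord_space_eqI[of _ "{..<d}"])
    fix i assume i: "i \<in> {..<d}"
    have "(\<Sum>k<d. f k i) = (\<Sum>k<d. s ((i + k) mod d))"
      using i by (simp add: f_def p_def add.commute)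
    also have "\<dots> = (\<Sum>i<d. s i)"
      using i cyclic_shift_bij[of i d] by (intro sum.reindex_bij_betw) auto
    finally show "vscale {..<d} (\<Sum>i<d. s i) (ones d) i = (\<lambda>i\<in>{..<d}. \<Sum>k<d. f k i) i"
      using i by (simp add: vscale_def ones_def)
  qed auto
  then have "\<tau> (vscale {..<d} (\<Sum>i<d. s i) (ones d)) \<le> (\<Sum>k<d. \<tau> (f k))"
    using norm_on_sum[OF N, of "{..<d}" f] by (simp add: f_def)
  also have "\<dots> = real d * \<tau> s" using f by simp
  also have "\<tau> (vscale {..<d} (\<Sum>i<d. s i) (ones d)) = \<bar>\<Sum>i<d. s i\<bar> * \<tau> (ones d)"
    using N by (simp add: norm_on_def)
  finally show ?thesis .
qed

lemma one_symmetric_norm_ones_pos: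
  assumes "one_symmetric_norm d \<tau>" "d > 0"
  shows "\<tau> (ones d) > 0"
proof -
  have N: "norm_on {..<d} \<tau>" using assms(1) by (simp add: one_symmetric_norm_def)
  have "\<tau> (ones d) \<noteq> 0" using N assms(2) by (auto simp: norm_on_def ones_def)
  moreover have "\<tau> (ones d) \<ge> 0" using N by (simp add: norm_on_def)
  ultimately show ?thesis by simp
qed

lemma schatten_inf_nonneg: "0 \<le> schatten_inf d T" if d: "d > 0"
proof -
  obtain v where "L2_set (lin_map {..<d} T v) {..<d} = schatten_inf d T"
    using schatten_inf_attained[OF d, of T] by blast
  then show ?thesis using L2_set_nonneg[of "lin_map {..<d} T v" "{..<d}"] by simp
qed

lemma norm_le_schatten_inf:
  assumes "associated_norm d N \<tau>" "T \<in> coord_space (mat_idx d)" "d > 0"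
  shows "N T \<le> schatten_inf d T * \<tau> (ones d)"
proof -
  have tau: "one_symmetric_norm d \<tau>" and NT: "N T = \<tau> (singular_vector d T)"
    using assms by (auto simp: associated_norm_def)
  have "\<tau> (singular_vector d T) \<le> \<tau> (vscale {..<d} (schatten_inf d T) (ones d))"
    by (rule one_symmetric_norm_mono[OF tau])
      (use singular_vector_bounds[of _ d T] in \<open>auto simp: vscale_def ones_def intro: order_trans[OF _ abs_ge_self]\<close>)
  also have "\<dots> = \<bar>schatten_inf d T\<bar> * \<tau> (ones d)"
    using tau by (simp add: one_symmetric_norm_def norm_on_def)
  finally show ?thesis using schatten_inf_nonneg[OF assms(3)] NT by simp
qed

lemma trace_norm_le:
  assumes "associated_norm d N \<tau>" "T \<in> coord_space (mat_idx d)" "d > 0"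
  shows "(\<Sum>i<d. singular_vector d T i) \<le> real d / \<tau> (ones d) * N T"
proof -
  have tau: "one_symmetric_norm d \<tau>" and NT: "N T = \<tau> (singular_vector d T)"
    using assms by (auto simp: associated_norm_def)
  have "0 \<le> (\<Sum>i<d. singular_vector d T i)" by (intro sum_nonneg singular_vector_bounds) auto
  then show ?thesis
    using one_symmetric_norm_average[OF tau singular_vector_coord_space assms(3), of T]
      one_symmetric_norm_ones_pos[OF tau assms(3)]
    by (simp add: NT field_simps)
qed

text \<open>The lattice points of mesh 1 / (4 sqrt d) in the Euclidean unit ball. The bounds on
  single coordinates already follow from the bound on the sum of squares; they put the lattice
  points into a finite box.\<close>

definition net :: "nat \<Rightarrow> (nat \<Rightarrow> real) set" where
  "net d = (\<lambda>m i. real_of_int (m i) / (4 * sqrt (real d))) `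
     {m \<in> {..<d} \<rightarrow>\<^sub>E {- int (16 * d)..int (16 * d)}. (\<Sum>i<d. (m i)\<^sup>2) \<le> int (16 * d)}"

lemma finite_net: "finite (net d)"
proof -
  have "finite ({..<d} \<rightarrow>\<^sub>E {- int (16 * d)..int (16 * d)})" by (rule finite_PiE) simp_all
  then show ?thesis unfolding net_def by (intro finite_imageI) (rule rev_finite_subset, blast+)
qed

lemma net_nonempty: "net d \<noteq> {}"
proof -
  have "(\<lambda>i\<in>{..<d}. 0) \<in> {m \<in> {..<d} \<rightarrow>\<^sub>E {- int (16 * d)..int (16 * d)}. (\<Sum>i<d. (m i)\<^sup>2) \<le> int (16 * d)}"
    by auto
  then show ?thesis unfolding net_def by blast
qed

lemma net_L2: "z \<in> net d \<Longrightarrow> L2_set z {..<d} \<le> 1"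
proof -
  assume "z \<in> net d"
  then obtain m where m: "z = (\<lambda>i. real_of_int (m i) / (4 * sqrt (real d)))" "(\<Sum>i<d. (m i)\<^sup>2) \<le> int (16 * d)"
    by (auto simp: net_def)
  have "(\<Sum>i<d. (z i)\<^sup>2) = real_of_int (\<Sum>i<d. (m i)\<^sup>2) / (16 * real d)"
    by (simp add: m(1) power_divide power_mult_distrib sum_divide_distrib)
  also have "\<dots> \<le> real_of_int (int (16 * d)) / (16 * real d)"
    by (rule divide_right_mono[OF of_int_le_iff[THEN iffD2, OF m(2)]]) simp
  also have "\<dots> \<le> 1" by simp
  finally show ?thesis by (simp add: L2_set_def)
qed

lemma sum_half_powers_int: "(\<Sum>t\<in>{- int n..int n}. (1/2::real) ^ nat \<bar>t\<bar>) \<le> 3"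
proof -
  have "(\<Sum>t\<in>{- int n..int n}. (1/2::real) ^ nat \<bar>t\<bar>) = 3 - 2 * (1/2) ^ n"
  proof (induction n)
    case (Suc n)
    have "{- int (Suc n)..int (Suc n)} = insert (- int (Suc n)) (insert (int (Suc n)) {- int n..int n})"
      by auto
    then show ?case using Suc by (simp add: nat_add_distrib)
  qed simp
  then show ?thesis by simp
qed

text \<open>Lattice points \<open>m\<close> with \<open>\<Sum> m_i\<^sup>2 \<le> 16 d\<close> are counted with the weight \<open>2 ^ (16 d - \<Sum> \<bar>m_i\<bar>) \<ge> 1\<close>.\<close>

lemma card_net: "real (card (net d)) \<le> (3 * 2 ^ 16) ^ d"
proof -
  define R where "R = {- int (16 * d)..int (16 * d)}"
  define M where "M = {m \<in> {..<d} \<rightarrow>\<^sub>E R. (\<Sum>i<d. (m i)\<^sup>2) \<le> int (16 * d)}"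
  have finR: "finite ({..<d} \<rightarrow>\<^sub>E R)" by (rule finite_PiE) (auto simp: R_def)
  have finM: "finite M" by (rule finite_subset[OF _ finR]) (auto simp: M_def)
  have "real (card (net d)) \<le> real (card M)"
    unfolding net_def M_def R_def[symmetric] by (intro of_nat_mono card_image_le) (use finM in \<open>simp add: M_def\<close>)
  also have "\<dots> = (\<Sum>m\<in>M. 1)" by simp
  also have "\<dots> \<le> (\<Sum>m\<in>M. 2 ^ (16 * d) * (\<Prod>i<d. (1/2) ^ nat \<bar>m i\<bar>))"
  proof (rule sum_mono)
    fix m assume m: "m \<in> M"
    have "(\<Sum>i<d. \<bar>m i\<bar>) \<le> (\<Sum>i<d. (m i)\<^sup>2)"
    proof (rule sum_mono)
      fix i show "\<bar>m i\<bar> \<le> (m i)\<^sup>2"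
      proof (cases "m i = 0")
        case False
        then have "\<bar>m i\<bar> * 1 \<le> \<bar>m i\<bar> * \<bar>m i\<bar>" by (intro mult_left_mono) auto
        then show ?thesis by (simp add: power2_eq_square)
      qed simp
    qed
    also have "\<dots> \<le> int (16 * d)" using m by (simp add: M_def)
    finally have "(\<Sum>i<d. \<bar>m i\<bar>) \<le> int (16 * d)" .
    moreover have "int (\<Sum>i<d. nat \<bar>m i\<bar>) = (\<Sum>i<d. \<bar>m i\<bar>)" by simp
    ultimately have "(\<Sum>i<d. nat \<bar>m i\<bar>) \<le> 16 * d" by linarith
    then have "(1/2::real) ^ (16 * d) \<le> (1/2) ^ (\<Sum>i<d. nat \<bar>m i\<bar>)"
      by (intro power_decreasing) auto
    then have "2 ^ (16 * d) * (1/2::real) ^ (16 * d) \<le> 2 ^ (16 * d) * (1/2) ^ (\<Sum>i<d. nat \<bar>m i\<bar>)"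
      by (intro mult_left_mono) auto
    then show "(1::real) \<le> 2 ^ (16 * d) * (\<Prod>i<d. (1/2) ^ nat \<bar>m i\<bar>)"
      by (simp add: power_sum power_one_over)
  qed
  also have "\<dots> \<le> (\<Sum>m\<in>{..<d} \<rightarrow>\<^sub>E R. 2 ^ (16 * d) * (\<Prod>i<d. (1/2) ^ nat \<bar>m i\<bar>))"
  proof (rule sum_mono2[OF finR])
    show "M \<subseteq> {..<d} \<rightarrow>\<^sub>E R" unfolding M_def by blast
    show "0 \<le> 2 ^ (16 * d) * (\<Prod>i<d. (1/2::real) ^ nat \<bar>m i\<bar>)" for m :: "nat \<Rightarrow> int"
      by (intro mult_nonneg_nonneg prod_nonneg) simp_all
  qed
  also have "\<dots> = 2 ^ (16 * d) * (\<Prod>i<d. \<Sum>t\<in>R. (1/2) ^ nat \<bar>t\<bar>)"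
    by (subst prod_sum_PiE) (auto simp: R_def sum_distrib_left)
  also have "\<dots> \<le> 2 ^ (16 * d) * (\<Prod>i<d. 3)"
    unfolding R_def by (intro mult_left_mono prod_mono conjI sum_nonneg sum_half_powers_int) auto
  also have "\<dots> = (3 * 2 ^ 16) ^ d"
    unfolding prod_constant card_lessThan power_mult power_mult_distrib by (rule mult.commute)
  finally show ?thesis .
qed

text \<open>Coordinates are rounded towards 0, so the rounded point does not leave the ball. In
  units of 1 / q, with q = 4 sqrt d, each coordinate is off by at most 1, hence the distance is at
  most sqrt d / q = 1 / 4.\<close>

lemma net_approx:
  assumes x: "L2_set x {..<d} = 1"
  obtains z where "z \<in> net d" "L2_set (\<lambda>i. x i - z i) {..<d} \<le> 1/4"
proof -
  have d: "d > 0" using x by (cases d) auto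
  define q where "q = 4 * sqrt (real d)"
  have q: "q > 0" "q\<^sup>2 = 16 * real d" using d by (auto simp: q_def power_mult_distrib)
  have sx: "(\<Sum>i<d. (x i)\<^sup>2) = 1" using x by (simp add: L2_set_def)
  define m where "m = (\<lambda>i\<in>{..<d}. if 0 \<le> x i then \<lfloor>q * x i\<rfloor> else \<lceil>q * x i\<rceil>)"
  have m1: "\<bar>real_of_int (m i)\<bar> \<le> \<bar>q * x i\<bar>" "\<bar>q * x i - real_of_int (m i)\<bar> \<le> 1" if "i < d" for i
  proof -
    consider "0 \<le> x i" "0 \<le> q * x i" | "x i < 0" "q * x i < 0"
      using q(1) by (meson mult_nonneg_nonneg mult_pos_neg not_le less_imp_le)
    then have "\<bar>real_of_int (m i)\<bar> \<le> \<bar>q * x i\<bar> \<and> \<bar>q * x i - real_of_int (m i)\<bar> \<le> 1"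
    proof cases
      case 1
      then have "0 \<le> \<lfloor>q * x i\<rfloor>" by simp
      then show ?thesis using 1 that by (simp add: m_def) linarith
    next
      case 2
      then have "\<lceil>q * x i\<rceil> \<le> 0" by simp
      then show ?thesis using 2 that by (simp add: m_def) linarith
    qed
    then show "\<bar>real_of_int (m i)\<bar> \<le> \<bar>q * x i\<bar>" "\<bar>q * x i - real_of_int (m i)\<bar> \<le> 1" by auto
  qed
  have "real_of_int (\<Sum>i<d. (m i)\<^sup>2) \<le> (\<Sum>i<d. (q * x i)\<^sup>2)"
    unfolding of_int_sum of_int_power by (rule sum_mono) (use m1 in \<open>auto intro: abs_le_square_iff[THEN iffD1]\<close>)
  also have "\<dots> = 16 * real d" using sx q by (simp add: power_mult_distrib sum_distrib_left[symmetric])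
  finally have ms: "(\<Sum>i<d. (m i)\<^sup>2) \<le> int (16 * d)" by linarith
  have mr: "m i \<in> {- int (16 * d)..int (16 * d)}" if "i < d" for i
  proof -
    have "\<bar>m i\<bar> \<le> (m i)\<^sup>2"
    proof (cases "m i = 0")
      case False
      then have "\<bar>m i\<bar> * 1 \<le> \<bar>m i\<bar> * \<bar>m i\<bar>" by (intro mult_left_mono) auto
      then show ?thesis by (simp add: power2_eq_square)
    qed simp
    also have "\<dots> \<le> (\<Sum>i<d. (m i)\<^sup>2)" using that by (intro member_le_sum) auto
    finally show ?thesis using ms by auto
  qed
  show thesis
  proof (rule that)
    show "(\<lambda>i. real_of_int (m i) / (4 * sqrt (real d))) \<in> net d"
    proof -
      have "m \<in> {..<d} \<rightarrow>\<^sub>E {- int (16 * d)..int (16 * d)}"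
      proof (rule PiE_I)
        show "m i \<in> {- int (16 * d)..int (16 * d)}" if "i \<in> {..<d}" for i
          using mr that by blast
      qed (simp add: m_def)
      then show ?thesis using ms unfolding net_def by blast
    qed
    have "(\<Sum>i<d. (x i - real_of_int (m i) / q)\<^sup>2) \<le> (\<Sum>i<d. (1/q)\<^sup>2)"
    proof (rule sum_mono)
      fix i assume i: "i \<in> {..<d}"
      have "x i - real_of_int (m i) / q = (q * x i - real_of_int (m i)) / q" using q by (simp add: field_simps)
      then have "\<bar>x i - real_of_int (m i) / q\<bar> \<le> 1 / q" using m1(2)[of i] i q by (simp add: abs_divide divide_right_mono)
      then show "(x i - real_of_int (m i) / q)\<^sup>2 \<le> (1/q)\<^sup>2" using q by (intro abs_le_square_iff[THEN iffD1]) auto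
    qed
    also have "\<dots> = (1/4)\<^sup>2" using q d by (simp add: power_divide)
    finally show "L2_set (\<lambda>i. x i - real_of_int (m i) / (4 * sqrt (real d))) {..<d} \<le> 1/4"
      unfolding L2_set_def q_def[symmetric] by (intro real_le_lsqrt) auto
  qed
qed

text \<open>Replacing the two extremal unit vectors by net points, one after the other, costs at
  most a quarter of the norm S each time, so S \<le> c + S / 2. That net points have length at most
  1 is used for the second replacement.\<close>

lemma schatten_inf_le_net:
  assumes d: "d > 0"
    and c: "\<And>u v. u \<in> net d \<Longrightarrow> v \<in> net d \<Longrightarrow> vinner {..<d} u (lin_map {..<d} Y v) \<le> c"
  shows "schatten_inf d Y \<le> 2 * c"
proof -
  let ?I = "{..<d}"
  define S where "S = schatten_inf d Y"
  have S: "L2_set (lin_map ?I Y x) ?I \<le> S * L2_set x ?I" for x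
    unfolding S_def by (rule schatten_inf_upper)
  obtain v where v: "L2_set v ?I = 1" "L2_set (lin_map ?I Y v) ?I = S"
    using schatten_inf_attained[OF d] unfolding S_def by blast
  have S0: "0 \<le> S" using v(2) by (metis L2_set_nonneg)
  show ?thesis
  proof (cases "S = 0")
    case True
    \<comment> \<open>For S = 0 it remains to see 0 \<le> c. Any net point serves, since the form of
      Y vanishes.\<close>
    obtain u where u: "u \<in> net d" using net_nonempty by blast
    have "\<bar>vinner ?I u (lin_map ?I Y u)\<bar> \<le> L2_set u ?I * (S * L2_set u ?I)"
      by (intro order_trans[OF vinner_cauchy_schwarz] mult_left_mono S) simp
    then show ?thesis using c[OF u u] True unfolding S_def[symmetric] by simp
  next
    case False
    then have Sp: "S > 0" using S0 by simp
    define u where "u = (\<lambda>i. (1 / S) * lin_map ?I Y v i)"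
    have "vinner ?I u u = 1"
      unfolding u_def vinner_scale_left vinner_scale_right vinner_self_L2 v(2) using Sp by (simp add: power2_eq_square)
    then have u: "L2_set u ?I = 1" by (rule L2_set_eq_1)
    have uv: "vinner ?I u (lin_map ?I Y v) = S"
      unfolding u_def vinner_scale_left vinner_self_L2 v(2) using Sp by (simp add: power2_eq_square)
    obtain u' where u': "u' \<in> net d" "L2_set (\<lambda>i. u i - u' i) ?I \<le> 1/4" using net_approx[OF u] .
    obtain v' where v': "v' \<in> net d" "L2_set (\<lambda>i. v i - v' i) ?I \<le> 1/4" using net_approx[OF v(1)] .
    have "lin_map ?I Y v i - lin_map ?I Y v' i = lin_map ?I Y (\<lambda>i. v i - v' i) i" if "i < d" for i
      using that by (simp add: lin_map_def right_diff_distrib sum_subtractf)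
    then have "vinner ?I u (lin_map ?I Y (\<lambda>i. v i - v' i)) = vinner ?I u (\<lambda>i. lin_map ?I Y v i - lin_map ?I Y v' i)"
      by (intro vinner_cong) auto
    then have "S = vinner ?I u' (lin_map ?I Y v') + vinner ?I (\<lambda>i. u i - u' i) (lin_map ?I Y v')
        + vinner ?I u (lin_map ?I Y (\<lambda>i. v i - v' i))"
      using uv by (simp add: vinner_diff_left vinner_diff_right)
    also have "\<dots> \<le> c + 1/4 * (S * 1) + 1 * (S * (1/4))"
    proof (intro add_mono)
      show "vinner ?I u' (lin_map ?I Y v') \<le> c" using c u' v' by blast
      have "vinner ?I (\<lambda>i. u i - u' i) (lin_map ?I Y v')
          \<le> L2_set (\<lambda>i. u i - u' i) ?I * L2_set (lin_map ?I Y v') ?I"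
        by (rule order_trans[OF abs_ge_self vinner_cauchy_schwarz])
      also have "\<dots> \<le> 1/4 * (S * 1)"
        using S0 by (intro mult_mono u'(2) order_trans[OF S mult_left_mono] net_L2 v'(1)) auto
      finally show "vinner ?I (\<lambda>i. u i - u' i) (lin_map ?I Y v') \<le> 1/4 * (S * 1)" .
      have "vinner ?I u (lin_map ?I Y (\<lambda>i. v i - v' i))
          \<le> L2_set u ?I * L2_set (lin_map ?I Y (\<lambda>i. v i - v' i)) ?I"
        by (rule order_trans[OF abs_ge_self vinner_cauchy_schwarz])
      also have "\<dots> \<le> 1 * (S * (1/4))"
        using S0 u by (intro mult_mono order_trans[OF S mult_left_mono] v'(2)) auto
      finally show "vinner ?I u (lin_map ?I Y (\<lambda>i. v i - v' i)) \<le> 1 * (S * (1/4))" .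
    qed
    finally show ?thesis unfolding S_def[symmetric] by simp
  qed
qed

subsection \<open>Covering the trace norm ball\<close>

fun step_sums :: "('i \<Rightarrow> real) set \<Rightarrow> nat \<Rightarrow> ('i \<Rightarrow> real) set" where
  "step_sums Z 0 = {\<lambda>_. 0}"
| "step_sums Z (Suc m) = (\<lambda>(s, z) i. s i + z i) ` (step_sums Z m \<times> Z)"

lemma finite_step_sums: "finite Z \<Longrightarrow> finite (step_sums Z m)"
  by (induction m) auto

lemma card_step_sums: "finite Z \<Longrightarrow> card (step_sums Z m) \<le> card Z ^ m"
proof (induction m)
  case (Suc m)
  have "card (step_sums Z (Suc m)) \<le> card (step_sums Z m \<times> Z)"
    unfolding step_sums.simps by (intro card_image_le finite_cartesian_product finite_step_sums Suc.prems)
  also have "\<dots> \<le> card Z ^ m * card Z" using Suc by (simp add: card_cartesian_product)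
  finally show ?case by (simp add: mult.commute)
qed simp

text \<open>Greedy form of Maurey's empirical method: the next summand is chosen so that the cross term
  in the squared error is not positive.\<close>

lemma greedy_approximation:
  assumes Z: "\<And>Y. \<exists>z\<in>Z. vinner J Y T \<le> vinner J Y z"
    and r: "\<And>z. z \<in> Z \<Longrightarrow> vinner J (\<lambda>i. z i - T i) (\<lambda>i. z i - T i) \<le> r"
  shows "\<exists>s\<in>step_sums Z m. vinner J (\<lambda>i. s i - real m * T i) (\<lambda>i. s i - real m * T i) \<le> real m * r"
proof (induction m)
  case 0
  show ?case by (simp add: vinner_def)
next
  case (Suc m)
  then obtain s where s: "s \<in> step_sums Z m"
    "vinner J (\<lambda>i. s i - real m * T i) (\<lambda>i. s i - real m * T i) \<le> real m * r" by blast
  define e where "e = (\<lambda>i. s i - real m * T i)"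
  obtain z where z: "z \<in> Z" "vinner J (\<lambda>i. - 1 * e i) T \<le> vinner J (\<lambda>i. - 1 * e i) z" using Z by blast
  define f where "f = (\<lambda>i. z i - T i)"
  have "vinner J e f \<le> 0" using z(2) unfolding f_def vinner_diff_right vinner_scale_left by simp
  moreover have "vinner J f e = vinner J e f" by (rule vinner_commute)
  ultimately have "vinner J (\<lambda>i. e i + f i) (\<lambda>i. e i + f i) \<le> vinner J e e + vinner J f f"
    unfolding vinner_add_left vinner_add_right by simp
  also have "\<dots> \<le> real m * r + r" using s(2) r[OF z(1)] unfolding e_def f_def by simp
  also have "(\<lambda>i. e i + f i) = (\<lambda>i. (s i + z i) - real (Suc m) * T i)"
    by (simp add: e_def f_def algebra_simps)
  finally show ?case using s(1) z(1)
    by (intro bexI[of _ "\<lambda>i. s i + z i"]) (auto simp: algebra_simps intro!: image_eqI[of _ _ "(s, z)"])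
qed

definition tensor :: "(nat \<Rightarrow> real) \<Rightarrow> (nat \<Rightarrow> real) \<Rightarrow> nat \<times> nat \<Rightarrow> real" where
  "tensor u v = (\<lambda>(i, j). u i * v j)"

lemma vinner_tensor: "vinner (mat_idx d) Y (tensor u v) = vinner {..<d} u (lin_map {..<d} Y v)"
  by (simp add: vinner_def tensor_def lin_map_def sum.cartesian_product' sum_distrib_left mult_ac)

lemma L2_tensor: "L2_set (tensor u v) (mat_idx d) = L2_set u {..<d} * L2_set v {..<d}"
  by (simp add: L2_set_def tensor_def sum.cartesian_product' power_mult_distrib sum_product real_sqrt_mult[symmetric])

text \<open>The factor 2 is that of \<open>schatten_inf_le_net\<close>: it makes the trace norm ball
  of radius \<open>D\<close> lie in the convex hull of the scaled tensors. With d summands there are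
  exp (O(d^2)) centers, which changes a volume in dimension d^2 only by a constant factor per
  dimension.\<close>

definition trace_centers :: "nat \<Rightarrow> real \<Rightarrow> (nat \<times> nat \<Rightarrow> real) set" where
  "trace_centers d D = (\<lambda>s p. s p / real d) ` step_sums ((\<lambda>(u, v) p. 2 * D * tensor u v p) ` (net d \<times> net d)) d"

lemma finite_trace_centers: "finite (trace_centers d D)"
  unfolding trace_centers_def by (intro finite_imageI finite_step_sums finite_cartesian_product finite_net)

lemma card_trace_centers: "real (card (trace_centers d D)) \<le> (3 * 2 ^ 16) ^ (2 * d\<^sup>2)"
proof -
  let ?Z = "(\<lambda>(u, v) p. 2 * D * tensor u v p) ` (net d \<times> net d)"
  have fZ: "finite ?Z" by (intro finite_imageI finite_cartesian_product finite_net)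
  have "card ?Z \<le> card (net d) * card (net d)"
    using card_image_le[of "net d \<times> net d"] finite_net by (simp add: card_cartesian_product)
  moreover have "card (trace_centers d D) \<le> card ?Z ^ d"
    unfolding trace_centers_def
    by (rule order_trans[OF card_image_le card_step_sums]) (use fZ finite_step_sums in auto)
  ultimately have "card (trace_centers d D) \<le> (card (net d) * card (net d)) ^ d"
    by (meson order_trans power_mono zero_le)
  then have "real (card (trace_centers d D)) \<le> (real (card (net d)) * real (card (net d))) ^ d"
    by (metis of_nat_mono of_nat_mult of_nat_power)
  also have "\<dots> \<le> ((3 * 2 ^ 16) ^ d * (3 * 2 ^ 16) ^ d) ^ d"
    by (intro power_mono mult_mono card_net) auto
  also have "\<dots> = (3 * 2 ^ 16) ^ (2 * d\<^sup>2)"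
    by (simp only: power_add[symmetric] power_mult[symmetric]) (simp add: power2_eq_square algebra_simps)
  finally show ?thesis .
qed

text \<open>The greedy method needs that no linear functional separates T from the scaled tensors,
  and this is trace duality combined with the net bound. All vectors involved have length at most 2
  D, so each step adds at most 16 D^2 to the squared error; after d steps it is divided by
  d^2.\<close>

lemma trace_centers_cover:
  assumes d: "d > 0" and T: "(\<Sum>i<d. singular_vector d T i) \<le> D"
  obtains c where "c \<in> trace_centers d D" "(\<Sum>p\<in>mat_idx d. (T p - c p)\<^sup>2) \<le> 16 * D\<^sup>2 / real d"
proof -
  let ?J = "mat_idx d"
  define Z where "Z = (\<lambda>(u, v) p. 2 * D * tensor u v p) ` (net d \<times> net d)"
  have D: "0 \<le> D" by (rule order_trans[OF _ T]) (intro sum_nonneg singular_vector_bounds, simp)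
  have Zs: "\<exists>z\<in>Z. vinner ?J Y T \<le> vinner ?J Y z" for Y
  proof -
    define S where "S = schatten_inf d Y"
    have S0: "0 \<le> S" unfolding S_def by (rule schatten_inf_nonneg[OF d])
    have "vinner ?J Y T \<le> S * (\<Sum>i<d. singular_vector d T i)"
      unfolding S_def by (rule trace_duality[OF schatten_inf_upper])
    also have "\<dots> \<le> S * D" by (rule mult_left_mono[OF T S0])
    finally have YT: "vinner ?J Y T \<le> S * D" .
    define c where "c = Max ((\<lambda>(u, v). vinner {..<d} u (lin_map {..<d} Y v)) ` (net d \<times> net d))"
    have fin: "finite ((\<lambda>(u, v). vinner {..<d} u (lin_map {..<d} Y v)) ` (net d \<times> net d))"
      by (intro finite_imageI finite_cartesian_product finite_net)
    have "c \<in> (\<lambda>(u, v). vinner {..<d} u (lin_map {..<d} Y v)) ` (net d \<times> net d)"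
      unfolding c_def by (rule Max_in[OF fin]) (use net_nonempty in auto)
    then obtain u v where uv: "u \<in> net d" "v \<in> net d" "c = vinner {..<d} u (lin_map {..<d} Y v)" by auto
    have "S \<le> 2 * c" unfolding S_def
    proof (rule schatten_inf_le_net[OF d])
      fix u v assume "u \<in> net d" "v \<in> net d"
      then show "vinner {..<d} u (lin_map {..<d} Y v) \<le> c" unfolding c_def by (intro Max_ge[OF fin]) auto
    qed
    then have "S * D \<le> 2 * c * D" using D by (rule mult_right_mono)
    also have "\<dots> = vinner ?J Y (\<lambda>p. 2 * D * tensor u v p)"
      unfolding vinner_scale_right vinner_tensor uv(3) by (simp add: mult_ac)
    finally show ?thesis using YT uv(1,2) unfolding Z_def
      by (intro bexI[of _ "\<lambda>p. 2 * D * tensor u v p"]) auto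
  qed
  have zL: "L2_set z ?J \<le> 2 * D" if zZ: "z \<in> Z" for z
  proof -
    obtain w where w: "z = (\<lambda>(u, v) p. 2 * D * tensor u v p) w" "w \<in> net d \<times> net d"
      using zZ unfolding Z_def by (rule imageE)
    define u v where "u = fst w" and "v = snd w"
    have uv: "u \<in> net d" "v \<in> net d" "z = (\<lambda>p. 2 * D * tensor u v p)"
      using w by (simp_all add: u_def v_def case_prod_beta mem_Times_iff)
    have "L2_set z ?J = 2 * D * (L2_set u {..<d} * L2_set v {..<d})"
      unfolding uv(3) using D by (simp only: L2_set_right_distrib[symmetric] L2_tensor) 
    also have "\<dots> \<le> 2 * D * (1 * 1)"
      using D by (intro mult_left_mono mult_mono net_L2 uv) auto
    finally show ?thesis by simp
  qed
  \<comment> \<open>The functional given by T itself already bounds the Euclidean length of T by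
    that of some element of \<open>Z\<close>.\<close>
  have TL: "L2_set T ?J \<le> 2 * D"
  proof -
    obtain z where z: "z \<in> Z" "vinner ?J T T \<le> vinner ?J T z" using Zs by blast
    have "L2_set T ?J * L2_set T ?J \<le> L2_set T ?J * L2_set z ?J"
      using z(2) vinner_cauchy_schwarz[of ?J T z] unfolding vinner_self_L2_mult by linarith
    then have "L2_set T ?J \<le> L2_set z ?J"
      using L2_set_nonneg[of T ?J] L2_set_nonneg[of z ?J] by (cases "L2_set T ?J = 0") auto
    then show ?thesis using zL[OF z(1)] by simp
  qed
  have r: "vinner ?J (\<lambda>i. z i - T i) (\<lambda>i. z i - T i) \<le> 16 * D\<^sup>2" if z: "z \<in> Z" for z
  proof -
    have "L2_set (\<lambda>i. z i - T i) ?J \<le> L2_set z ?J + L2_set (\<lambda>i. - T i) ?J"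
      using L2_set_triangle_ineq[of z "\<lambda>i. - T i" ?J] by simp
    also have "L2_set (\<lambda>i. - T i) ?J = L2_set T ?J" by (simp add: L2_set_def)
    finally have "L2_set (\<lambda>i. z i - T i) ?J \<le> 4 * D" using zL[OF z] TL by simp
    then have "(L2_set (\<lambda>i. z i - T i) ?J)\<^sup>2 \<le> (4 * D)\<^sup>2" by (rule power_mono) simp
    then show ?thesis by (simp add: vinner_self_L2 power_mult_distrib)
  qed
  from greedy_approximation[OF Zs r, of d]
  obtain s where s: "s \<in> step_sums Z d"
    "vinner ?J (\<lambda>i. s i - real d * T i) (\<lambda>i. s i - real d * T i) \<le> real d * (16 * D\<^sup>2)" by blast
  show thesis
  proof (rule that)
    show "(\<lambda>p. s p / real d) \<in> trace_centers d D"
      using s(1) unfolding trace_centers_def Z_def by blast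
    have "(\<Sum>p\<in>?J. (T p - s p / real d)\<^sup>2) = (\<Sum>p\<in>?J. (s p - real d * T p)\<^sup>2 / (real d)\<^sup>2)"
    proof (rule sum.cong[OF refl])
      fix p
      have "T p - s p / real d = - ((s p - real d * T p) / real d)" using d by (simp add: field_simps)
      then show "(T p - s p / real d)\<^sup>2 = (s p - real d * T p)\<^sup>2 / (real d)\<^sup>2" by (simp add: power_divide)
    qed
    also have "\<dots> = vinner ?J (\<lambda>i. s i - real d * T i) (\<lambda>i. s i - real d * T i) / (real d)\<^sup>2"
      by (simp add: vinner_def power2_eq_square sum_divide_distrib)
    also have "\<dots> \<le> real d * (16 * D\<^sup>2) / (real d)\<^sup>2" using s(2) by (rule divide_right_mono) simp
    also have "\<dots> = 16 * D\<^sup>2 / real d" using d by (simp add: power2_eq_square)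
    finally show "(\<Sum>p\<in>?J. (T p - s p / real d)\<^sup>2) \<le> 16 * D\<^sup>2 / real d" .
  qed
qed

subsection \<open>Lebesgue and Gaussian measure\<close>

abbreviation leb :: "'i set \<Rightarrow> ('i \<Rightarrow> real) measure" where
  "leb I \<equiv> PiM I (\<lambda>_. lborel)"

interpretation leb: product_sigma_finite "\<lambda>_. lborel :: real measure"
  by standard

interpretation gauss: product_sigma_finite "\<lambda>_. std_normal_distribution"
  by (simp add: product_sigma_finite_def prob_space_normal_density prob_space_imp_sigma_finite)

lemma space_leb [simp]: "space (leb I) = coord_space I"
  by (simp add: space_PiM coord_space_def)

lemma sets_gaussian [measurable_cong]: "sets (gaussian I) = sets (leb I)"
  unfolding gaussian_def by (intro sets_PiM_cong) auto

lemma space_gaussian [simp]: "space (gaussian I) = coord_space I"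
  by (simp add: gaussian_def space_PiM coord_space_def)

lemma prob_space_gaussian: "prob_space (gaussian I)"
  unfolding gaussian_def by (rule prob_space_PiM) (simp add: prob_space_normal_density)

lemma measurable_coordI:
  "(\<And>i. i \<in> I \<Longrightarrow> (\<lambda>\<omega>. f \<omega> i) \<in> borel_measurable N) \<Longrightarrow> (\<lambda>\<omega>. \<lambda>i\<in>I. f \<omega> i) \<in> N \<rightarrow>\<^sub>M leb I"
  by (rule measurable_restrict) simp

lemma measurable_coord:
  "a \<in> N \<rightarrow>\<^sub>M leb I \<Longrightarrow> i \<in> I \<Longrightarrow> (\<lambda>\<omega>. a \<omega> i) \<in> borel_measurable N"
  using measurable_compose[OF _ measurable_component_singleton[of i I "\<lambda>_. lborel"], of a N] by simp

lemma sigma_finite_leb: "finite I \<Longrightarrow> sigma_finite_measure (leb I)"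
  by (rule leb.sigma_finite)

lemma pair_sigma_finite_leb: "finite I \<Longrightarrow> finite J \<Longrightarrow> pair_sigma_finite (leb I) (leb J)"
  by (simp add: pair_sigma_finite_def sigma_finite_leb)

lemma emeasure_lborel_affine:
  assumes "A \<in> sets borel" "s \<noteq> 0"
  shows "emeasure lborel A = ennreal \<bar>s\<bar> * emeasure lborel ((\<lambda>t. c + s * t) -` A)"
proof -
  have m: "(\<lambda>t. c + s * t) -` A \<in> sets borel"
    by (rule measurable_sets_borel[OF _ assms(1)]) simp
  have "emeasure lborel A = (\<integral>\<^sup>+x. indicator A x \<partial>lborel)" using assms by simp
  also have "\<dots> = ennreal \<bar>s\<bar> * (\<integral>\<^sup>+x. indicator A (c + s * x) \<partial>lborel)"
    using assms by (intro nn_integral_real_affine) auto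
  also have "(\<integral>\<^sup>+x. indicator A (c + s * x) \<partial>lborel) = (\<integral>\<^sup>+x. indicator ((\<lambda>t. c + s * t) -` A) x \<partial>lborel)"
    by (intro nn_integral_cong) (simp add: indicator_def)
  finally show ?thesis using m by simp
qed

lemma measurable_affine [measurable]: "(\<lambda>x. \<lambda>i\<in>I. c i + s * x i) \<in> leb I \<rightarrow>\<^sub>M leb I"
  by measurable

lemma leb_affine:
  assumes I: "finite I" and s: "s \<noteq> 0"
  shows "leb I = scale_measure (ennreal (\<bar>s\<bar> ^ card I)) (distr (leb I) (leb I) (\<lambda>x. \<lambda>i\<in>I. c i + s * x i))"
proof (rule leb.PiM_eqI[OF I, symmetric])
  fix A :: "'a \<Rightarrow> real set" assume A: "\<And>i. i \<in> I \<Longrightarrow> A i \<in> sets lborel"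
  have PA: "Pi\<^sub>E I A \<in> sets (leb I)" using A I by (intro sets_PiM_I_finite) auto
  have "(\<lambda>x. \<lambda>i\<in>I. c i + s * x i) -` Pi\<^sub>E I A \<inter> space (leb I) = Pi\<^sub>E I (\<lambda>i. (\<lambda>t. c i + s * t) -` A i)"
    by (auto simp: coord_space_def PiE_iff extensional_def)
  then have "emeasure (scale_measure (ennreal (\<bar>s\<bar> ^ card I)) (distr (leb I) (leb I) (\<lambda>x. \<lambda>i\<in>I. c i + s * x i))) (Pi\<^sub>E I A)
     = ennreal (\<bar>s\<bar> ^ card I) * emeasure (leb I) (Pi\<^sub>E I (\<lambda>i. (\<lambda>t. c i + s * t) -` A i))"
    using PA by (simp add: emeasure_distr)
  also have "\<dots> = (\<Prod>i\<in>I. ennreal \<bar>s\<bar>) * (\<Prod>i\<in>I. emeasure lborel ((\<lambda>t. c i + s * t) -` A i))"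
  proof (subst leb.emeasure_PiM[OF I])
    fix i assume "i \<in> I"
    then show "(\<lambda>t. c i + s * t) -` A i \<in> sets lborel"
      using measurable_sets_borel[of "\<lambda>t. c i + s * t" borel "A i"] A by simp
  qed (simp add: ennreal_power)
  also have "\<dots> = (\<Prod>i\<in>I. emeasure lborel (A i))"
    unfolding prod.distrib[symmetric] using A s
    by (intro prod.cong refl emeasure_lborel_affine[symmetric]) auto
  finally show "emeasure (scale_measure (ennreal (\<bar>s\<bar> ^ card I)) (distr (leb I) (leb I) (\<lambda>x. \<lambda>i\<in>I. c i + s * x i))) (Pi\<^sub>E I A)
     = (\<Prod>i\<in>I. emeasure lborel (A i))" .
qed simp

lemma nn_integral_leb_affine:
  assumes I: "finite I" and s: "s \<noteq> 0" and f[measurable]: "f \<in> borel_measurable (leb I)"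
  shows "(\<integral>\<^sup>+x. f x \<partial>leb I) = ennreal (\<bar>s\<bar> ^ card I) * (\<integral>\<^sup>+x. f (\<lambda>i\<in>I. c i + s * x i) \<partial>leb I)"
  by (subst leb_affine[OF I s, of c]) (simp add: nn_integral_scale_measure nn_integral_distr)

lemma measurable_lin_map [measurable]: "lin_map I A \<in> leb I \<rightarrow>\<^sub>M leb I"
  unfolding lin_map_def by measurable

lemma lin_map_coord_space [simp]: "lin_map I A x \<in> coord_space I"
  by (simp add: lin_map_def)

lemma measurable_lincomb:
  "a \<in> N \<rightarrow>\<^sub>M leb I \<Longrightarrow> b \<in> N \<rightarrow>\<^sub>M leb I \<Longrightarrow> (\<lambda>\<omega>. \<lambda>i\<in>I. s * a \<omega> i + t * b \<omega> i) \<in> N \<rightarrow>\<^sub>M leb I"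
  by (intro measurable_coordI borel_measurable_add borel_measurable_times borel_measurable_const) (auto intro: measurable_coord)

definition inverse_mat_on :: "'i set \<Rightarrow> ('i \<times> 'i \<Rightarrow> real) \<Rightarrow> ('i \<times> 'i \<Rightarrow> real) \<Rightarrow> bool" where
  "inverse_mat_on I A B \<longleftrightarrow>
     (\<forall>i\<in>I. \<forall>k\<in>I. (\<Sum>j\<in>I. A (i, j) * B (j, k)) = (if i = k then 1 else 0)) \<and>
     (\<forall>i\<in>I. \<forall>k\<in>I. (\<Sum>j\<in>I. B (i, j) * A (j, k)) = (if i = k then 1 else 0))"

lemma inverse_mat_on_lin_map:
  assumes I: "finite I" and AB: "inverse_mat_on I A B" and i: "i \<in> I"
  shows "lin_map I A (lin_map I B x) i = x i"
proof -
  have "lin_map I A (lin_map I B x) i = (\<Sum>j\<in>I. \<Sum>k\<in>I. A (i, j) * B (j, k) * x k)"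
    using i by (simp add: lin_map_def sum_distrib_left mult.assoc)
  also have "\<dots> = (\<Sum>k\<in>I. (\<Sum>j\<in>I. A (i, j) * B (j, k)) * x k)"
    by (subst sum.swap) (simp add: sum_distrib_right)
  also have "\<dots> = (\<Sum>k\<in>I. if i = k then x k else 0)"
    using AB i by (intro sum.cong refl) (auto simp: inverse_mat_on_def)
  also have "\<dots> = x i" using i I by simp
  finally show ?thesis .
qed

lemma inverse_mat_on_commute: "inverse_mat_on I A B \<Longrightarrow> inverse_mat_on I B A"
  by (auto simp: inverse_mat_on_def)

text \<open>Uniqueness of the translation invariant measure, applied to the image of Lebesgue measure
  under \<open>A\<close>; this replaces the determinant in the change of variables formula.\<close>

lemma nn_integral_lin_map_ratio:
  assumes I: "finite I" and AB: "inverse_mat_on I A B"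
    and f[measurable]: "f \<in> borel_measurable (leb I)" and g[measurable]: "g \<in> borel_measurable (leb I)"
  shows "(\<integral>\<^sup>+x. f (lin_map I A x) \<partial>leb I) * (\<integral>\<^sup>+x. g x \<partial>leb I)
       = (\<integral>\<^sup>+x. f x \<partial>leb I) * (\<integral>\<^sup>+x. g (lin_map I A x) \<partial>leb I)"
proof -
  interpret P: pair_sigma_finite "leb I" "leb I" by (rule pair_sigma_finite_leb[OF I I])
  have lm: "(\<lambda>\<omega>. lin_map I A (a \<omega>)) \<in> N \<rightarrow>\<^sub>M leb I" if "a \<in> N \<rightarrow>\<^sub>M leb I" for a :: "'b \<Rightarrow> _" and N
    using measurable_compose[OF that measurable_lin_map] .
  have am: "(\<lambda>\<omega>. \<lambda>i\<in>I. lin_map I A (a \<omega>) i + s * b \<omega> i) \<in> N \<rightarrow>\<^sub>M leb I"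
    if "a \<in> N \<rightarrow>\<^sub>M leb I" "b \<in> N \<rightarrow>\<^sub>M leb I" for a b :: "'b \<Rightarrow> _" and N s
    by (intro measurable_coordI borel_measurable_add borel_measurable_times measurable_coord[OF lm[OF that(1)]]
        measurable_coord[OF that(2)] borel_measurable_const)
  have [measurable]: "(\<lambda>p. \<lambda>i\<in>I. lin_map I A (fst p) i + s * snd p i) \<in> leb I \<Otimes>\<^sub>M leb I \<rightarrow>\<^sub>M leb I"
    "(\<lambda>p. \<lambda>i\<in>I. lin_map I A (snd p) i + s * fst p i) \<in> leb I \<Otimes>\<^sub>M leb I \<rightarrow>\<^sub>M leb I" for s
    by (rule am; measurable)+
  have [measurable]: "(\<lambda>y. \<lambda>i\<in>I. lin_map I A u i + s * y i) \<in> leb I \<rightarrow>\<^sub>M leb I" for s u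
    by measurable

  have "(\<integral>\<^sup>+x. f (lin_map I A x) \<partial>leb I) * (\<integral>\<^sup>+x. g x \<partial>leb I)
      = (\<integral>\<^sup>+u. f (lin_map I A u) * (\<integral>\<^sup>+y. g (\<lambda>i\<in>I. lin_map I A u i + - 1 * y i) \<partial>leb I) \<partial>leb I)"
    using nn_integral_leb_affine[OF I, of "-1" g] by (simp add: nn_integral_multc)
  also have "\<dots> = (\<integral>\<^sup>+u. \<integral>\<^sup>+y. f (lin_map I A u) * g (\<lambda>i\<in>I. lin_map I A u i + - 1 * y i) \<partial>leb I \<partial>leb I)"
    by (intro nn_integral_cong nn_integral_cmult[symmetric]) measurable
  also have "\<dots> = (\<integral>\<^sup>+y. \<integral>\<^sup>+u. f (lin_map I A u) * g (\<lambda>i\<in>I. lin_map I A u i + - 1 * y i) \<partial>leb I \<partial>leb I)"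
    by (rule P.Fubini'[symmetric]) measurable
  \<comment> \<open>For fixed y, u is translated by the preimage B y. This adds y to A u, after
    which f and g can be integrated separately.\<close>
  also have "\<dots> = (\<integral>\<^sup>+y. \<integral>\<^sup>+u. f (\<lambda>i\<in>I. lin_map I A u i + 1 * y i) * g (lin_map I A u) \<partial>leb I \<partial>leb I)"
  proof (rule nn_integral_cong)
    fix y assume y: "y \<in> space (leb I)"
    have [measurable]: "(\<lambda>u. \<lambda>i\<in>I. lin_map I A u i + s * y i) \<in> leb I \<rightarrow>\<^sub>M leb I" for s
      by (rule am) (use y in measurable)
    have shift: "lin_map I A (\<lambda>i\<in>I. lin_map I B y i + 1 * u i) = (\<lambda>i\<in>I. lin_map I A u i + 1 * y i)" for u
    proof (rule coord_space_eqI[of _ I])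
      fix i assume i: "i \<in> I"
      have "lin_map I A (\<lambda>i\<in>I. lin_map I B y i + 1 * u i) i = lin_map I A (lin_map I B y) i + lin_map I A u i"
        using i by (simp add: lin_map_def distrib_left sum.distrib)
      then show "lin_map I A (\<lambda>i\<in>I. lin_map I B y i + 1 * u i) i = (\<lambda>i\<in>I. lin_map I A u i + 1 * y i) i"
        using i inverse_mat_on_lin_map[OF I AB i] by simp
    qed simp_all
    have unshift: "(\<lambda>i\<in>I. (\<lambda>i\<in>I. lin_map I A u i + 1 * y i) i + - 1 * y i) = lin_map I A u" for u
      by (rule coord_space_eqI[of _ I]) simp_all
    have "(\<integral>\<^sup>+u. f (lin_map I A u) * g (\<lambda>i\<in>I. lin_map I A u i + - 1 * y i) \<partial>leb I)
      = ennreal (\<bar>1\<bar> ^ card I) * (\<integral>\<^sup>+u. f (lin_map I A (\<lambda>i\<in>I. lin_map I B y i + 1 * u i))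
          * g (\<lambda>i\<in>I. lin_map I A (\<lambda>i\<in>I. lin_map I B y i + 1 * u i) i + - 1 * y i) \<partial>leb I)"
      by (rule nn_integral_leb_affine[OF I]) (simp, measurable)
    then show "(\<integral>\<^sup>+u. f (lin_map I A u) * g (\<lambda>i\<in>I. lin_map I A u i + - 1 * y i) \<partial>leb I)
      = (\<integral>\<^sup>+u. f (\<lambda>i\<in>I. lin_map I A u i + 1 * y i) * g (lin_map I A u) \<partial>leb I)"
      unfolding shift unshift by simp
  qed
  also have "\<dots> = (\<integral>\<^sup>+u. \<integral>\<^sup>+y. f (\<lambda>i\<in>I. lin_map I A u i + 1 * y i) * g (lin_map I A u) \<partial>leb I \<partial>leb I)"
    by (rule P.Fubini') measurable
  also have "\<dots> = (\<integral>\<^sup>+u. (\<integral>\<^sup>+y. f (\<lambda>i\<in>I. lin_map I A u i + 1 * y i) \<partial>leb I) * g (lin_map I A u) \<partial>leb I)"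
    by (intro nn_integral_cong nn_integral_multc) measurable
  also have "\<dots> = (\<integral>\<^sup>+u. (\<integral>\<^sup>+y. f y \<partial>leb I) * g (lin_map I A u) \<partial>leb I)"
    using nn_integral_leb_affine[OF I, of 1 f] by simp
  also have "\<dots> = (\<integral>\<^sup>+x. f x \<partial>leb I) * (\<integral>\<^sup>+x. g (lin_map I A x) \<partial>leb I)"
    by (intro nn_integral_cmult) measurable
  finally show ?thesis .
qed

section \<open>Gaussian integrals, and the standard Gaussian measure as a density\<close>

lemma nn_integral_gauss_1d:
  assumes "a > 0"
  shows "(\<integral>\<^sup>+t. ennreal (exp (- a * (t - c)\<^sup>2)) \<partial>lborel) = ennreal (sqrt (pi / a))"
proof -
  define s where "s = sqrt (1 / (2 * a))"
  have s: "s > 0" "s\<^sup>2 = 1 / (2 * a)" using assms by (auto simp: s_def)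
  have "exp (- a * (t - c)\<^sup>2) = sqrt (pi / a) * normal_density c s t" for t
    using assms by (simp add: normal_density_def s(2))
  then have "(\<integral>\<^sup>+t. ennreal (exp (- a * (t - c)\<^sup>2)) \<partial>lborel)
      = (\<integral>\<^sup>+t. ennreal (sqrt (pi / a)) * ennreal (normal_density c s t) \<partial>lborel)"
    using assms by (simp add: ennreal_mult)
  also have "\<dots> = ennreal (sqrt (pi / a)) * (\<integral>\<^sup>+t. ennreal (normal_density c s t) \<partial>lborel)"
    by (rule nn_integral_cmult) measurable
  also have "(\<integral>\<^sup>+t. ennreal (normal_density c s t) \<partial>lborel) = 1"
    using prob_space.emeasure_space_1[OF prob_space_normal_density[OF s(1), of c]]
    by (simp add: emeasure_density)
  finally show ?thesis by simp
qed

lemma nn_integral_gauss_leb: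
  assumes I: "finite I" and a: "a > 0"
  shows "(\<integral>\<^sup>+x. ennreal (exp (- a * (\<Sum>i\<in>I. (x i - c i)\<^sup>2))) \<partial>leb I) = ennreal (sqrt (pi / a) ^ card I)"
proof -
  have "(\<integral>\<^sup>+x. ennreal (exp (- a * (\<Sum>i\<in>I. (x i - c i)\<^sup>2))) \<partial>leb I)
      = (\<integral>\<^sup>+x. (\<Prod>i\<in>I. ennreal (exp (- a * (x i - c i)\<^sup>2))) \<partial>leb I)"
    using I by (simp add: sum_distrib_left exp_sum prod_ennreal)
  also have "\<dots> = (\<Prod>i\<in>I. ennreal (sqrt (pi / a)))"
    using I by (subst leb.product_nn_integral_prod) (auto simp: nn_integral_gauss_1d[OF a, simplified] ennreal_power)
  finally show ?thesis using a by (simp add: ennreal_power)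
qed

definition gauss_density :: "'i set \<Rightarrow> ('i \<Rightarrow> real) \<Rightarrow> real" where
  "gauss_density I x = (1 / sqrt (2 * pi)) ^ card I * exp (- (\<Sum>i\<in>I. (x i)\<^sup>2) / 2)"

lemma measurable_gauss_density [measurable]: "gauss_density I \<in> borel_measurable (leb I)"
  unfolding gauss_density_def by measurable

lemma gauss_density_nonneg: "0 \<le> gauss_density I x"
  by (simp add: gauss_density_def)

lemma gauss_density_prod: "finite I \<Longrightarrow> gauss_density I x = (\<Prod>i\<in>I. std_normal_density (x i))"
  by (simp add: gauss_density_def std_normal_density_def prod_dividef exp_sum[symmetric] sum_negf sum_divide_distrib
      power_one_over)

lemma gaussian_density:
  assumes I: "finite I"
  shows "gaussian I = density (leb I) (gauss_density I)"
  unfolding gaussian_def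
proof (rule gauss.PiM_eqI[OF I, symmetric])
  show "sets (density (leb I) (gauss_density I)) = sets (PiM I (\<lambda>_. std_normal_distribution))"
    by (simp cong: sets_PiM_cong)
  fix A :: "'a \<Rightarrow> real set" assume A: "\<And>i. i \<in> I \<Longrightarrow> A i \<in> sets std_normal_distribution"
  have PA: "Pi\<^sub>E I A \<in> sets (leb I)" using A I by (intro sets_PiM_I_finite) auto
  have "emeasure (density (leb I) (gauss_density I)) (Pi\<^sub>E I A)
      = (\<integral>\<^sup>+x. ennreal (gauss_density I x) * indicator (Pi\<^sub>E I A) x \<partial>leb I)"
    using PA by (simp add: emeasure_density)
  also have "\<dots> = (\<integral>\<^sup>+x. (\<Prod>i\<in>I. ennreal (std_normal_density (x i)) * indicator (A i) (x i)) \<partial>leb I)"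
  proof (rule nn_integral_cong)
    fix x assume "x \<in> space (leb I)"
    then have "indicator (Pi\<^sub>E I A) x = (\<Prod>i\<in>I. indicator (A i) (x i) :: ennreal)"
      using I by (auto simp: coord_space_def PiE_iff indicator_def prod.neutral)
    then show "ennreal (gauss_density I x) * indicator (Pi\<^sub>E I A) x
        = (\<Prod>i\<in>I. ennreal (std_normal_density (x i)) * indicator (A i) (x i))"
      by (simp add: gauss_density_prod[OF I] prod_ennreal prod.distrib)
  qed
  also have "\<dots> = (\<Prod>i\<in>I. \<integral>\<^sup>+t. ennreal (std_normal_density t) * indicator (A i) t \<partial>lborel)"
    using A by (intro leb.product_nn_integral_prod I) auto
  also have "\<dots> = (\<Prod>i\<in>I. emeasure std_normal_distribution (A i))"
    using A by (intro prod.cong refl) (simp add: emeasure_density)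
  finally show "emeasure (density (leb I) (gauss_density I)) (Pi\<^sub>E I A) = (\<Prod>i\<in>I. emeasure std_normal_distribution (A i))" .
qed

lemma nn_integral_gaussian:
  assumes "finite I" "f \<in> borel_measurable (leb I)"
  shows "(\<integral>\<^sup>+x. f x \<partial>gaussian I) = (\<integral>\<^sup>+x. ennreal (gauss_density I x) * f x \<partial>leb I)"
  unfolding gaussian_density[OF assms(1)] by (rule nn_integral_density[OF _ assms(2)]) measurable

lemma nn_integral_gaussian_prod:
  assumes I: "finite I" and f: "\<And>i. i \<in> I \<Longrightarrow> f i \<in> borel_measurable borel"
  shows "(\<integral>\<^sup>+x. (\<Prod>i\<in>I. f i (x i)) \<partial>gaussian I) = (\<Prod>i\<in>I. \<integral>\<^sup>+t. f i t \<partial>std_normal_distribution)"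
  unfolding gaussian_def using f by (intro gauss.product_nn_integral_prod I) auto

lemma nn_integral_exp_normal:
  "(\<integral>\<^sup>+t. ennreal (exp (a * t)) \<partial>std_normal_distribution) = ennreal (exp (a\<^sup>2 / 2))"
proof -
  have "(\<integral>\<^sup>+t. ennreal (exp (a * t)) \<partial>std_normal_distribution)
      = (\<integral>\<^sup>+t. ennreal (std_normal_density t) * ennreal (exp (a * t)) \<partial>lborel)"
    by (rule nn_integral_density) measurable
  also have "\<dots> = (\<integral>\<^sup>+t. ennreal (exp (a\<^sup>2 / 2) / sqrt (2 * pi)) * ennreal (exp (- (1/2) * (t - a)\<^sup>2)) \<partial>lborel)"
  proof (rule nn_integral_cong)
    fix t
    have "std_normal_density t * exp (a * t) = exp (a\<^sup>2 / 2) / sqrt (2 * pi) * exp (- (1/2) * (t - a)\<^sup>2)"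
      unfolding std_normal_density_def
      by (simp add: exp_add[symmetric] field_simps power2_eq_square) 
    then show "ennreal (std_normal_density t) * ennreal (exp (a * t))
       = ennreal (exp (a\<^sup>2 / 2) / sqrt (2 * pi)) * ennreal (exp (- (1/2) * (t - a)\<^sup>2))"
      by (simp add: ennreal_mult[symmetric])
  qed
  also have "\<dots> = ennreal (exp (a\<^sup>2 / 2) / sqrt (2 * pi)) * ennreal (sqrt (pi / (1/2)))"
    by (subst nn_integral_cmult, measurable, subst nn_integral_gauss_1d) auto
  also have "\<dots> = ennreal (exp (a\<^sup>2 / 2))"
    by (simp add: ennreal_mult[symmetric] mult.commute)
  finally show ?thesis .
qed

lemma nn_integral_exp_gaussian:
  assumes I: "finite I"
  shows "(\<integral>\<^sup>+x. ennreal (exp (\<Sum>i\<in>I. a i * x i)) \<partial>gaussian I) = ennreal (exp ((\<Sum>i\<in>I. (a i)\<^sup>2) / 2))"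
proof -
  have "(\<integral>\<^sup>+x. ennreal (exp (\<Sum>i\<in>I. a i * x i)) \<partial>gaussian I)
      = (\<integral>\<^sup>+x. (\<Prod>i\<in>I. ennreal (exp (a i * x i))) \<partial>gaussian I)"
    using I by (simp add: exp_sum prod_ennreal)
  also have "\<dots> = (\<Prod>i\<in>I. ennreal (exp ((a i)\<^sup>2 / 2)))"
    by (subst nn_integral_gaussian_prod[OF I]) (auto simp: nn_integral_exp_normal)
  also have "\<dots> = ennreal (exp ((\<Sum>i\<in>I. (a i)\<^sup>2) / 2))"
    using I by (simp add: prod_ennreal exp_sum[symmetric] sum_divide_distrib)
  finally show ?thesis .
qed

text \<open>The norms, support functions and smallest stretches below are suprema or infima over
  uncountable sets; their measurability is obtained from Lipschitz continuity. The function is the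
  pointwise limit of its values at the points rounded to a grid of mesh 1 / (k + 1), and these
  approximations are constant on countably many measurable cells.\<close>

lemma lipschitz_measurable:
  fixes f :: "('i \<Rightarrow> real) \<Rightarrow> real"
  assumes I: "finite I"
    and lip: "\<And>x y. x \<in> coord_space I \<Longrightarrow> y \<in> coord_space I \<Longrightarrow> \<bar>f x - f y\<bar> \<le> C * (\<Sum>i\<in>I. \<bar>x i - y i\<bar>)"
  shows "f \<in> borel_measurable (leb I)"
proof (rule borel_measurable_LIMSEQ_real)
  define r where "r = (\<lambda>(k::nat) (x :: 'i \<Rightarrow> real). \<lambda>i\<in>I. \<lfloor>real (Suc k) * x i\<rfloor>)"
  define g where "g = (\<lambda>(k::nat) (m :: 'i \<Rightarrow> int). \<lambda>i\<in>I. real_of_int (m i) / real (Suc k))"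
  let ?Z = "I \<rightarrow>\<^sub>E (UNIV :: int set)"
  have cZ: "countable ?Z" using I by (intro countable_PiE) auto
  show "(\<lambda>x. f (g k (r k x))) \<in> borel_measurable (leb I)" for k
  proof -
    have "r k \<in> leb I \<rightarrow>\<^sub>M count_space ?Z"
    proof (subst measurable_count_space_eq_countable[OF cZ], intro conjI ballI)
      show "r k \<in> space (leb I) \<rightarrow> ?Z" by (auto simp: r_def)
      fix m assume m: "m \<in> ?Z"
      have "r k -` {m} \<inter> space (leb I) = {x \<in> space (leb I). \<forall>i\<in>I. \<lfloor>real (Suc k) * x i\<rfloor> = m i}"
        using m by (auto simp: r_def PiE_iff extensional_def fun_eq_iff restrict_def) 
      also have "\<dots> \<in> sets (leb I)" using I by measurable
      finally show "r k -` {m} \<inter> space (leb I) \<in> sets (leb I)" .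
    qed
    moreover have "(\<lambda>m. f (g k m)) \<in> measurable (count_space ?Z) borel" by simp
    ultimately show ?thesis by (rule measurable_compose)
  qed
  fix x assume x: "x \<in> space (leb I)"
  have bd: "\<bar>f (g k (r k x)) - f x\<bar> \<le> \<bar>C\<bar> * real (card I) * (1 / real (Suc k))" for k
  proof -
    have "\<bar>f (g k (r k x)) - f x\<bar> \<le> C * (\<Sum>i\<in>I. \<bar>g k (r k x) i - x i\<bar>)"
      using x by (intro lip) (auto simp: g_def)
    also have "\<dots> \<le> \<bar>C\<bar> * (\<Sum>i\<in>I. 1 / real (Suc k))"
    proof (intro mult_mono sum_mono)
      fix i assume i: "i \<in> I"
      have "g k (r k x) i - x i = (real_of_int \<lfloor>real (Suc k) * x i\<rfloor> - real (Suc k) * x i) / real (Suc k)"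
        using i by (simp add: g_def r_def field_simps)
      also have "\<bar>\<dots>\<bar> \<le> 1 / real (Suc k)"
        unfolding abs_divide by (intro frac_le) (simp_all, linarith)
      finally show "\<bar>g k (r k x) i - x i\<bar> \<le> 1 / real (Suc k)" .
    qed (auto intro: sum_nonneg)
    finally show ?thesis by simp
  qed
  have "(\<lambda>k. f (g k (r k x)) - f x) \<longlonglongrightarrow> 0"
  proof (rule Lim_null_comparison)
    show "\<forall>\<^sub>F k in sequentially. norm (f (g k (r k x)) - f x) \<le> \<bar>C\<bar> * real (card I) * (1 / real (Suc k))"
      using bd by simp
    show "(\<lambda>k. \<bar>C\<bar> * real (card I) * (1 / real (Suc k))) \<longlonglongrightarrow> 0"
      using tendsto_mult_right_zero[OF lim_1_over_n[THEN LIMSEQ_Suc], of "\<bar>C\<bar> * real (card I)"] by simp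
  qed
  then show "(\<lambda>k. f (g k (r k x))) \<longlonglongrightarrow> f x" by (rule LIM_zero_cancel)
qed

section \<open>Gaussian matrices contracted with unit vectors\<close>

lemma indep_vars_gaussian_coords:
  assumes I: "I \<noteq> {}" and c: "inj_on c I" "c ` I \<subseteq> J"
  shows "prob_space.indep_vars (gaussian J) (\<lambda>_. borel) (\<lambda>i A. A (c i)) I"
proof -
  interpret prob_space "gaussian J" by (rule prob_space_gaussian)
  have m: "(\<lambda>A. A j) \<in> borel_measurable (gaussian J)" if "j \<in> J" for j
    using measurable_component_singleton[OF that, of "\<lambda>_. std_normal_distribution"] by (simp add: gaussian_def)
  have d: "distr (gaussian J) borel (\<lambda>A. A j) = std_normal_distribution" if j: "j \<in> J" for j
  proof -
    have "distr (gaussian J) std_normal_distribution (\<lambda>A. A j) = std_normal_distribution"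
      unfolding gaussian_def using j by (intro distr_PiM_component) (simp_all add: prob_space_normal_density)
    then show ?thesis by (simp cong: distr_cong)
  qed
  have "distr (gaussian J) (PiM I (\<lambda>_. borel)) (\<lambda>x. \<lambda>i\<in>I. x (c i))
      = distr (gaussian J) (PiM I (\<lambda>_. std_normal_distribution)) (\<lambda>x. \<lambda>i\<in>I. x (c i))"
    by (rule distr_cong) (auto intro!: sets_PiM_cong)
  also have "\<dots> = PiM I (\<lambda>_. std_normal_distribution)"
    unfolding gaussian_def using c by (intro distr_PiM_reindex) (auto simp: prob_space_normal_density)
  also have "\<dots> = PiM I (\<lambda>i. distr (gaussian J) borel (\<lambda>A. A (c i)))"
    by (rule PiM_cong) (use c d in auto)
  finally show ?thesis
    by (subst indep_vars_iff_distr_eq_PiM'[OF I]) (use c m in auto)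
qed

lemma distributed_gaussian_linear:
  assumes J: "finite I" and c: "inj_on c I" "c ` I \<subseteq> J" and u: "(\<Sum>i\<in>I. (u i)\<^sup>2) = 1"
  shows "distr (gaussian J) borel (\<lambda>A. \<Sum>i\<in>I. u i * A (c i)) = std_normal_distribution"
proof -
  interpret prob_space "gaussian J" by (rule prob_space_gaussian)
  \<comment> \<open>Terms with coefficient 0 are dropped, since a normal density requires a positive
    deviation.\<close>
  define I' where "I' = {i \<in> I. u i \<noteq> 0}"
  have I': "finite I'" "I' \<subseteq> I" using J by (auto simp: I'_def)
  have su: "(\<Sum>i\<in>I'. (u i)\<^sup>2) = 1"
    using u J by (subst u[symmetric], intro sum.mono_neutral_left) (auto simp: I'_def)
  then have ne: "I' \<noteq> {}" by auto
  have ind: "indep_vars (\<lambda>_. borel) (\<lambda>i A. A (c i)) I'"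
    by (rule indep_vars_gaussian_coords[OF ne inj_on_subset[OF c(1) I'(2)]]) (use c I' in auto)
  have ind': "indep_vars (\<lambda>_. borel) (\<lambda>i A. u i * A (c i)) I'"
    by (rule indep_vars_compose2[OF ind]) simp
  have dist: "distributed (gaussian J) lborel (\<lambda>A. u i * A (c i)) (normal_density 0 \<bar>u i\<bar>)" if i: "i \<in> I'" for i
  proof -
    have cJ: "c i \<in> J" using i c I' by auto
    have "distr (gaussian J) std_normal_distribution (\<lambda>A. A (c i)) = std_normal_distribution"
      unfolding gaussian_def using cJ by (intro distr_PiM_component) (simp_all add: prob_space_normal_density)
    then have "distr (gaussian J) lborel (\<lambda>A. A (c i)) = density lborel std_normal_density"
      by (simp cong: distr_cong)
    moreover have "(\<lambda>A. A (c i)) \<in> borel_measurable (gaussian J)"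
      using measurable_component_singleton[OF cJ, of "\<lambda>_. std_normal_distribution"] by (simp add: gaussian_def)
    ultimately have "distributed (gaussian J) lborel (\<lambda>A. A (c i)) (normal_density 0 1)"
      by (simp add: distributed_def)
    from normal_density_affine[OF this, of "u i" 0] i show ?thesis by (simp add: I'_def)
  qed
  have "distributed (gaussian J) lborel (\<lambda>A. \<Sum>i\<in>I'. u i * A (c i))
      (normal_density (\<Sum>i\<in>I'. 0) (sqrt (\<Sum>i\<in>I'. \<bar>u i\<bar>\<^sup>2)))"
    by (rule sum_indep_normal[OF I'(1) ne ind' _ dist]) (auto simp: I'_def)
  then have "distributed (gaussian J) lborel (\<lambda>A. \<Sum>i\<in>I'. u i * A (c i)) std_normal_density"
    by (simp add: su)
  then have "distr (gaussian J) lborel (\<lambda>A. \<Sum>i\<in>I'. u i * A (c i)) = std_normal_distribution"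
    by (simp add: distributed_def)
  also have "(\<lambda>A. \<Sum>i\<in>I'. u i * A (c i)) = (\<lambda>A. \<Sum>i\<in>I. u i * A (c i))"
    using J by (intro ext sum.mono_neutral_left) (auto simp: I'_def)
  finally show ?thesis by (simp cong: distr_cong)
qed

text \<open>Entries of the result use disjoint sets of coordinates, so they are independent, and
  each is a unit combination of standard normals. The selector \<open>c\<close> allows both a matrix
  and its transpose to be applied to u.\<close>

lemma distr_gaussian_contract:
  assumes I: "finite I" and K: "finite K" "K \<noteq> {}"
    and c: "inj_on (\<lambda>(i, k). c i k) (I \<times> K)" "\<And>i k. i \<in> I \<Longrightarrow> k \<in> K \<Longrightarrow> c i k \<in> J"
    and u: "(\<Sum>i\<in>I. (u i)\<^sup>2) = 1"
  shows "distr (gaussian J) (leb K) (\<lambda>A. \<lambda>k\<in>K. \<Sum>i\<in>I. u i * A (c i k)) = gaussian K"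
proof -
  interpret prob_space "gaussian J" by (rule prob_space_gaussian)
  have Ine: "I \<noteq> {}" using u by auto
  have Jne: "J \<noteq> {}" using Ine K c(2) by auto
  define S where "S = (\<lambda>k. (\<lambda>i. c i k) ` I)"
  have cinj: "i = i' \<and> k = k'" if "c i k = c i' k'" "i \<in> I" "i' \<in> I" "k \<in> K" "k' \<in> K" for i i' k k'
    using inj_onD[OF c(1), of "(i, k)" "(i', k')"] that by auto
  have "indep_vars (\<lambda>k. PiM (S k) (\<lambda>_. borel)) (\<lambda>k A. restrict (\<lambda>j. A j) (S k)) K"
    by (rule indep_vars_restrict[OF indep_vars_gaussian_coords[OF Jne, where c = "\<lambda>j. j"]])
      (use c(2) cinj in \<open>fastforce simp: S_def disjoint_family_on_def\<close>)+
  then have "indep_vars (\<lambda>_. borel) (\<lambda>k A. \<Sum>i\<in>I. u i * restrict (\<lambda>j. A j) (S k) (c i k)) K"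
  proof (rule indep_vars_compose2[where Y = "\<lambda>k A. \<Sum>i\<in>I. u i * A (c i k)"])
    fix k assume "k \<in> K"
    show "(\<lambda>A. \<Sum>i\<in>I. u i * A (c i k)) \<in> borel_measurable (PiM (S k) (\<lambda>_. borel))"
      by (intro borel_measurable_sum borel_measurable_times borel_measurable_const measurable_component_singleton)
        (simp add: S_def)
  qed
  also have "(\<lambda>k A. \<Sum>i\<in>I. u i * restrict (\<lambda>j. A j) (S k) (c i k)) = (\<lambda>k A. \<Sum>i\<in>I. u i * A (c i k))"
    by (intro ext sum.cong) (auto simp: S_def)
  finally have ind: "indep_vars (\<lambda>_. borel) (\<lambda>k A. \<Sum>i\<in>I. u i * A (c i k)) K" .
  have m: "(\<lambda>A. \<Sum>i\<in>I. u i * A (c i k)) \<in> borel_measurable (gaussian J)" if "k \<in> K" for k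
    using ind that by (auto simp: indep_vars_def)
  have "distr (gaussian J) (leb K) (\<lambda>A. \<lambda>k\<in>K. \<Sum>i\<in>I. u i * A (c i k))
      = distr (gaussian J) (PiM K (\<lambda>_. borel)) (\<lambda>A. \<lambda>k\<in>K. \<Sum>i\<in>I. u i * A (c i k))"
    by (rule distr_cong) (auto intro!: sets_PiM_cong)
  also have "\<dots> = PiM K (\<lambda>k. distr (gaussian J) borel (\<lambda>A. \<Sum>i\<in>I. u i * A (c i k)))"
    using ind m by (subst indep_vars_iff_distr_eq_PiM'[OF K(2), symmetric]) auto
  also have "\<dots> = gaussian K"
    unfolding gaussian_def[of K]
  proof (rule PiM_cong[OF refl])
    fix k assume k: "k \<in> K"
    show "distr (gaussian J) borel (\<lambda>A. \<Sum>i\<in>I. u i * A (c i k)) = std_normal_distribution"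
      by (rule distributed_gaussian_linear[OF I _ _ u]) (use c(2) cinj k in \<open>auto intro!: inj_onI\<close>)
  qed
  finally show ?thesis .
qed

lemma measurable_contract:
  assumes "\<And>i k. i \<in> I \<Longrightarrow> k \<in> K \<Longrightarrow> c i k \<in> J"
  shows "(\<lambda>A. \<lambda>k\<in>K. \<Sum>i\<in>I. u i * A (c i k)) \<in> gaussian J \<rightarrow>\<^sub>M leb K"
  by (intro measurable_coordI borel_measurable_sum borel_measurable_times borel_measurable_const)
    (use measurable_component_singleton[of _ J "\<lambda>_. std_normal_distribution"] assms in \<open>simp add: gaussian_def\<close>)

lemma nn_integral_gaussian_contract:
  assumes "finite I" "finite K" "K \<noteq> {}"
    and c: "inj_on (\<lambda>(i, k). c i k) (I \<times> K)" "\<And>i k. i \<in> I \<Longrightarrow> k \<in> K \<Longrightarrow> c i k \<in> J"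
    and "(\<Sum>i\<in>I. (u i)\<^sup>2) = 1" and f: "f \<in> borel_measurable (leb K)"
  shows "(\<integral>\<^sup>+A. f (\<lambda>k\<in>K. \<Sum>i\<in>I. u i * A (c i k)) \<partial>gaussian J) = (\<integral>\<^sup>+x. f x \<partial>gaussian K)"
proof -
  have "(\<integral>\<^sup>+A. f (\<lambda>k\<in>K. \<Sum>i\<in>I. u i * A (c i k)) \<partial>gaussian J)
      = (\<integral>\<^sup>+x. f x \<partial>distr (gaussian J) (leb K) (\<lambda>A. \<lambda>k\<in>K. \<Sum>i\<in>I. u i * A (c i k)))"
  proof (rule nn_integral_distr[symmetric])
    show "(\<lambda>A. \<lambda>k\<in>K. \<Sum>i\<in>I. u i * A (c i k)) \<in> gaussian J \<rightarrow>\<^sub>M leb K"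
      by (rule measurable_contract) (rule c(2))
  qed (use f in simp)
  moreover have "distr (gaussian J) (leb K) (\<lambda>A. \<lambda>k\<in>K. \<Sum>i\<in>I. u i * A (c i k)) = gaussian K"
    by (rule distr_gaussian_contract) (use assms in auto)
  ultimately show ?thesis by simp
qed

text \<open>Invariance of the standard Gaussian pair under rotation by \<open>pi / 4\<close>, by two successive
  affine substitutions.\<close>

lemma nn_integral_gaussian_rotation:
  fixes f :: "('i \<Rightarrow> real) \<Rightarrow> ('i \<Rightarrow> real) \<Rightarrow> ennreal"
  assumes I: "finite I" and f: "case_prod f \<in> borel_measurable (leb I \<Otimes>\<^sub>M leb I)"
  shows "(\<integral>\<^sup>+x. \<integral>\<^sup>+y. f (\<lambda>i\<in>I. (x i + y i) / sqrt 2) (\<lambda>i\<in>I. (x i - y i) / sqrt 2) \<partial>gaussian I \<partial>gaussian I)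
       = (\<integral>\<^sup>+x. \<integral>\<^sup>+y. f x y \<partial>gaussian I \<partial>gaussian I)"
proof -
  interpret P: pair_sigma_finite "leb I" "leb I" by (rule pair_sigma_finite_leb[OF I I])
  define n where "n = card I"
  let ?g = "gauss_density I"
  have am: "(\<lambda>\<omega>. \<lambda>i\<in>I. s * a \<omega> i + t * b \<omega> i) \<in> N \<rightarrow>\<^sub>M leb I"
    if "a \<in> N \<rightarrow>\<^sub>M leb I" "b \<in> N \<rightarrow>\<^sub>M leb I" for a b :: "'c \<Rightarrow> _" and N s t
    by (rule measurable_lincomb[OF that])
  have fm: "(\<lambda>\<omega>. f (a \<omega>) (b \<omega>)) \<in> borel_measurable N"
    if "a \<in> N \<rightarrow>\<^sub>M leb I" "b \<in> N \<rightarrow>\<^sub>M leb I" for a b :: "'c \<Rightarrow> _" and N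
    using measurable_compose[OF measurable_Pair[OF that] f] by simp
  have gm: "(\<lambda>\<omega>. ennreal (?g (a \<omega>))) \<in> borel_measurable N"
    if "a \<in> N \<rightarrow>\<^sub>M leb I" for a :: "'c \<Rightarrow> _" and N
    using measurable_compose[OF that measurable_gauss_density] by simp
  define p m where "p = (\<lambda>x y. \<lambda>i\<in>I. (1 / sqrt 2) * x i + (1 / sqrt 2) * y i :: real)"
    and "m = (\<lambda>x y. \<lambda>i\<in>I. (1 / sqrt 2) * x i + (- 1 / sqrt 2) * y i :: real)"
  define q where "q = (\<lambda>x w. \<lambda>i\<in>I. sqrt 2 * x i + (- 1) * w i :: real)"
  have meas: "(\<lambda>\<omega>. p (a \<omega>) (b \<omega>)) \<in> N \<rightarrow>\<^sub>M leb I" "(\<lambda>\<omega>. m (a \<omega>) (b \<omega>)) \<in> N \<rightarrow>\<^sub>M leb I"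
      "(\<lambda>\<omega>. q (a \<omega>) (b \<omega>)) \<in> N \<rightarrow>\<^sub>M leb I"
    if "a \<in> N \<rightarrow>\<^sub>M leb I" "b \<in> N \<rightarrow>\<^sub>M leb I" for a b :: "'c \<Rightarrow> _" and N
    unfolding p_def m_def q_def by (rule am[OF that])+
  have gauss2: "(\<integral>\<^sup>+x. \<integral>\<^sup>+y. h x y \<partial>gaussian I \<partial>gaussian I)
      = (\<integral>\<^sup>+x. \<integral>\<^sup>+y. ennreal (?g x) * (ennreal (?g y) * h x y) \<partial>leb I \<partial>leb I)"
    if h: "case_prod h \<in> borel_measurable (leb I \<Otimes>\<^sub>M leb I)" for h
  proof -
    have h1: "h x \<in> borel_measurable (leb I)" if "x \<in> space (leb I)" for x
      using measurable_compose[OF measurable_Pair1'[OF that] h] by simp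
    have hg: "(\<lambda>(x, y). ennreal (?g y) * h x y) \<in> borel_measurable (leb I \<Otimes>\<^sub>M leb I)"
      using h by measurable
    have "(\<integral>\<^sup>+x. \<integral>\<^sup>+y. h x y \<partial>gaussian I \<partial>gaussian I)
        = (\<integral>\<^sup>+x. \<integral>\<^sup>+y. ennreal (?g y) * h x y \<partial>leb I \<partial>gaussian I)"
      by (rule nn_integral_cong) (simp add: nn_integral_gaussian[OF I] h1)
    also have "\<dots> = (\<integral>\<^sup>+x. ennreal (?g x) * (\<integral>\<^sup>+y. ennreal (?g y) * h x y \<partial>leb I) \<partial>leb I)"
      by (rule nn_integral_gaussian[OF I])
        (use sigma_finite_measure.borel_measurable_nn_integral[OF sigma_finite_leb[OF I] hg] in simp)
    also have "\<dots> = (\<integral>\<^sup>+x. \<integral>\<^sup>+y. ennreal (?g x) * (ennreal (?g y) * h x y) \<partial>leb I \<partial>leb I)"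
      by (intro nn_integral_cong nn_integral_cmult[symmetric] borel_measurable_times_ennreal h1 gm) auto
    finally show ?thesis .
  qed
  have "(\<integral>\<^sup>+x. \<integral>\<^sup>+y. f (\<lambda>i\<in>I. (x i + y i) / sqrt 2) (\<lambda>i\<in>I. (x i - y i) / sqrt 2) \<partial>gaussian I \<partial>gaussian I)
      = (\<integral>\<^sup>+x. \<integral>\<^sup>+y. f (p x y) (m x y) \<partial>gaussian I \<partial>gaussian I)"
    by (simp add: p_def m_def add_divide_distrib diff_divide_distrib)
  also have "\<dots> = (\<integral>\<^sup>+x. \<integral>\<^sup>+y. ennreal (?g x) * (ennreal (?g y) * f (p x y) (m x y)) \<partial>leb I \<partial>leb I)"
    by (rule gauss2) (simp add: split_beta' fm meas)
  \<comment> \<open>First substitution, for fixed x: y = sqrt 2 w - x. The first argument of f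
    becomes w, the second one sqrt 2 x - w.\<close>
  also have "\<dots> = (\<integral>\<^sup>+x. ennreal (sqrt 2 ^ n) * (\<integral>\<^sup>+w. ennreal (?g x) * (ennreal (?g (q w x)) * f w (q x w)) \<partial>leb I) \<partial>leb I)"
  proof (rule nn_integral_cong)
    fix x assume x: "x \<in> space (leb I)"
    have "(\<integral>\<^sup>+y. ennreal (?g x) * (ennreal (?g y) * f (p x y) (m x y)) \<partial>leb I)
       = ennreal (\<bar>sqrt 2\<bar> ^ card I) * (\<integral>\<^sup>+w. ennreal (?g x) * (ennreal (?g (\<lambda>i\<in>I. - x i + sqrt 2 * w i))
           * f (p x (\<lambda>i\<in>I. - x i + sqrt 2 * w i)) (m x (\<lambda>i\<in>I. - x i + sqrt 2 * w i))) \<partial>leb I)"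
      using x by (intro nn_integral_leb_affine[OF I] borel_measurable_times_ennreal gm fm meas) auto
    also have "(\<integral>\<^sup>+w. ennreal (?g x) * (ennreal (?g (\<lambda>i\<in>I. - x i + sqrt 2 * w i))
           * f (p x (\<lambda>i\<in>I. - x i + sqrt 2 * w i)) (m x (\<lambda>i\<in>I. - x i + sqrt 2 * w i))) \<partial>leb I)
       = (\<integral>\<^sup>+w. ennreal (?g x) * (ennreal (?g (q w x)) * f w (q x w)) \<partial>leb I)"
    proof (rule nn_integral_cong)
      fix w assume w: "w \<in> space (leb I)"
      have "p x (\<lambda>i\<in>I. - x i + sqrt 2 * w i) = w"
        by (rule coord_space_eqI[of _ I]) (use w in \<open>auto simp: p_def diff_divide_distrib\<close>)
      moreover have "m x (\<lambda>i\<in>I. - x i + sqrt 2 * w i) = q x w"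
        by (rule coord_space_eqI[of _ I]) (auto simp: m_def q_def field_simps)
      moreover have "(\<lambda>i\<in>I. - x i + sqrt 2 * w i) = q w x"
        by (rule coord_space_eqI[of _ I]) (auto simp: q_def)
      ultimately show "ennreal (?g x) * (ennreal (?g (\<lambda>i\<in>I. - x i + sqrt 2 * w i))
           * f (p x (\<lambda>i\<in>I. - x i + sqrt 2 * w i)) (m x (\<lambda>i\<in>I. - x i + sqrt 2 * w i)))
        = ennreal (?g x) * (ennreal (?g (q w x)) * f w (q x w))" by simp
    qed
    finally show "(\<integral>\<^sup>+y. ennreal (?g x) * (ennreal (?g y) * f (p x y) (m x y)) \<partial>leb I)
       = ennreal (sqrt 2 ^ n) * (\<integral>\<^sup>+w. ennreal (?g x) * (ennreal (?g (q w x)) * f w (q x w)) \<partial>leb I)"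
      by (simp add: n_def)
  qed
  also have "\<dots> = (\<integral>\<^sup>+x. \<integral>\<^sup>+w. ennreal (sqrt 2 ^ n) * (ennreal (?g x) * (ennreal (?g (q w x)) * f w (q x w))) \<partial>leb I \<partial>leb I)"
    by (intro nn_integral_cong nn_integral_cmult[symmetric] borel_measurable_times_ennreal gm fm meas) auto
  also have "\<dots> = (\<integral>\<^sup>+w. \<integral>\<^sup>+x. ennreal (sqrt 2 ^ n) * (ennreal (?g x) * (ennreal (?g (q w x)) * f w (q x w))) \<partial>leb I \<partial>leb I)"
    unfolding split_beta'
    by (rule P.Fubini'[symmetric]) (simp add: split_beta', intro borel_measurable_times_ennreal gm fm meas, auto)
  \<comment> \<open>Second substitution, for fixed w: x = (w + z) / sqrt 2. The second argument
    becomes z, the product of the densities is preserved by the parallelogram identity, and the two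
    Jacobians cancel.\<close>
  also have "\<dots> = (\<integral>\<^sup>+w. \<integral>\<^sup>+z. ennreal (?g w) * (ennreal (?g z) * f w z) \<partial>leb I \<partial>leb I)"
  proof (rule nn_integral_cong)
    fix w assume w: "w \<in> space (leb I)"
    let ?x = "\<lambda>z. \<lambda>i\<in>I. w i / sqrt 2 + (1 / sqrt 2) * z i"
    have "(\<integral>\<^sup>+x. ennreal (sqrt 2 ^ n) * (ennreal (?g x) * (ennreal (?g (q w x)) * f w (q x w))) \<partial>leb I)
      = ennreal (\<bar>1 / sqrt 2\<bar> ^ card I) * (\<integral>\<^sup>+z. ennreal (sqrt 2 ^ n) * (ennreal (?g (?x z))
          * (ennreal (?g (q w (?x z))) * f w (q (?x z) w))) \<partial>leb I)"
      using w by (intro nn_integral_leb_affine[OF I] borel_measurable_times_ennreal gm fm meas) auto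
    also have "(\<integral>\<^sup>+z. ennreal (sqrt 2 ^ n) * (ennreal (?g (?x z)) * (ennreal (?g (q w (?x z))) * f w (q (?x z) w))) \<partial>leb I)
        = (\<integral>\<^sup>+z. ennreal (sqrt 2 ^ n) * (ennreal (?g w) * (ennreal (?g z) * f w z)) \<partial>leb I)"
    proof (rule nn_integral_cong)
      fix z assume z: "z \<in> space (leb I)"
      have "q (?x z) w = z"
        by (rule coord_space_eqI[of _ I]) (use z in \<open>auto simp: q_def field_simps\<close>)
      moreover have "?g (?x z) * ?g (q w (?x z)) = ?g w * ?g z"
      proof -
        have "(\<Sum>i\<in>I. (?x z i)\<^sup>2) + (\<Sum>i\<in>I. (q w (?x z) i)\<^sup>2) = (\<Sum>i\<in>I. (w i)\<^sup>2) + (\<Sum>i\<in>I. (z i)\<^sup>2)"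
          unfolding sum.distrib[symmetric]
        proof (rule sum.cong[OF refl])
          fix i assume i: "i \<in> I"
          have a: "?x z i = (w i + z i) / sqrt 2" using i by (simp add: add_divide_distrib)
          have b: "q w (?x z) i = (w i - z i) / sqrt 2" using i by (simp add: q_def field_simps)
          show "(?x z i)\<^sup>2 + (q w (?x z) i)\<^sup>2 = (w i)\<^sup>2 + (z i)\<^sup>2"
            unfolding a b by (simp add: power_divide power2_eq_square field_simps)
        qed
        then show ?thesis
          unfolding gauss_density_def by (simp add: exp_add[symmetric] add_divide_distrib[symmetric] power_add[symmetric] algebra_simps)
      qed
      ultimately show "ennreal (sqrt 2 ^ n) * (ennreal (?g (?x z)) * (ennreal (?g (q w (?x z))) * f w (q (?x z) w)))
        = ennreal (sqrt 2 ^ n) * (ennreal (?g w) * (ennreal (?g z) * f w z))"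
        by (simp add: mult.assoc[symmetric] ennreal_mult[symmetric] gauss_density_nonneg)
    qed
    also have "(\<integral>\<^sup>+z. ennreal (sqrt 2 ^ n) * (ennreal (?g w) * (ennreal (?g z) * f w z)) \<partial>leb I)
        = ennreal (sqrt 2 ^ n) * (\<integral>\<^sup>+z. ennreal (?g w) * (ennreal (?g z) * f w z) \<partial>leb I)"
      using w by (intro nn_integral_cmult borel_measurable_times_ennreal gm fm) auto
    also have "ennreal (\<bar>1 / sqrt 2\<bar> ^ card I) * (ennreal (sqrt 2 ^ n) * (\<integral>\<^sup>+z. ennreal (?g w) * (ennreal (?g z) * f w z) \<partial>leb I)) = (\<integral>\<^sup>+z. ennreal (?g w) * (ennreal (?g z) * f w z) \<partial>leb I)"
      by (simp add: mult.assoc[symmetric] ennreal_mult[symmetric] n_def power_mult_distrib[symmetric])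
    finally show "(\<integral>\<^sup>+x. ennreal (sqrt 2 ^ n) * (ennreal (?g x) * (ennreal (?g (q w x)) * f w (q x w))) \<partial>leb I)
      = (\<integral>\<^sup>+z. ennreal (?g w) * (ennreal (?g z) * f w z) \<partial>leb I)" .
  qed
  also have "\<dots> = (\<integral>\<^sup>+x. \<integral>\<^sup>+y. f x y \<partial>gaussian I \<partial>gaussian I)"
    by (rule gauss2[OF f, symmetric])
  finally show ?thesis .
qed

subsection \<open>Gaussian concentration\<close>

text \<open>Since |t| \<le> exp t + exp (- t), the exponential moments dominate. The vectors
  \<open>e i s\<close> present a single coordinate as a linear form to which
  \<open>nn_integral_exp_gaussian\<close> applies.\<close>

lemma integrable_gaussian_linear_growth:
  fixes f :: "('i \<Rightarrow> real) \<Rightarrow> real"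
  assumes I: "finite I" and f: "f \<in> borel_measurable (leb I)"
    and le: "\<And>x. x \<in> coord_space I \<Longrightarrow> \<bar>f x\<bar> \<le> C * (\<Sum>i\<in>I. \<bar>x i\<bar>)"
  shows "integrable (gaussian I) f"
proof (rule integrableI_bounded)
  show "f \<in> borel_measurable (gaussian I)" using f by (simp cong: measurable_cong_sets)
  define e where "e = (\<lambda>(i :: 'i) (s :: real) j. if j = i then s else 0)"
  have e: "(\<Sum>j\<in>I. e i s j * x j) = s * x i" "(\<Sum>j\<in>I. (e i s j)\<^sup>2) = s\<^sup>2" if "i \<in> I" for i s x
    using I that by (simp_all add: e_def if_distrib[of "\<lambda>t. t * _"] if_distrib[of "\<lambda>t. t\<^sup>2"] cong: if_cong)
  have b: "\<bar>f x\<bar> \<le> \<bar>C\<bar> * (\<Sum>i\<in>I. exp (x i) + exp (- x i))" if "x \<in> coord_space I" for x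
  proof -
    have "\<bar>f x\<bar> \<le> C * (\<Sum>i\<in>I. \<bar>x i\<bar>)" using le[OF that] .
    also have "\<dots> \<le> \<bar>C\<bar> * (\<Sum>i\<in>I. exp (x i) + exp (- x i))"
    proof (intro mult_mono sum_mono)
      fix i
      have "x i \<le> exp (x i)" "- x i \<le> exp (- x i)"
        using exp_ge_add_one_self[of "x i"] exp_ge_add_one_self[of "- x i"] by linarith+
      moreover have "0 < exp (x i)" "0 < exp (- x i)" by simp_all
      ultimately show "\<bar>x i\<bar> \<le> exp (x i) + exp (- x i)" by linarith
    qed (auto intro: sum_nonneg)
    finally show ?thesis .
  qed
  have "(\<integral>\<^sup>+x. ennreal (norm (f x)) \<partial>gaussian I)
      \<le> (\<integral>\<^sup>+x. ennreal \<bar>C\<bar> * (\<Sum>i\<in>I. ennreal (exp (\<Sum>j\<in>I. e i 1 j * x j)) + ennreal (exp (\<Sum>j\<in>I. e i (-1) j * x j))) \<partial>gaussian I)"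
  proof (rule nn_integral_mono)
    fix x assume x: "x \<in> space (gaussian I)"
    have "ennreal (norm (f x)) \<le> ennreal (\<bar>C\<bar> * (\<Sum>i\<in>I. exp (x i) + exp (- x i)))"
      using b[of x] x by (intro ennreal_leI) simp
    also have "\<dots> = ennreal \<bar>C\<bar> * (\<Sum>i\<in>I. ennreal (exp (\<Sum>j\<in>I. e i 1 j * x j)) + ennreal (exp (\<Sum>j\<in>I. e i (-1) j * x j)))"
      by (simp add: ennreal_mult sum_nonneg sum_ennreal[symmetric] e ennreal_plus[symmetric] del: ennreal_plus sum_ennreal)
    finally show "ennreal (norm (f x)) \<le> ennreal \<bar>C\<bar> * (\<Sum>i\<in>I. ennreal (exp (\<Sum>j\<in>I. e i 1 j * x j)) + ennreal (exp (\<Sum>j\<in>I. e i (-1) j * x j)))" .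
  qed
  also have "\<dots> = ennreal \<bar>C\<bar> * (\<Sum>i\<in>I. (\<integral>\<^sup>+x. ennreal (exp (\<Sum>j\<in>I. e i 1 j * x j)) \<partial>gaussian I)
        + (\<integral>\<^sup>+x. ennreal (exp (\<Sum>j\<in>I. e i (-1) j * x j)) \<partial>gaussian I))"
    by (simp add: nn_integral_cmult nn_integral_sum nn_integral_add)
  also have "\<dots> < \<infinity>"
    unfolding nn_integral_exp_gaussian[OF I]
    by (simp add: ennreal_plus[symmetric] ennreal_mult[symmetric] sum_nonneg del: ennreal_plus)
  finally show "(\<integral>\<^sup>+x. ennreal (norm (f x)) \<partial>gaussian I) < \<infinity>" .
qed

text \<open>\<open>F\<close> is the support function of \<open>K\<close>.\<close>

locale gaussian_support =
  fixes I :: "'i set" and K :: "('i \<Rightarrow> real) set" and F :: "('i \<Rightarrow> real) \<Rightarrow> real" and R :: real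
  assumes I: "finite I"
    and F_upper: "\<And>x k. k \<in> K \<Longrightarrow> vinner I x k \<le> F x"
    and F_attained: "\<And>x. \<exists>k\<in>K. F x = vinner I x k"
    and F_nonneg: "\<And>x. 0 \<le> F x"
    and K_bound: "\<And>k. k \<in> K \<Longrightarrow> L2_set k I \<le> R"
begin

lemma F_cong: "(\<And>i. i \<in> I \<Longrightarrow> x i = y i) \<Longrightarrow> F x = F y"
proof -
  assume eq: "\<And>i. i \<in> I \<Longrightarrow> x i = y i"
  have v: "vinner I x k = vinner I y k" for k using eq by (intro vinner_cong) auto
  obtain k k' where "k \<in> K" "F x = vinner I x k" "k' \<in> K" "F y = vinner I y k'" using F_attained by meson
  then show "F x = F y" using F_upper[of k y] F_upper[of k' x] v by (metis order_antisym)
qed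

lemma F_diff: "\<exists>k\<in>K. \<forall>w. F x - F w \<le> vinner I (\<lambda>i. x i - w i) k"
proof -
  obtain k where k: "k \<in> K" "F x = vinner I x k" using F_attained by meson
  then show ?thesis using F_upper[OF k(1)]
    by (intro bexI[OF _ k(1)]) (auto simp: vinner_diff_left)
qed

lemma vinner_K_le: "k \<in> K \<Longrightarrow> vinner I x k \<le> R * (\<Sum>i\<in>I. \<bar>x i\<bar>)"
proof -
  assume k: "k \<in> K"
  have "vinner I x k \<le> (\<Sum>i\<in>I. \<bar>x i\<bar> * R)" unfolding vinner_def
  proof (rule sum_mono)
    fix i assume i: "i \<in> I"
    have "\<bar>k i\<bar> \<le> L2_set k I" using member_le_L2_set[OF I i, of "\<lambda>i. \<bar>k i\<bar>"] by (simp add: L2_set_def)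
    then have "\<bar>x i\<bar> * \<bar>k i\<bar> \<le> \<bar>x i\<bar> * R" using K_bound[OF k] by (intro mult_left_mono) auto
    then show "x i * k i \<le> \<bar>x i\<bar> * R" by (simp add: abs_mult[symmetric])
  qed
  then show ?thesis by (simp add: sum_distrib_left mult.commute)
qed

lemma F_lipschitz: "\<bar>F x - F y\<bar> \<le> R * (\<Sum>i\<in>I. \<bar>x i - y i\<bar>)"
proof -
  have "F x - F y \<le> R * (\<Sum>i\<in>I. \<bar>x i - y i\<bar>)" for x y
    using F_diff[of x] vinner_K_le[of _ "\<lambda>i. x i - y i"] order_trans by meson
  from this[of x y] this[of y x] show ?thesis by (simp add: abs_minus_commute)
qed

lemma F_measurable: "F \<in> borel_measurable (leb I)"
  by (rule lipschitz_measurable[OF I F_lipschitz])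

lemma F_zero: "F (\<lambda>_. 0) = 0"
  using F_attained[of "\<lambda>_. 0"] by (auto simp: vinner_def)

lemma F_integrable: "integrable (gaussian I) F"
  by (rule integrable_gaussian_linear_growth[OF I F_measurable, of R])
    (use F_lipschitz[of _ "\<lambda>_. 0"] F_zero in simp)

lemma F_scale: "0 \<le> c \<Longrightarrow> F (\<lambda>i. c * x i) = c * F x"
proof (rule antisym)
  assume c: "0 \<le> c"
  obtain k where k: "k \<in> K" "F (\<lambda>i. c * x i) = vinner I (\<lambda>i. c * x i) k" using F_attained by meson
  show "F (\<lambda>i. c * x i) \<le> c * F x"
    unfolding k(2) vinner_scale_left by (rule mult_left_mono[OF F_upper[OF k(1)] c])
  obtain k' where k': "k' \<in> K" "F x = vinner I x k'" using F_attained by meson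
  show "c * F x \<le> F (\<lambda>i. c * x i)"
    using F_upper[OF k'(1), of "\<lambda>i. c * x i"] by (simp add: k'(2) vinner_scale_left)
qed

text \<open>Let k be the maximiser for x. Testing F at (x + s y) / sqrt 2 with the same k gives an
  upper bound for F x - G y that is affine in y, so its Laplace transform is explicit. The
  coefficient left at F x is 2 - sqrt 2, at most 3 / 5 because 7 / 5 \<le> sqrt 2; F x \<ge> 0 is
  needed for this rounding.\<close>

lemma exp_slice_bound:
  assumes l: "0 \<le> l" and z: "\<And>y. y \<in> space (gaussian I) \<Longrightarrow> G y = F (\<lambda>i. (x i + s * y i) / sqrt 2)"
    and s: "\<bar>s\<bar> = 1"
  shows "(\<integral>\<^sup>+y. ennreal (exp (2 * l * (F x - G y))) \<partial>gaussian I)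
    \<le> ennreal (exp (l\<^sup>2 * R\<^sup>2)) * ennreal (exp (3 / 5 * l * F x))"
proof -
  obtain k where k: "k \<in> K" "F x = vinner I x k" using F_attained by meson
  have bnd: "2 * l * (F x - G y) \<le> 3 / 5 * l * F x + (\<Sum>i\<in>I. (- sqrt 2 * s * l * k i) * y i)"
    if y: "y \<in> space (gaussian I)" for y
  proof -
    have "vinner I (\<lambda>i. (1 / sqrt 2) * (x i + s * y i)) k \<le> G y"
      using F_upper[OF k(1), of "\<lambda>i. (x i + s * y i) / sqrt 2"] z[OF y] by simp
    then have "F x - G y \<le> (1 - 1 / sqrt 2) * F x - (s / sqrt 2) * vinner I y k"
      unfolding vinner_scale_left vinner_add_left k(2) by (simp add: algebra_simps)
    then have "2 * l * (F x - G y) \<le> 2 * l * ((1 - 1 / sqrt 2) * F x - (s / sqrt 2) * vinner I y k)"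
      using l by (intro mult_left_mono) auto
    also have "\<dots> = l * F x * (2 - sqrt 2) + (- sqrt 2 * s * l) * vinner I y k"
      by (simp add: field_simps real_divide_square_eq)
    also have "\<dots> \<le> l * F x * (3 / 5) + (- sqrt 2 * s * l) * vinner I y k"
    proof (intro add_right_mono mult_left_mono)
      have "(7 / 5)\<^sup>2 \<le> (2 :: real)" by (simp add: power2_eq_square)
      then have "7 / 5 \<le> sqrt 2" by (rule real_le_rsqrt)
      then show "2 - sqrt 2 \<le> 3 / 5" by simp
      show "0 \<le> l * F x" using l F_nonneg by simp
    qed
    also have "(- sqrt 2 * s * l) * vinner I y k = (\<Sum>i\<in>I. (- sqrt 2 * s * l * k i) * y i)"
      by (simp add: vinner_def sum_distrib_left mult_ac sum_negf)
    finally show ?thesis by (simp add: mult_ac)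
  qed
  have "(\<integral>\<^sup>+y. ennreal (exp (2 * l * (F x - G y))) \<partial>gaussian I)
     \<le> (\<integral>\<^sup>+y. ennreal (exp (3 / 5 * l * F x)) * ennreal (exp (\<Sum>i\<in>I. (- sqrt 2 * s * l * k i) * y i)) \<partial>gaussian I)"
    using bnd by (intro nn_integral_mono) (simp add: ennreal_mult[symmetric] exp_add[symmetric])
  also have "\<dots> = ennreal (exp (3 / 5 * l * F x)) * ennreal (exp ((\<Sum>i\<in>I. (- sqrt 2 * s * l * k i)\<^sup>2) / 2))"
    by (subst nn_integral_cmult) (simp_all only: nn_integral_exp_gaussian[OF I], measurable)
  also have "(\<Sum>i\<in>I. (- sqrt 2 * s * l * k i)\<^sup>2) / 2 = l\<^sup>2 * (L2_set k I)\<^sup>2"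
  proof -
    have "s\<^sup>2 = 1" using s by (metis power2_abs one_power2)
    then show ?thesis by (simp add: power_mult_distrib L2_set_def sum_nonneg sum_distrib_left[symmetric])
  qed
  also have "ennreal (exp (3 / 5 * l * F x)) * ennreal (exp (l\<^sup>2 * (L2_set k I)\<^sup>2))
      \<le> ennreal (exp (3 / 5 * l * F x)) * ennreal (exp (l\<^sup>2 * R\<^sup>2))"
    by (intro mult_left_mono ennreal_leI exp_le_cancel_iff[THEN iffD2] power_mono K_bound[OF k(1)]) auto
  finally show ?thesis by (simp add: mult.commute)
qed

text \<open>A qualitative bound, depending badly on the dimension. Finiteness is what allows the
  self-referential inequality in \<open>laplace_bound\<close> to be solved.\<close>

lemma nn_integral_exp_finite: "(\<integral>\<^sup>+x. ennreal (exp (l * F x)) \<partial>gaussian I) < \<infinity>" if l: "0 \<le> l"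
proof -
  have "(\<integral>\<^sup>+x. ennreal (exp (l * F x)) \<partial>gaussian I)
      \<le> (\<integral>\<^sup>+x. (\<Prod>i\<in>I. ennreal (exp (l * R * x i)) + ennreal (exp (- (l * R) * x i))) \<partial>gaussian I)"
  proof (rule nn_integral_mono)
    fix x assume "x \<in> space (gaussian I)"
    have "F x \<le> R * (\<Sum>i\<in>I. \<bar>x i\<bar>)" using F_lipschitz[of x "\<lambda>_. 0"] F_zero by simp
    then have "l * F x \<le> l * (R * (\<Sum>i\<in>I. \<bar>x i\<bar>))" by (rule mult_left_mono[OF _ l])
    then have "exp (l * F x) \<le> exp (\<Sum>i\<in>I. l * R * \<bar>x i\<bar>)" by (simp add: sum_distrib_left mult.assoc)
    also have "\<dots> = (\<Prod>i\<in>I. exp (l * R * \<bar>x i\<bar>))" by (rule exp_sum[OF I])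
    also have "\<dots> \<le> (\<Prod>i\<in>I. exp (l * R * x i) + exp (- (l * R) * x i))"
      by (intro prod_mono) (auto simp: abs_if)
    finally show "ennreal (exp (l * F x)) \<le> (\<Prod>i\<in>I. ennreal (exp (l * R * x i)) + ennreal (exp (- (l * R) * x i)))"
      by (simp add: prod_ennreal ennreal_plus[symmetric] ennreal_leI del: ennreal_plus)
  qed
  also have "\<dots> = (\<Prod>i\<in>I. \<integral>\<^sup>+t. ennreal (exp (l * R * t)) + ennreal (exp (- (l * R) * t)) \<partial>std_normal_distribution)"
    by (rule nn_integral_gaussian_prod[OF I]) measurable
  also have "\<dots> = (\<Prod>i\<in>I. ennreal (exp ((l * R)\<^sup>2 / 2) + exp ((l * R)\<^sup>2 / 2)))"
    by (subst nn_integral_add) (simp_all only: nn_integral_exp_normal power2_minus, auto simp: ennreal_plus[symmetric] simp del: ennreal_plus)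
  also have "\<dots> < \<infinity>" by (simp add: ennreal_power)
  finally show ?thesis .
qed

text \<open>The left side is the expectation of exp (l (F x - F y)) for independent x and y.
  Inserting F w with w = (x + y) / sqrt 2 splits the exponent, and the inequality between a product
  and the mean of squares separates the factors; the squares explain the 2 l in
  \<open>exp_slice_bound\<close>.\<close>

lemma laplace_contraction:
  assumes l: "0 \<le> l"
  shows "(\<integral>\<^sup>+x. ennreal (exp (l * F x)) \<partial>gaussian I) * (\<integral>\<^sup>+x. ennreal (exp (- l * F x)) \<partial>gaussian I)
    \<le> ennreal (exp (l\<^sup>2 * R\<^sup>2)) * (\<integral>\<^sup>+x. ennreal (exp (3 / 5 * l * F x)) \<partial>gaussian I)"
proof -
  let ?G = "gaussian I"
  define w where "w = (\<lambda>x y. \<lambda>i\<in>I. 1 / sqrt 2 * x i + 1 / sqrt 2 * y i :: real)"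
  define w' where "w' = (\<lambda>x y. \<lambda>i\<in>I. 1 / sqrt 2 * x i + (- 1 / sqrt 2) * y i :: real)"
  have wf: "w x y = (\<lambda>i\<in>I. (x i + y i) / sqrt 2)" "w' x y = (\<lambda>i\<in>I. (x i - y i) / sqrt 2)" for x y
    by (simp_all add: w_def w'_def add_divide_distrib diff_divide_distrib)
  have Fg[measurable]: "F \<in> borel_measurable ?G" using F_measurable by (simp cong: measurable_cong_sets)
  have Fm: "(\<lambda>\<omega>. F (a \<omega>)) \<in> borel_measurable N" if "a \<in> N \<rightarrow>\<^sub>M leb I" for a :: "'c \<Rightarrow> _" and N
    using measurable_compose[OF that F_measurable] .
  have am: "(\<lambda>\<omega>. w (a \<omega>) (b \<omega>)) \<in> N \<rightarrow>\<^sub>M leb I" "(\<lambda>\<omega>. w' (a \<omega>) (b \<omega>)) \<in> N \<rightarrow>\<^sub>M leb I"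
    if "a \<in> N \<rightarrow>\<^sub>M leb I" "b \<in> N \<rightarrow>\<^sub>M leb I" for a b :: "'c \<Rightarrow> _" and N
    unfolding w_def w'_def by (rule measurable_lincomb[OF that])+
  have em: "(\<lambda>\<omega>. ennreal (exp (2 * l * (F (a \<omega>) - F (b \<omega>))))) \<in> borel_measurable N"
    if "a \<in> N \<rightarrow>\<^sub>M leb I" "b \<in> N \<rightarrow>\<^sub>M leb I" for a b :: "'c \<Rightarrow> _" and N
    using Fm[OF that(1)] Fm[OF that(2)] by measurable
  have idm: "(\<lambda>x. x) \<in> ?G \<rightarrow>\<^sub>M leb I" by (simp add: measurable_ident_sets sets_gaussian)
  \<comment> \<open>Rotating twice recovers y. So F w - F y is the second kind of difference, taken
    at the rotated pair, whose law is again that of an independent pair.\<close>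
  have w'w: "F (w' (w x y) (w' x y)) = F y" for x y
    by (rule F_cong) (simp add: w_def w'_def field_simps)
  define P where "P = (\<lambda>x y. ennreal (exp (2 * l * (F x - F (w x y)))))"
  define Q where "Q = (\<lambda>x y. ennreal (exp (2 * l * (F x - F (w' x y)))))"
  have pm: "case_prod P \<in> borel_measurable (leb I \<Otimes>\<^sub>M leb I)" "case_prod Q \<in> borel_measurable (leb I \<Otimes>\<^sub>M leb I)"
    unfolding P_def Q_def split_beta' by (intro em am measurable_fst measurable_snd)+
  have sf: "sigma_finite_measure ?G"
    by (rule prob_space_imp_sigma_finite[OF prob_space_gaussian])
  have pg: "case_prod h \<in> borel_measurable (?G \<Otimes>\<^sub>M ?G)" if "case_prod h \<in> borel_measurable (leb I \<Otimes>\<^sub>M leb I)"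
    for h :: "('i \<Rightarrow> real) \<Rightarrow> ('i \<Rightarrow> real) \<Rightarrow> ennreal"
    using that by (simp cong: measurable_cong_sets sets_pair_measure_cong add: sets_gaussian)
  have P_le: "(\<integral>\<^sup>+y. P x y \<partial>?G) \<le> ennreal (exp (l\<^sup>2 * R\<^sup>2)) * ennreal (exp (3 / 5 * l * F x))" for x
    unfolding P_def by (rule exp_slice_bound[OF l, where s = 1]) (auto simp: wf intro!: F_cong)
  have Q_le: "(\<integral>\<^sup>+y. Q x y \<partial>?G) \<le> ennreal (exp (l\<^sup>2 * R\<^sup>2)) * ennreal (exp (3 / 5 * l * F x))" for x
    unfolding Q_def by (rule exp_slice_bound[OF l, where s = "-1"]) (auto simp: wf intro!: F_cong)
  define M' where "M' = (\<integral>\<^sup>+x. ennreal (exp (3 / 5 * l * F x)) \<partial>?G)"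
  have int_le: "(\<integral>\<^sup>+x. \<integral>\<^sup>+y. h x y \<partial>?G \<partial>?G) \<le> ennreal (exp (l\<^sup>2 * R\<^sup>2)) * M'"
    if "\<And>x. (\<integral>\<^sup>+y. h x y \<partial>?G) \<le> ennreal (exp (l\<^sup>2 * R\<^sup>2)) * ennreal (exp (3 / 5 * l * F x))" for h
  proof -
    have "(\<integral>\<^sup>+x. \<integral>\<^sup>+y. h x y \<partial>?G \<partial>?G) \<le> (\<integral>\<^sup>+x. ennreal (exp (l\<^sup>2 * R\<^sup>2)) * ennreal (exp (3 / 5 * l * F x)) \<partial>?G)"
      by (intro nn_integral_mono that)
    also have "\<dots> = ennreal (exp (l\<^sup>2 * R\<^sup>2)) * M'"
      unfolding M'_def by (rule nn_integral_cmult) measurable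
    finally show ?thesis .
  qed
  have rot: "(\<integral>\<^sup>+x. \<integral>\<^sup>+y. Q (w x y) (w' x y) \<partial>?G \<partial>?G) = (\<integral>\<^sup>+x. \<integral>\<^sup>+y. Q x y \<partial>?G \<partial>?G)"
    unfolding wf by (rule nn_integral_gaussian_rotation[OF I pm(2)])
  have Pw: "(\<lambda>y. P x y) \<in> borel_measurable ?G" "(\<lambda>y. Q (w x y) (w' x y)) \<in> borel_measurable ?G"
    if "x \<in> space ?G" for x
    unfolding P_def Q_def by (intro em am idm measurable_const; use that in simp)+
  have QQ: "case_prod (\<lambda>x y. Q (w x y) (w' x y)) \<in> borel_measurable (leb I \<Otimes>\<^sub>M leb I)"
    unfolding Q_def split_beta' by (intro em am measurable_fst measurable_snd)
  have mint: "(\<lambda>x. \<integral>\<^sup>+y. h x y \<partial>?G) \<in> borel_measurable ?G"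
    if "case_prod h \<in> borel_measurable (leb I \<Otimes>\<^sub>M leb I)" for h
    using sigma_finite_measure.borel_measurable_nn_integral[OF sf pg[OF that]] .
  have "(\<integral>\<^sup>+x. ennreal (exp (l * F x)) \<partial>?G) * (\<integral>\<^sup>+x. ennreal (exp (- l * F x)) \<partial>?G)
      = (\<integral>\<^sup>+x. \<integral>\<^sup>+y. ennreal (exp (l * F x)) * ennreal (exp (- l * F y)) \<partial>?G \<partial>?G)"
    by (subst nn_integral_cmult, measurable) (rule nn_integral_multc[symmetric], measurable)
  also have "\<dots> \<le> (\<integral>\<^sup>+x. \<integral>\<^sup>+y. ennreal (1/2) * (P x y + Q (w x y) (w' x y)) \<partial>?G \<partial>?G)"
  proof (intro nn_integral_mono)
    fix x y
    have "exp (l * F x) * exp (- l * F y) = exp (l * (F x - F (w x y))) * exp (l * (F (w x y) - F y))"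
      by (simp add: exp_add[symmetric] algebra_simps)
    also have "\<dots> \<le> 1/2 * ((exp (l * (F x - F (w x y))))\<^sup>2 + (exp (l * (F (w x y) - F y)))\<^sup>2)"
      using sum_squares_bound[of "exp (l * (F x - F (w x y)))" "exp (l * (F (w x y) - F y))"] by simp
    also have "\<dots> = 1/2 * (exp (2 * l * (F x - F (w x y))) + exp (2 * l * (F (w x y) - F (w' (w x y) (w' x y)))))"
      by (simp add: exp_double[symmetric] w'w mult.assoc)
    finally show "ennreal (exp (l * F x)) * ennreal (exp (- l * F y)) \<le> ennreal (1/2) * (P x y + Q (w x y) (w' x y))"
      unfolding P_def Q_def
      by (simp only: ennreal_mult[symmetric] ennreal_plus[symmetric] exp_ge_zero add_nonneg_nonneg zero_le_divide_1_iff zero_le_numeral ennreal_leI)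
  qed
  also have "\<dots> = ennreal (1/2) * ((\<integral>\<^sup>+x. \<integral>\<^sup>+y. P x y \<partial>?G \<partial>?G) + (\<integral>\<^sup>+x. \<integral>\<^sup>+y. Q (w x y) (w' x y) \<partial>?G \<partial>?G))"
  proof -
    have "(\<integral>\<^sup>+x. \<integral>\<^sup>+y. ennreal (1/2) * (P x y + Q (w x y) (w' x y)) \<partial>?G \<partial>?G)
       = (\<integral>\<^sup>+x. ennreal (1/2) * ((\<integral>\<^sup>+y. P x y \<partial>?G) + (\<integral>\<^sup>+y. Q (w x y) (w' x y) \<partial>?G)) \<partial>?G)"
    proof (rule nn_integral_cong)
      fix x assume x: "x \<in> space ?G"
      have "(\<integral>\<^sup>+y. ennreal (1/2) * (P x y + Q (w x y) (w' x y)) \<partial>?G)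
          = ennreal (1/2) * (\<integral>\<^sup>+y. P x y + Q (w x y) (w' x y) \<partial>?G)"
        by (intro nn_integral_cmult borel_measurable_add Pw x)
      also have "(\<integral>\<^sup>+y. P x y + Q (w x y) (w' x y) \<partial>?G) = (\<integral>\<^sup>+y. P x y \<partial>?G) + (\<integral>\<^sup>+y. Q (w x y) (w' x y) \<partial>?G)"
        by (intro nn_integral_add Pw x)
      finally show "(\<integral>\<^sup>+y. ennreal (1/2) * (P x y + Q (w x y) (w' x y)) \<partial>?G)
          = ennreal (1/2) * ((\<integral>\<^sup>+y. P x y \<partial>?G) + (\<integral>\<^sup>+y. Q (w x y) (w' x y) \<partial>?G))" .
    qed
    also have "\<dots> = ennreal (1/2) * (\<integral>\<^sup>+x. (\<integral>\<^sup>+y. P x y \<partial>?G) + (\<integral>\<^sup>+y. Q (w x y) (w' x y) \<partial>?G) \<partial>?G)"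
      by (intro nn_integral_cmult borel_measurable_add mint pm QQ)
    also have "(\<integral>\<^sup>+x. (\<integral>\<^sup>+y. P x y \<partial>?G) + (\<integral>\<^sup>+y. Q (w x y) (w' x y) \<partial>?G) \<partial>?G)
        = (\<integral>\<^sup>+x. \<integral>\<^sup>+y. P x y \<partial>?G \<partial>?G) + (\<integral>\<^sup>+x. \<integral>\<^sup>+y. Q (w x y) (w' x y) \<partial>?G \<partial>?G)"
      by (intro nn_integral_add mint pm QQ)
    finally show ?thesis .
  qed
  also have "\<dots> \<le> ennreal (1/2) * (ennreal (exp (l\<^sup>2 * R\<^sup>2)) * M' + ennreal (exp (l\<^sup>2 * R\<^sup>2)) * M')"
    unfolding rot by (intro mult_left_mono add_mono int_le P_le Q_le) simp
  also have "\<dots> = ennreal (exp (l\<^sup>2 * R\<^sup>2)) * M'"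
  proof -
    have "ennreal (1/2) * (t + t) = t" for t
    proof -
      have "ennreal (1/2) * (t + t) = (ennreal (1/2) + ennreal (1/2)) * t" by (simp only: distrib_left distrib_right)
      also have "ennreal (1/2) + ennreal (1/2) = 1" by (subst ennreal_plus[symmetric]) simp_all
      finally show ?thesis by simp
    qed
    then show ?thesis .
  qed
  finally show ?thesis unfolding M'_def .
qed

text \<open>Write M = exp m for the Laplace transform and E for the mean. Jensen's inequality gives
  a lower bound exp (- l E) for the second factor in \<open>laplace_contraction\<close>, and M to
  the power 3 / 5 as an upper bound for the right side. Hence 2 / 5 of m is at most l E + l^2 R^2,
  which is where 5 / 2 comes from.\<close>

lemma laplace_bound:
  assumes l: "0 \<le> l"
  shows "(\<integral>\<^sup>+x. ennreal (exp (l * F x)) \<partial>gaussian I)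
    \<le> ennreal (exp (5 / 2 * (l * (LINT x|gaussian I. F x) + l\<^sup>2 * R\<^sup>2)))"
proof -
  let ?G = "gaussian I"
  interpret prob_space ?G by (rule prob_space_gaussian)
  have Fg[measurable]: "F \<in> borel_measurable ?G" using F_measurable by (simp cong: measurable_cong_sets)
  define E where "E = (LINT x|?G. F x)"
  have ps: "prob (coord_space I) = 1" using prob_space by simp
  have int: "integrable ?G (\<lambda>x. exp (a * F x))" if "0 \<le> a" for a
    by (rule integrableI_bounded) (use nn_integral_exp_finite[OF that] in simp_all)
  have nn: "(\<integral>\<^sup>+x. ennreal (exp (a * F x)) \<partial>?G) = ennreal (LINT x|?G. exp (a * F x))" if "0 \<le> a" for a
    by (rule nn_integral_eq_integral[OF int[OF that]]) simp
  define M where "M = (LINT x|?G. exp (l * F x))"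
  define M' where "M' = (LINT x|?G. exp (3 / 5 * l * F x))"
  have intm: "integrable ?G (\<lambda>x. exp (- l * F x))"
    by (rule integrable_const_bound[of _ 1]) (use l F_nonneg in auto)
  have M1: "1 \<le> M"
  proof -
    have "(LINT x|?G. 1) \<le> M" unfolding M_def
      by (rule integral_mono[OF _ int[OF l]]) (use l F_nonneg in auto)
    then show ?thesis by (simp add: ps)
  qed
  \<comment> \<open>Jensen's inequality by integrating the tangent of exp at the mean.\<close>
  have Em: "exp (- l * E) \<le> (LINT x|?G. exp (- l * F x))"
  proof -
    have "(LINT x|?G. exp (- l * E) * (1 + (- l * F x - - l * E))) \<le> (LINT x|?G. exp (- l * F x))"
    proof (rule integral_mono[OF _ intm])
      show "integrable ?G (\<lambda>x. exp (- l * E) * (1 + (- l * F x - - l * E)))"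
        using F_integrable by (intro integrable_mult_right integrable_add integrable_diff) auto
      fix x
      have "exp (- l * E) * (1 + (- l * F x - - l * E)) \<le> exp (- l * E) * exp (- l * F x - - l * E)"
        by (intro mult_left_mono exp_ge_add_one_self) simp
      also have "\<dots> = exp (- l * F x)" by (simp only: exp_add[symmetric]) simp
      finally show "exp (- l * E) * (1 + (- l * F x - - l * E)) \<le> exp (- l * F x)" .
    qed
    also have "(LINT x|?G. exp (- l * E) * (1 + (- l * F x - - l * E))) = exp (- l * E)"
      using F_integrable by (simp add: E_def ps)
    finally show ?thesis .
  qed
  have c: "M * exp (- l * E) \<le> exp (l\<^sup>2 * R\<^sup>2) * M'"
  proof -
    have "ennreal (M * exp (- l * E)) \<le> ennreal (M * (LINT x|?G. exp (- l * F x)))"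
      using Em M1 by (intro ennreal_leI mult_left_mono) auto
    also have "\<dots> = (\<integral>\<^sup>+x. ennreal (exp (l * F x)) \<partial>?G) * (\<integral>\<^sup>+x. ennreal (exp (- l * F x)) \<partial>?G)"
      unfolding nn[OF l] M_def[symmetric] nn_integral_eq_integral[OF intm] using M1
      by (subst nn_integral_eq_integral[OF intm]) (auto simp: ennreal_mult[symmetric])
    also have "\<dots> \<le> ennreal (exp (l\<^sup>2 * R\<^sup>2)) * ennreal M'"
      using laplace_contraction[OF l] nn[of "3 / 5 * l"] l unfolding M'_def by simp
    also have "\<dots> = ennreal (exp (l\<^sup>2 * R\<^sup>2) * M')" by (rule ennreal_mult'[symmetric]) simp
    finally show ?thesis
      by (subst (asm) ennreal_le_iff) (auto simp: M'_def)
  qed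
  define m where "m = ln M"
  have m: "M = exp m" using M1 by (simp add: m_def)
  \<comment> \<open>Normalising by m makes exp (l F - m) have mean 1. The chord inequality exp (3 /
    5 s) \<le> 2 / 5 + 3 / 5 exp s is then integrated.\<close>
  have M'le: "M' \<le> exp (3 / 5 * m)"
  proof -
    have ex: "exp (3 / 5 * (l * F x - m)) = exp (3 / 5 * l * F x) * exp (- (3 / 5) * m)" for x
      by (simp add: exp_add[symmetric] algebra_simps diff_divide_distrib)
    have "M' * exp (- (3 / 5) * m) = (LINT x|?G. exp (3 / 5 * (l * F x - m)))"
      unfolding M'_def ex by simp
    also have "\<dots> \<le> (LINT x|?G. 2 / 5 + 3 / 5 * (exp (- m) * exp (l * F x)))"
    proof (rule integral_mono)
      show "integrable ?G (\<lambda>x. exp (3 / 5 * (l * F x - m)))"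
        unfolding ex using int[of "3 / 5 * l"] l by simp
      show "integrable ?G (\<lambda>x. 2 / 5 + 3 / 5 * (exp (- m) * exp (l * F x)))"
        using int[OF l] by simp
      fix x
      show "exp (3 / 5 * (l * F x - m)) \<le> 2 / 5 + 3 / 5 * (exp (- m) * exp (l * F x))"
        using convex_onD[OF exp_convex, of "3/5" 0 "l * F x - m"] by (simp add: exp_diff exp_minus field_simps)
    qed
    also have "\<dots> = 2 / 5 + 3 / 5 * (exp (- m) * M)"
      using int[OF l] by (simp add: M_def ps)
    also have "\<dots> = 1" by (simp add: m exp_minus)
    finally have "M' * exp (- (3 / 5) * m) * exp (3 / 5 * m) \<le> 1 * exp (3 / 5 * m)"
      by (intro mult_right_mono) auto
    then show ?thesis by (simp add: mult.assoc exp_add[symmetric])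
  qed
  have "exp (m - l * E) \<le> exp (l\<^sup>2 * R\<^sup>2 + 3 / 5 * m)"
  proof -
    have "exp (m - l * E) = M * exp (- l * E)" by (simp add: m exp_add[symmetric])
    also have "\<dots> \<le> exp (l\<^sup>2 * R\<^sup>2) * exp (3 / 5 * m)"
      using c M'le by (meson exp_ge_zero mult_left_mono order_trans)
    finally show ?thesis by (simp add: exp_add)
  qed
  then have "m \<le> 5 / 2 * (l * E + l\<^sup>2 * R\<^sup>2)" by simp
  then show ?thesis unfolding nn[OF l] M_def[symmetric] E_def[symmetric] by (intro ennreal_leI) (simp add: m)
qed

end

subsection \<open>Symmetric convex bodies\<close>

lemma box_in_open:
  assumes I: "finite I" and U: "openin (powertop_real I) U" and x: "x \<in> U"
  obtains e where "e > 0" "\<And>y. y \<in> coord_space I \<Longrightarrow> (\<And>i. i \<in> I \<Longrightarrow> \<bar>y i - x i\<bar> < e) \<Longrightarrow> y \<in> U"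
proof -
  obtain V where V: "\<And>i. i \<in> I \<Longrightarrow> openin euclideanreal (V i)" "x \<in> Pi\<^sub>E I V" "Pi\<^sub>E I V \<subseteq> U"
  proof -
    have "\<exists>V. finite {i \<in> I. V i \<noteq> topspace euclideanreal} \<and> (\<forall>i\<in>I. openin euclideanreal (V i)) \<and> x \<in> Pi\<^sub>E I V \<and> Pi\<^sub>E I V \<subseteq> U"
      using U x unfolding openin_product_topology_alt by (simp only:)
    then show thesis using that by metis
  qed
  have "\<exists>e>0. \<forall>t. \<bar>t - x i\<bar> < e \<longrightarrow> t \<in> V i" if i: "i \<in> I" for i
  proof -
    have "open (V i)" "x i \<in> V i" using V i by auto
    then obtain e where "e > 0" "\<forall>t. dist t (x i) < e \<longrightarrow> t \<in> V i" unfolding open_dist by blast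
    then show ?thesis by (auto simp: dist_real_def)
  qed
  then obtain e where e: "\<And>i. i \<in> I \<Longrightarrow> e i > 0" "\<And>i t. i \<in> I \<Longrightarrow> \<bar>t - x i\<bar> < e i \<Longrightarrow> t \<in> V i" by metis
  define r where "r = Min (insert 1 (e ` I))"
  have r: "r > 0" "\<And>i. i \<in> I \<Longrightarrow> r \<le> e i" using I e by (auto simp: r_def)
  show thesis
  proof (rule that[OF r(1)])
    fix y assume y: "y \<in> coord_space I" "\<And>i. i \<in> I \<Longrightarrow> \<bar>y i - x i\<bar> < r"
    have "y \<in> Pi\<^sub>E I V"
    proof (rule PiE_I)
      fix i assume i: "i \<in> I"
      show "y i \<in> V i" using e(2)[OF i] y(2)[OF i] r(2)[OF i] by simp
    qed (use y(1) in \<open>simp add: coord_space_iff\<close>)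
    then show "y \<in> U" using V by blast
  qed
qed

locale sym_body =
  fixes I :: "'i set" and L :: "('i \<Rightarrow> real) set"
  assumes I: "finite I" and Ine: "I \<noteq> {}" and body: "convex_body I L" and sym: "centrally_symmetric I L"
begin

lemma L_sub: "x \<in> L \<Longrightarrow> x \<in> coord_space I"
  using body compactin_subset_topspace[of "powertop_real I" L] by (auto simp: convex_body_def coord_space_def)

lemma convex_comb:
  "x \<in> L \<Longrightarrow> y \<in> L \<Longrightarrow> 0 \<le> t \<Longrightarrow> t \<le> 1 \<Longrightarrow> (\<lambda>i\<in>I. (1 - t) * x i + t * y i) \<in> L"
proof -
  assume "x \<in> L" "y \<in> L" "0 \<le> t" "t \<le> 1"
  then have "vadd I (vscale I (1 - t) x) (vscale I t y) \<in> L" using body by (auto simp: convex_body_def)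
  moreover have "vadd I (vscale I (1 - t) x) (vscale I t y) = (\<lambda>i\<in>I. (1 - t) * x i + t * y i)"
    by (rule coord_space_eqI[of _ I]) (auto simp: vadd_def vscale_def)
  ultimately show ?thesis by simp
qed

lemma neg: "x \<in> L \<Longrightarrow> vscale I (-1) x \<in> L"
  using sym by (simp add: centrally_symmetric_def)

text \<open>A small y is the midpoint of x0 + 2 y, which is near an interior point x0, and of - x0,
  which lies in \<open>L\<close> by symmetry.\<close>

lemma inner_box:
  obtains r where "r > 0" "\<And>y. y \<in> coord_space I \<Longrightarrow> (\<And>i. i \<in> I \<Longrightarrow> \<bar>y i\<bar> \<le> r) \<Longrightarrow> y \<in> L"
proof -
  obtain x0 where x0: "x0 \<in> powertop_real I interior_of L" using body by (auto simp: convex_body_def)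
  obtain e where e: "e > 0"
    "\<And>y. y \<in> coord_space I \<Longrightarrow> (\<And>i. i \<in> I \<Longrightarrow> \<bar>y i - x0 i\<bar> < e) \<Longrightarrow> y \<in> powertop_real I interior_of L"
    using box_in_open[OF I openin_interior_of x0] by blast
  have x0L: "x0 \<in> L" by (rule subsetD[OF interior_of_subset x0])
  show thesis
  proof (rule that[of "e / 4"])
    show "e / 4 > 0" using e by simp
    fix y assume y: "y \<in> coord_space I" "\<And>i. i \<in> I \<Longrightarrow> \<bar>y i\<bar> \<le> e / 4"
    have "(\<lambda>i\<in>I. x0 i + 2 * y i) \<in> powertop_real I interior_of L"
    proof (rule e(2))
      fix i assume i: "i \<in> I"
      show "\<bar>(\<lambda>i\<in>I. x0 i + 2 * y i) i - x0 i\<bar> < e" using y(2)[OF i] i e(1) by (simp add: abs_mult)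
    qed simp
    then have a: "(\<lambda>i\<in>I. x0 i + 2 * y i) \<in> L" by (rule subsetD[OF interior_of_subset])
    have "(\<lambda>i\<in>I. (1 - 1/2) * (\<lambda>i\<in>I. x0 i + 2 * y i) i + 1/2 * vscale I (-1) x0 i) \<in> L"
      by (rule convex_comb[OF a neg[OF x0L]]) auto
    also have "(\<lambda>i\<in>I. (1 - 1/2) * (\<lambda>i\<in>I. x0 i + 2 * y i) i + 1/2 * vscale I (-1) x0 i) = y"
      by (rule coord_space_eqI[of _ I]) (use y(1) in \<open>auto simp: vscale_def field_simps\<close>)
    finally show "y \<in> L" .
  qed
qed

lemma zero_in: "(\<lambda>i\<in>I. 0) \<in> L"
  by (rule inner_box) auto

lemma star: "y \<in> L \<Longrightarrow> 0 \<le> t \<Longrightarrow> t \<le> 1 \<Longrightarrow> vscale I t y \<in> L"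
  using convex_comb[OF zero_in, of y t] by (simp add: vscale_def cong: restrict_cong)

lemma compact_image:
  assumes "continuous_map (powertop_real I) euclideanreal f"
  shows "compact (f ` L)"
  using image_compactin[OF _ assms, of L] body by (simp add: convex_body_def)

lemma bounded:
  obtains B where "B > 0" "\<And>y i. y \<in> L \<Longrightarrow> i \<in> I \<Longrightarrow> \<bar>y i\<bar> \<le> B"
proof -
  have "\<exists>b. \<forall>y\<in>L. \<bar>y i\<bar> \<le> b" if i: "i \<in> I" for i
  proof -
    have "compact ((\<lambda>x. x i) ` L)"
      by (rule compact_image) (rule continuous_map_product_projection[OF i])
    then show ?thesis using compact_imp_bounded by (force simp: bounded_iff)
  qed
  then obtain b where b: "\<And>y i. y \<in> L \<Longrightarrow> i \<in> I \<Longrightarrow> \<bar>y i\<bar> \<le> b i" by metis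
  show thesis
  proof (rule that[of "Max (insert 1 (b ` I))"])
    show "0 < Max (insert 1 (b ` I))" using I by (simp add: Max_gr_iff)
    fix y i assume "y \<in> L" "i \<in> I"
    then show "\<bar>y i\<bar> \<le> Max (insert 1 (b ` I))"
      using I by (intro order_trans[OF b Max_ge]) auto
  qed
qed

section \<open>The support function and the norm of the polar body\<close>

definition supp :: "('i \<Rightarrow> real) \<Rightarrow> real" where
  "supp x = (SUP y\<in>L. vinner I x y)"

lemma supp_attained: "\<exists>k\<in>L. supp x = vinner I x k"
  and supp_upper: "y \<in> L \<Longrightarrow> vinner I x y \<le> supp x"
proof -
  have "compact ((\<lambda>y. vinner I x y) ` L)"
    unfolding vinner_def by (rule compact_image) (intro continuous_intros I, auto)
  then obtain s where s: "s \<in> (\<lambda>y. vinner I x y) ` L" "\<And>t. t \<in> (\<lambda>y. vinner I x y) ` L \<Longrightarrow> t \<le> s"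
    using compact_attains_sup[of "(\<lambda>y. vinner I x y) ` L"] zero_in by blast
  have "supp x = s" unfolding supp_def by (rule cSup_eq_maximum[OF s])
  then show "\<exists>k\<in>L. supp x = vinner I x k" and "y \<in> L \<Longrightarrow> vinner I x y \<le> supp x" using s by auto
qed

lemma supp_nonneg: "0 \<le> supp x"
  using supp_upper[OF zero_in, of x] by (simp add: vinner_def)

text \<open>This turns the two conditions of the Rudelson position on the polar body into a bound
  for the mean of the support function of \<open>L\<close> and, through
  \<open>L2_le_op_norm\<close>, one for its Lipschitz constant.\<close>

lemma body_norm_polar:
  assumes x: "x \<in> coord_space I"
  shows "body_norm I (polar I L) x = supp x"
proof -
  have "x \<in> vscale I t ` polar I L \<longleftrightarrow> supp x \<le> t" if t: "0 < t" for t
  proof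
    assume "x \<in> vscale I t ` polar I L"
    then obtain p where p: "p \<in> polar I L" "x = vscale I t p" by blast
    obtain k where k: "k \<in> L" "supp x = vinner I x k" using supp_attained by blast
    have "vinner I x k = t * vinner I p k"
      by (simp add: p(2) vinner_def vscale_def sum_distrib_left mult.assoc)
    also have "\<dots> \<le> t * 1" using p(1) k(1) t by (intro mult_left_mono) (auto simp: polar_def)
    finally show "supp x \<le> t" using k(2) by simp
  next
    assume le: "supp x \<le> t"
    have "vscale I (1 / t) x \<in> polar I L"
      unfolding polar_def
    proof (intro CollectI conjI ballI vscale_coord_space)
      fix y assume y: "y \<in> L"
      have "vinner I (vscale I (1 / t) x) y = vinner I x y / t"
        by (simp add: vinner_def vscale_def sum_divide_distrib)
      also have "\<dots> \<le> 1" using supp_upper[OF y, of x] le t by (simp add: divide_le_eq)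
      finally show "vinner I (vscale I (1 / t) x) y \<le> 1" .
    qed
    moreover have "x = vscale I t (vscale I (1 / t) x)"
      by (rule coord_space_eqI[of _ I]) (use x t in \<open>auto simp: vscale_def\<close>)
    ultimately show "x \<in> vscale I t ` polar I L" by blast
  qed
  then have eq: "{t. 0 < t \<and> x \<in> vscale I t ` polar I L} = {t. 0 < t \<and> supp x \<le> t}" by auto
  show ?thesis unfolding body_norm_def eq
  proof (rule antisym)
    show "Inf {t. 0 < t \<and> supp x \<le> t} \<le> supp x"
    proof (rule field_le_epsilon)
      fix e :: real assume "e > 0"
      then show "Inf {t. 0 < t \<and> supp x \<le> t} \<le> supp x + e"
        using supp_nonneg[of x] by (intro cInf_lower bdd_belowI[of _ 0]) auto
    qed
    show "supp x \<le> Inf {t. 0 < t \<and> supp x \<le> t}"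
    proof (rule cInf_greatest)
      show "{t. 0 < t \<and> supp x \<le> t} \<noteq> {}" using supp_nonneg[of x] by (auto intro!: exI[of _ "supp x + 1"])
    qed auto
  qed
qed

text \<open>The operator norm is the supremum of the support function over the Euclidean ball, that
  is, the circumradius of \<open>L\<close>; the point y is detected by the unit vector in its own
  direction.\<close>

lemma L2_le_op_norm:
  assumes y: "y \<in> L"
  shows "L2_set y I \<le> op_norm I (\<lambda>x. L2_set x I) (body_norm I (polar I L)) (\<lambda>x. x)"
proof -
  obtain B where B: "B > 0" "\<And>y i. y \<in> L \<Longrightarrow> i \<in> I \<Longrightarrow> \<bar>y i\<bar> \<le> B" using bounded by blast
  have eq: "op_norm I (\<lambda>x. L2_set x I) (body_norm I (polar I L)) (\<lambda>x. x) = (SUP x\<in>unit_ball I (\<lambda>x. L2_set x I). supp x)"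
    unfolding op_norm_def by (rule SUP_cong) (auto simp: unit_ball_def body_norm_polar)
  \<comment> \<open>\<open>op_norm\<close> is a supremum of reals, so it bounds its values from
    above only once they are known to be bounded.\<close>
  have bdd: "bdd_above (supp ` unit_ball I (\<lambda>x. L2_set x I))"
  proof (rule bdd_aboveI)
    fix s assume "s \<in> supp ` unit_ball I (\<lambda>x. L2_set x I)"
    then obtain x where x: "L2_set x I \<le> 1" "s = supp x" by (auto simp: unit_ball_def)
    obtain k where k: "k \<in> L" "supp x = vinner I x k" using supp_attained by blast
    have "vinner I x k \<le> L2_set x I * L2_set k I"
      by (rule order_trans[OF abs_ge_self vinner_cauchy_schwarz])
    also have "\<dots> \<le> 1 * (\<Sum>i\<in>I. \<bar>k i\<bar>)" by (intro mult_mono x L2_set_le_sum_abs) auto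
    also have "\<dots> \<le> (\<Sum>i\<in>I. B)" unfolding mult_1 by (rule sum_mono) (rule B(2)[OF k(1)])
    finally show "s \<le> (\<Sum>i\<in>I. B)" using x k by simp
  qed
  show ?thesis
  proof (cases "L2_set y I = 0")
    case True
    have "(\<lambda>i\<in>I. 0) \<in> unit_ball I (\<lambda>x. L2_set x I)" by (simp add: unit_ball_def L2_set_def)
    then have "supp (\<lambda>i\<in>I. 0) \<le> (SUP x\<in>unit_ball I (\<lambda>x. L2_set x I). supp x)" by (rule cSUP_upper[OF _ bdd])
    then show ?thesis using supp_nonneg[of "\<lambda>i\<in>I. 0"] True eq by simp
  next
    case False
    define r where "r = L2_set y I"
    have r: "r > 0" using False L2_set_nonneg[of y I] unfolding r_def by linarith
    define x where "x = vscale I (1 / r) y"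
    have "L2_set x I = L2_set (\<lambda>i. (1 / r) * y i) I" unfolding x_def vscale_def by (rule L2_set_cong) auto
    also have "\<dots> = (1 / r) * L2_set y I" using r by (subst L2_set_right_distrib) auto
    finally have "L2_set x I = 1" using r by (simp add: r_def)
    then have "supp x \<le> (SUP x\<in>unit_ball I (\<lambda>x. L2_set x I). supp x)"
      by (intro cSUP_upper[OF _ bdd]) (simp add: unit_ball_def x_def)
    moreover have "r \<le> supp x"
    proof -
      have "vinner I x y = (1 / r) * vinner I y y"
        by (simp add: x_def vinner_def vscale_def sum_distrib_left sum_divide_distrib)
      also have "\<dots> = r" using r by (simp add: vinner_self_L2 r_def[symmetric] power2_eq_square)
      finally show ?thesis using supp_upper[OF y, of x] by simp
    qed
    ultimately show ?thesis unfolding eq r_def by simp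
  qed
qed

lemma scaled_nonempty: "\<exists>r>0. \<forall>x\<in>coord_space I. \<forall>t>0. (\<Sum>i\<in>I. \<bar>x i\<bar>) \<le> r * t \<longrightarrow> x \<in> vscale I t ` L"
proof -
  obtain r where r: "r > 0" "\<And>y. y \<in> coord_space I \<Longrightarrow> (\<And>i. i \<in> I \<Longrightarrow> \<bar>y i\<bar> \<le> r) \<Longrightarrow> y \<in> L"
    using inner_box by blast
  show ?thesis
  proof (intro exI[of _ r] conjI ballI allI impI r(1))
    fix x t assume x: "x \<in> coord_space I" and t: "0 < (t :: real)" and le: "(\<Sum>i\<in>I. \<bar>x i\<bar>) \<le> r * t"
    have "vscale I (1 / t) x \<in> L"
    proof (rule r(2))
      fix i assume i: "i \<in> I"
      have "\<bar>x i\<bar> \<le> (\<Sum>i\<in>I. \<bar>x i\<bar>)" using i I by (intro member_le_sum) auto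
      then show "\<bar>vscale I (1 / t) x i\<bar> \<le> r"
        using le t i by (simp add: vscale_def abs_divide divide_le_eq)
    qed simp
    moreover have "x = vscale I t (vscale I (1 / t) x)"
      by (rule coord_space_eqI[of _ I]) (use x t in \<open>auto simp: vscale_def\<close>)
    ultimately show "x \<in> vscale I t ` L" by blast
  qed
qed

section \<open>The norm with unit ball \<open>L\<close>, and the volume of \<open>L\<close>\<close>

abbreviation "norm_L \<equiv> body_norm I L"

lemma norm_L_le: "0 < t \<Longrightarrow> x \<in> vscale I t ` L \<Longrightarrow> norm_L x \<le> t"
  unfolding body_norm_def by (rule cInf_lower) (auto intro!: bdd_belowI[of _ 0])

lemma norm_L_set_nonempty: "x \<in> coord_space I \<Longrightarrow> {t. 0 < t \<and> x \<in> vscale I t ` L} \<noteq> {}"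
proof -
  assume x: "x \<in> coord_space I"
  obtain r where r: "r > 0" "\<forall>x\<in>coord_space I. \<forall>t>0. (\<Sum>i\<in>I. \<bar>x i\<bar>) \<le> r * t \<longrightarrow> x \<in> vscale I t ` L"
    using scaled_nonempty by blast
  define t where "t = (\<Sum>i\<in>I. \<bar>x i\<bar>) / r + 1"
  have "0 < t" using r by (simp add: t_def add_nonneg_pos sum_nonneg)
  moreover have "(\<Sum>i\<in>I. \<bar>x i\<bar>) \<le> r * t" using r by (simp add: t_def algebra_simps)
  ultimately show ?thesis using r x by blast
qed

lemma norm_L_nonneg: "x \<in> coord_space I \<Longrightarrow> 0 \<le> norm_L x"
  unfolding body_norm_def by (rule cInf_greatest[OF norm_L_set_nonempty]) auto

lemma norm_L_less: "x \<in> coord_space I \<Longrightarrow> norm_L x < t \<Longrightarrow> x \<in> vscale I t ` L"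
proof -
  assume x: "x \<in> coord_space I" and lt: "norm_L x < t"
  obtain s where s: "0 < s" "x \<in> vscale I s ` L" "s < t"
    using lt cInf_lessD[OF norm_L_set_nonempty[OF x], of t] unfolding body_norm_def by blast
  then obtain y where y: "y \<in> L" "x = vscale I s y" by blast
  have "x = vscale I t (vscale I (s / t) y)"
    using s by (intro coord_space_eqI[of _ I]) (auto simp: y(2) vscale_def)
  moreover have "vscale I (s / t) y \<in> L" using s by (intro star y) auto
  ultimately show ?thesis by blast
qed

lemma norm_L_le_sum: "\<exists>C. \<forall>x\<in>coord_space I. norm_L x \<le> C * (\<Sum>i\<in>I. \<bar>x i\<bar>)"
proof -
  obtain r where r: "r > 0" "\<forall>x\<in>coord_space I. \<forall>t>0. (\<Sum>i\<in>I. \<bar>x i\<bar>) \<le> r * t \<longrightarrow> x \<in> vscale I t ` L"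
    using scaled_nonempty by blast
  show ?thesis
  proof (intro exI[of _ "1 / r"] ballI, rule field_le_epsilon)
    fix x e assume x: "x \<in> coord_space I" and e: "0 < (e :: real)"
    have s: "0 \<le> (\<Sum>i\<in>I. \<bar>x i\<bar>)" by (simp add: sum_nonneg)
    have "0 < 1 / r * (\<Sum>i\<in>I. \<bar>x i\<bar>) + e" using s r e by (simp add: add_nonneg_pos)
    moreover have "(\<Sum>i\<in>I. \<bar>x i\<bar>) \<le> r * (1 / r * (\<Sum>i\<in>I. \<bar>x i\<bar>) + e)"
      using r e by (simp add: algebra_simps)
    ultimately show "norm_L x \<le> 1 / r * (\<Sum>i\<in>I. \<bar>x i\<bar>) + e" using r x by (intro norm_L_le) auto
  qed
qed

lemma norm_L_triangle:
  assumes x: "x \<in> coord_space I" and y: "y \<in> coord_space I"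
  shows "norm_L (\<lambda>i\<in>I. x i + y i) \<le> norm_L x + norm_L y"
proof (rule field_le_epsilon)
  fix e :: real assume e: "e > 0"
  define s t where "s = norm_L x + e / 2" and "t = norm_L y + e / 2"
  have st: "0 < s" "0 < t" "norm_L x < s" "norm_L y < t" using e norm_L_nonneg[OF x] norm_L_nonneg[OF y] by (auto simp: s_def t_def)
  obtain a where a: "a \<in> L" "x = vscale I s a" using norm_L_less[OF x st(3)] by blast
  obtain b where b: "b \<in> L" "y = vscale I t b" using norm_L_less[OF y st(4)] by blast
  have "(\<lambda>i\<in>I. (1 - t / (s + t)) * a i + t / (s + t) * b i) \<in> L"
    using st by (intro convex_comb a b) auto
  moreover have "(\<lambda>i\<in>I. x i + y i) = vscale I (s + t) (\<lambda>i\<in>I. (1 - t / (s + t)) * a i + t / (s + t) * b i)"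
  proof (rule coord_space_eqI[of _ I])
    fix i assume i: "i \<in> I"
    have q: "(s + t) * (t / (s + t)) = t" using st by simp
    have "(s + t) * ((1 - t / (s + t)) * a i + t / (s + t) * b i)
        = (s + t - (s + t) * (t / (s + t))) * a i + (s + t) * (t / (s + t)) * b i"
      by (simp only: algebra_simps)
    also have "\<dots> = s * a i + t * b i" unfolding q by simp
    finally have "(s + t) * ((1 - t / (s + t)) * a i + t / (s + t) * b i) = s * a i + t * b i" .
    then show "(\<lambda>i\<in>I. x i + y i) i = vscale I (s + t) (\<lambda>i\<in>I. (1 - t / (s + t)) * a i + t / (s + t) * b i) i"
      using i by (simp add: a b vscale_def)
  qed auto
  ultimately have "norm_L (\<lambda>i\<in>I. x i + y i) \<le> s + t" using st by (intro norm_L_le) auto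
  then show "norm_L (\<lambda>i\<in>I. x i + y i) \<le> norm_L x + norm_L y + e" by (simp add: s_def t_def)
qed

lemma norm_L_lipschitz: "\<exists>C. \<forall>x\<in>coord_space I. \<forall>y\<in>coord_space I. \<bar>norm_L x - norm_L y\<bar> \<le> C * (\<Sum>i\<in>I. \<bar>x i - y i\<bar>)"
proof -
  obtain C where C: "\<And>x. x \<in> coord_space I \<Longrightarrow> norm_L x \<le> C * (\<Sum>i\<in>I. \<bar>x i\<bar>)" using norm_L_le_sum by blast
  have half: "norm_L x - norm_L y \<le> C * (\<Sum>i\<in>I. \<bar>x i - y i\<bar>)" if xy: "x \<in> coord_space I" "y \<in> coord_space I" for x y
  proof -
    have "norm_L (\<lambda>i\<in>I. y i + (\<lambda>i\<in>I. x i - y i) i) \<le> norm_L y + norm_L (\<lambda>i\<in>I. x i - y i)"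
      by (rule norm_L_triangle[OF xy(2) restrict_coord_space])
    moreover have "(\<lambda>i\<in>I. y i + (\<lambda>i\<in>I. x i - y i) i) = x"
      by (rule coord_space_eqI[OF restrict_coord_space xy(1)]) simp
    moreover have "norm_L (\<lambda>i\<in>I. x i - y i) \<le> C * (\<Sum>i\<in>I. \<bar>x i - y i\<bar>)"
      using C[of "\<lambda>i\<in>I. x i - y i"] by simp
    ultimately show ?thesis by simp
  qed
  show ?thesis
  proof (intro exI[of _ C] ballI)
    fix x y assume "x \<in> coord_space I" "y \<in> coord_space I"
    then show "\<bar>norm_L x - norm_L y\<bar> \<le> C * (\<Sum>i\<in>I. \<bar>x i - y i\<bar>)"
      using half[of x y] half[of y x] by (simp add: abs_minus_commute abs_le_iff)
  qed
qed

lemma norm_L_measurable: "norm_L \<in> borel_measurable (leb I)"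
  using norm_L_lipschitz lipschitz_measurable[OF I, of norm_L] by blast

lemma norm_L_integrable: "integrable (gaussian I) norm_L"
proof -
  obtain C where C: "\<And>x. x \<in> coord_space I \<Longrightarrow> norm_L x \<le> C * (\<Sum>i\<in>I. \<bar>x i\<bar>)" using norm_L_le_sum by blast
  show ?thesis
    by (rule integrable_gaussian_linear_growth[OF I norm_L_measurable, of C]) (use C norm_L_nonneg in simp)
qed

lemma mem_L_iff: "x \<in> coord_space I \<Longrightarrow> x \<in> L \<longleftrightarrow> norm_L x \<le> 1"
proof
  assume x: "x \<in> coord_space I" "x \<in> L"
  then have "x = vscale I 1 x" by (intro coord_space_eqI[of _ I]) (auto simp: vscale_def)
  then show "norm_L x \<le> 1" using x by (intro norm_L_le) auto
next
  assume x: "x \<in> coord_space I" and le: "norm_L x \<le> 1"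
  show "x \<in> L"
  proof (rule ccontr)
    assume xL: "x \<notin> L"
    have "closedin (powertop_real I) L"
      using body by (intro compactin_imp_closedin) (auto simp: convex_body_def Hausdorff_space_product_topology)
    then have op: "openin (powertop_real I) (topspace (powertop_real I) - L)" by blast
    have xin: "x \<in> topspace (powertop_real I) - L" using x xL by (simp add: coord_space_def)
    obtain e where e: "e > 0"
      "\<And>y. y \<in> coord_space I \<Longrightarrow> (\<And>i. i \<in> I \<Longrightarrow> \<bar>y i - x i\<bar> < e) \<Longrightarrow> y \<in> topspace (powertop_real I) - L"
      using box_in_open[OF I op xin] by blast
    define b where "b = (\<Sum>i\<in>I. \<bar>x i\<bar>) + 1"
    have b: "b > 0" by (simp add: b_def add_nonneg_pos sum_nonneg)
    have b2: "\<bar>x i\<bar> < b" if "i \<in> I" for i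
      using member_le_sum[OF that _ I, of "\<lambda>i. \<bar>x i\<bar>"] by (simp add: b_def)
    \<comment> \<open>The dilation is so close to 1 that x / t still lies in the box around x that
      misses the closed set \<open>L\<close>, although the norm bound puts x / t into
      \<open>L\<close>.\<close>
    define t where "t = 1 + e / b"
    have t: "t > 1" using e b by (simp add: t_def)
    obtain y where y: "y \<in> L" "x = vscale I t y" using norm_L_less[OF x, of t] le t by auto
    have "y \<in> topspace (powertop_real I) - L"
    proof (rule e(2)[OF L_sub[OF y(1)]])
      fix i assume i: "i \<in> I"
      have xi: "x i = t * y i" using i by (simp add: y(2) vscale_def)
      have "\<bar>y i\<bar> \<le> \<bar>x i\<bar>" unfolding xi abs_mult using t by (simp add: mult_le_cancel_right1)
      then have yb: "\<bar>y i\<bar> < b" using b2[OF i] by simp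
      have "\<bar>y i - x i\<bar> = (e / b) * \<bar>y i\<bar>"
        unfolding xi t_def using e b by (simp add: abs_mult algebra_simps abs_minus_commute)
      also have "\<dots> < (e / b) * b" using e b yb by (intro mult_strict_left_mono) auto
      finally show "\<bar>y i - x i\<bar> < e" using b by simp
    qed
    then show False using y by blast
  qed
qed

lemma unit_ball_norm_L: "unit_ball I norm_L = L"
  using mem_L_iff L_sub by (auto simp: unit_ball_def)

lemma L_sets: "L \<in> sets (leb I)"
proof -
  have "L = {x \<in> space (leb I). norm_L x \<le> 1}" using mem_L_iff L_sub by auto
  also have "\<dots> \<in> sets (leb I)" using norm_L_measurable by measurable
  finally show ?thesis .
qed

lemma norm_L_scale_le_iff: "0 < t \<Longrightarrow> x \<in> coord_space I \<Longrightarrow> norm_L (vscale I t x) \<le> t \<longleftrightarrow> x \<in> L"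
proof
  assume t: "0 < t" and x: "x \<in> coord_space I" and le: "norm_L (vscale I t x) \<le> t"
  have "norm_L x \<le> 1"
  proof (rule field_le_epsilon)
    fix e :: real assume e: "e > 0"
    have "0 < t * e" using t e by simp
    then have "norm_L (vscale I t x) < t * (1 + e)" using le by (simp add: distrib_left)
    then obtain y where y: "y \<in> L" "vscale I t x = vscale I (t * (1 + e)) y" using norm_L_less[of "vscale I t x"] by auto
    have "x = vscale I (1 + e) y"
    proof (rule coord_space_eqI[OF x vscale_coord_space])
      fix i assume i: "i \<in> I"
      have "t * x i = t * ((1 + e) * y i)" using fun_cong[OF y(2), of i] i by (simp add: vscale_def)
      then show "x i = vscale I (1 + e) y i" using t i by (simp add: vscale_def)
    qed
    then show "norm_L x \<le> 1 + e" using y e by (intro norm_L_le) auto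
  qed
  then show "x \<in> L" using mem_L_iff[OF x] by simp
qed (auto intro: norm_L_le)

text \<open>\<open>lebesgue_vol\<close> is a \<open>measure\<close>, whose value would be 0 for a
  set of infinite measure. A bounded set is dominated by a multiple of a Gaussian.\<close>

lemma emeasure_L_finite: "emeasure (leb I) L < \<infinity>"
proof -
  obtain B where B: "B > 0" "\<And>y i. y \<in> L \<Longrightarrow> i \<in> I \<Longrightarrow> \<bar>y i\<bar> \<le> B" using bounded by blast
  define b where "b = (\<Sum>i\<in>I. B\<^sup>2)"
  have "emeasure (leb I) L = (\<integral>\<^sup>+x. indicator L x \<partial>leb I)" using L_sets by simp
  also have "\<dots> \<le> (\<integral>\<^sup>+x. ennreal (exp b) * ennreal (exp (- 1 * (\<Sum>i\<in>I. (x i - 0)\<^sup>2))) \<partial>leb I)"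
  proof (rule nn_integral_mono)
    fix x
    have "1 \<le> exp b * exp (- 1 * (\<Sum>i\<in>I. (x i - 0)\<^sup>2))" if "x \<in> L"
    proof -
      have "(\<Sum>i\<in>I. (x i)\<^sup>2) \<le> b" unfolding b_def
        by (rule sum_mono) (use B(2)[OF that] in \<open>simp add: abs_le_square_iff[symmetric] B(1) less_imp_le\<close>)
      then show ?thesis by (simp add: exp_add[symmetric])
    qed
    then show "indicator L x \<le> ennreal (exp b) * ennreal (exp (- 1 * (\<Sum>i\<in>I. (x i - 0)\<^sup>2)))"
      by (auto simp: indicator_def ennreal_mult[symmetric])
  qed
  also have "\<dots> = ennreal (exp b) * ennreal (sqrt (pi / 1) ^ card I)"
    by (subst nn_integral_cmult, measurable) (subst nn_integral_gauss_leb[OF I], simp_all)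
  also have "\<dots> < \<infinity>" by (simp add: ennreal_mult[symmetric])
  finally show ?thesis .
qed

text \<open>Markov's inequality: half of the Gaussian mass lies in \<open>2 b L\<close>.\<close>

lemma volume_lower:
  assumes b: "b > 0" "ell I L \<le> b"
  shows "1 / 2 \<le> (2 * b / sqrt (2 * pi)) ^ card I * lebesgue_vol I L"
proof -
  interpret prob_space "gaussian I" by (rule prob_space_gaussian)
  define t where "t = 2 * b"
  have t: "t > 0" using b by (simp add: t_def)
  have Ng[measurable]: "norm_L \<in> borel_measurable (gaussian I)" using norm_L_measurable by (simp cong: measurable_cong_sets)
  note norm_L_measurable[measurable]
  have m: "prob {x \<in> space (gaussian I). t \<le> norm_L x} \<le> ell I L / t"
    unfolding ell_def using norm_L_nonneg t
    by (intro integral_Markov_inequality_measure[OF norm_L_integrable sets.top]) (auto intro!: AE_I2)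
  also have "\<dots> \<le> 1 / 2" using b by (simp add: t_def divide_le_eq)
  finally have "1 / 2 \<le> 1 - prob {x \<in> space (gaussian I). t \<le> norm_L x}" by simp
  also have "\<dots> = prob (space (gaussian I) - {x \<in> space (gaussian I). t \<le> norm_L x})"
    by (rule prob_compl[symmetric]) measurable
  also have "\<dots> \<le> prob {x \<in> space (gaussian I). norm_L x \<le> t}"
  proof (rule finite_measure_mono)
    show "{x \<in> space (gaussian I). norm_L x \<le> t} \<in> events" by measurable
  qed auto
  finally have "ennreal (1 / 2) \<le> emeasure (gaussian I) {x \<in> space (gaussian I). norm_L x \<le> t}"
    by (simp only: emeasure_eq_measure ennreal_leI)
  also have "\<dots> = (\<integral>\<^sup>+x. indicator {x \<in> coord_space I. norm_L x \<le> t} x \<partial>gaussian I)"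
  proof -
    have "{x \<in> space (gaussian I). norm_L x \<le> t} \<in> events" by measurable
    from nn_integral_indicator[OF this] show ?thesis by simp
  qed
  also have "\<dots> = (\<integral>\<^sup>+x. ennreal (gauss_density I x) * indicator {x \<in> coord_space I. norm_L x \<le> t} x \<partial>leb I)"
  proof (rule nn_integral_gaussian[OF I])
    have "{x \<in> space (leb I). norm_L x \<le> t} \<in> sets (leb I)" by measurable
    then show "(indicator {x \<in> coord_space I. norm_L x \<le> t} :: _ \<Rightarrow> ennreal) \<in> borel_measurable (leb I)" by simp
  qed
  also have "\<dots> \<le> (\<integral>\<^sup>+x. ennreal ((1 / sqrt (2 * pi)) ^ card I) * indicator {x \<in> coord_space I. norm_L x \<le> t} x \<partial>leb I)"
  proof (intro nn_integral_mono mult_right_mono ennreal_leI)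
    fix x show "gauss_density I x \<le> (1 / sqrt (2 * pi)) ^ card I"
      unfolding gauss_density_def by (intro mult_left_le) (auto simp: sum_nonneg)
  qed simp
  also have "\<dots> = ennreal ((1 / sqrt (2 * pi)) ^ card I) * (\<integral>\<^sup>+x. indicator {x \<in> coord_space I. norm_L x \<le> t} x \<partial>leb I)"
  proof (rule nn_integral_cmult)
    have "{x \<in> space (leb I). norm_L x \<le> t} \<in> sets (leb I)" by measurable
    then show "(indicator {x \<in> coord_space I. norm_L x \<le> t} :: _ \<Rightarrow> ennreal) \<in> borel_measurable (leb I)" by simp
  qed
  also have "(\<integral>\<^sup>+x. indicator {x \<in> coord_space I. norm_L x \<le> t} x \<partial>leb I) = ennreal (t ^ card I) * emeasure (leb I) L"
  proof -
    have s: "{x \<in> space (leb I). norm_L x \<le> t} \<in> sets (leb I)" by measurable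
    have "(\<integral>\<^sup>+x. indicator {x \<in> coord_space I. norm_L x \<le> t} x \<partial>leb I)
        = ennreal (\<bar>t\<bar> ^ card I) * (\<integral>\<^sup>+x. indicator {x \<in> coord_space I. norm_L x \<le> t} (\<lambda>i\<in>I. 0 + t * x i) \<partial>leb I)"
      by (rule nn_integral_leb_affine[OF I]) (use t s in auto)
    also have "(\<integral>\<^sup>+x. indicator {x \<in> coord_space I. norm_L x \<le> t} (\<lambda>i\<in>I. 0 + t * x i) \<partial>leb I)
        = (\<integral>\<^sup>+x. indicator L x \<partial>leb I)"
    proof (rule nn_integral_cong)
      fix x assume x: "x \<in> space (leb I)"
      have "(\<lambda>i\<in>I. 0 + t * x i) = vscale I t x" by (simp add: vscale_def)
      then show "indicator {x \<in> coord_space I. norm_L x \<le> t} (\<lambda>i\<in>I. 0 + t * x i) = (indicator L x :: ennreal)"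
        using norm_L_scale_le_iff[OF t, of x] x by (simp add: indicator_def)
    qed
    also have "\<dots> = emeasure (leb I) L" using L_sets by simp
    finally show ?thesis using t by simp
  qed
  also have "emeasure (leb I) L = ennreal (lebesgue_vol I L)"
    unfolding lebesgue_vol_def using emeasure_L_finite by (intro emeasure_eq_ennreal_measure) simp
  finally have "ennreal (1 / 2) \<le> ennreal ((1 / sqrt (2 * pi)) ^ card I * (t ^ card I * lebesgue_vol I L))"
    using t by (simp add: ennreal_mult lebesgue_vol_def)
  then have "1 / 2 \<le> (1 / sqrt (2 * pi)) ^ card I * (t ^ card I * lebesgue_vol I L)"
    by (subst (asm) ennreal_le_iff) (use t in \<open>auto simp: lebesgue_vol_def\<close>)
  then show ?thesis by (simp add: t_def power_divide mult.assoc)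
qed

end

subsection \<open>The Gaussian transform of a random matrix\<close>

text \<open>Bernoulli's inequality for real exponents, from the convexity of exp between 0 and ln (1
  + r x) with weight 1 / r.\<close>

lemma bernoulli_powr:
  assumes "r \<ge> 1" "x \<ge> 0"
  shows "1 + r * x \<le> (1 + x) powr (r :: real)"
proof -
  have p: "0 < 1 + r * x" using assms by (simp add: add_pos_nonneg)
  have "exp ((1 - 1 / r) *\<^sub>R 0 + (1 / r) *\<^sub>R ln (1 + r * x)) \<le> (1 - 1 / r) * exp 0 + (1 / r) * exp (ln (1 + r * x))"
    by (rule convex_onD[OF exp_convex]) (use assms in auto)
  then have "exp (ln (1 + r * x) / r) \<le> (1 - 1 / r) + (1 / r) * (1 + r * x)"
    using p by simp
  also have "\<dots> = 1 + x" using assms by (simp add: field_simps)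
  finally have "exp (ln (1 + r * x) / r) powr r \<le> (1 + x) powr r"
    using assms by (intro powr_mono2) auto
  then show ?thesis using p assms by (simp add: powr_def)
qed

lemma nn_integral_cauchy:
  assumes c: "c > 0"
  shows "(\<integral>\<^sup>+t. ennreal (1 / (1 + c * t\<^sup>2)) \<partial>lborel) = ennreal (pi / sqrt c)"
proof -
  have int: "integrable lborel (\<lambda>t::real. inverse (1 + t\<^sup>2))"
    using integrable_inverse_1_plus_square by (simp add: set_integrable_def)
  have val: "(LINT t|lborel. inverse (1 + t\<^sup>2)) = pi"
    using LBINT_inverse_1_plus_square by (simp add: interval_lebesgue_integral_def set_lebesgue_integral_def)
  have "(\<integral>\<^sup>+t. ennreal (inverse (1 + t\<^sup>2)) \<partial>lborel) = ennreal pi"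
    by (subst nn_integral_eq_integral[OF int]) (simp_all add: val)
  moreover have "(\<integral>\<^sup>+t. ennreal (inverse (1 + t\<^sup>2)) \<partial>lborel)
      = ennreal \<bar>sqrt c\<bar> * (\<integral>\<^sup>+t. ennreal (inverse (1 + (0 + sqrt c * t)\<^sup>2)) \<partial>lborel)"
    by (rule nn_integral_real_affine) (use c in auto)
  ultimately have eq: "ennreal pi = ennreal (sqrt c) * (\<integral>\<^sup>+t. ennreal (1 / (1 + c * t\<^sup>2)) \<partial>lborel)"
    using c by (simp add: power_mult_distrib inverse_eq_divide)
  have "(\<integral>\<^sup>+t. ennreal (1 / (1 + c * t\<^sup>2)) \<partial>lborel)
      = ennreal (1 / sqrt c) * (ennreal (sqrt c) * (\<integral>\<^sup>+t. ennreal (1 / (1 + c * t\<^sup>2)) \<partial>lborel))"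
    using c by (simp add: mult.assoc[symmetric] ennreal_mult[symmetric])
  also have "\<dots> = ennreal (pi / sqrt c)"
    unfolding eq[symmetric] using c by (simp add: ennreal_mult[symmetric])
  finally show ?thesis .
qed

text \<open>Bernoulli's inequality replaces the integrand by a Cauchy density. The bound keeps the
  correct order 1 / sqrt q, and these factors multiply up to the square root of a factorial in
  \<open>nn_integral_student\<close>.\<close>

lemma nn_integral_student_1d:
  assumes s: "s > 0" and q: "q \<ge> 2"
  shows "(\<integral>\<^sup>+t. ennreal ((s + t\<^sup>2) powr (- q / 2)) \<partial>lborel) \<le> ennreal (s powr (- (q - 1) / 2) * (pi * sqrt (2 / q)))"
proof -
  define c where "c = q / (2 * s)"
  have c: "c > 0" using s q by (simp add: c_def)
  have "(\<integral>\<^sup>+t. ennreal ((s + t\<^sup>2) powr (- q / 2)) \<partial>lborel) \<le> (\<integral>\<^sup>+t. ennreal (s powr (- q / 2)) * ennreal (1 / (1 + c * t\<^sup>2)) \<partial>lborel)"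
  proof (rule nn_integral_mono)
    fix t
    have "1 + c * t\<^sup>2 = 1 + (q / 2) * (t\<^sup>2 / s)" using s by (simp add: c_def)
    also have "\<dots> \<le> (1 + t\<^sup>2 / s) powr (q / 2)" using s q by (intro bernoulli_powr) auto
    finally have b: "1 + c * t\<^sup>2 \<le> (1 + t\<^sup>2 / s) powr (q / 2)" .
    have p: "0 < 1 + c * t\<^sup>2" using c by (simp add: add_pos_nonneg)
    have "s + t\<^sup>2 = s * (1 + t\<^sup>2 / s)" using s by (simp add: field_simps)
    then have "(s + t\<^sup>2) powr (- q / 2) = s powr (- q / 2) * (1 / (1 + t\<^sup>2 / s) powr (q / 2))"
      using s by (simp add: powr_mult powr_minus_divide)
    also have "\<dots> \<le> s powr (- q / 2) * (1 / (1 + c * t\<^sup>2))"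
      using b p by (intro mult_left_mono frac_le) auto
    finally show "ennreal ((s + t\<^sup>2) powr (- q / 2)) \<le> ennreal (s powr (- q / 2)) * ennreal (1 / (1 + c * t\<^sup>2))"
      using p by (simp add: ennreal_mult[symmetric] ennreal_leI)
  qed
  also have "\<dots> = ennreal (s powr (- q / 2)) * ennreal (pi / sqrt c)"
    by (subst nn_integral_cmult, measurable) (simp add: nn_integral_cauchy[OF c])
  also have "\<dots> = ennreal (s powr (- (q - 1) / 2) * (pi * sqrt (2 / q)))"
  proof -
    have "pi / sqrt c = sqrt s * (pi * sqrt (2 / q))"
      using s q by (simp add: c_def real_sqrt_divide real_sqrt_mult)
    moreover have "s powr (- q / 2) * sqrt s = s powr (- (q - 1) / 2)"
      using s by (simp add: powr_half_sqrt[symmetric] powr_add[symmetric] field_simps)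
    ultimately have e: "s powr (- q / 2) * (pi / sqrt c) = s powr (- (q - 1) / 2) * (pi * sqrt (2 / q))"
      by (simp only: mult.assoc[symmetric])
    show ?thesis unfolding e[symmetric] using c by (intro ennreal_mult[symmetric]) auto
  qed
  finally show ?thesis .
qed

text \<open>Integrating out one coordinate lowers the exponent by exactly one half, so the induction
  reproduces the same kind of integrand in one dimension less. With exponent - n / 2 instead of - (1
  + n) / 2 the integral over n > 0 dimensions would diverge.\<close>

lemma nn_integral_student:
  assumes "finite I" "s > 0"
  shows "(\<integral>\<^sup>+x. ennreal ((s + (\<Sum>i\<in>I. (x i)\<^sup>2)) powr (- (1 + real (card I)) / 2)) \<partial>leb I)
    \<le> ennreal (s powr (- 1 / 2) * ((pi * sqrt 2) ^ card I / sqrt (fact (card I))))"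
  using assms
proof (induction I arbitrary: s rule: finite_induct)
  case empty
  have "emeasure (leb {}) (coord_space ({} :: 'a set)) = 1"
    by (simp add: PiM_empty coord_space_def PiE_empty_domain)
  then show ?case by simp
next
  case (insert k I)
  define m where "m = card I"
  define q where "q = 2 + real m"
  have c: "card (insert k I) = Suc m" using insert by (simp add: m_def)
  have "(\<integral>\<^sup>+x. ennreal ((s + (\<Sum>i\<in>insert k I. (x i)\<^sup>2)) powr (- (1 + real (card (insert k I))) / 2)) \<partial>leb (insert k I))
     = (\<integral>\<^sup>+x. \<integral>\<^sup>+t. ennreal ((s + (\<Sum>i\<in>insert k I. ((x(k := t)) i)\<^sup>2)) powr (- (1 + real (card (insert k I))) / 2)) \<partial>lborel \<partial>leb I)"
    by (rule leb.product_nn_integral_insert) (use insert in \<open>auto, measurable\<close>)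
  also have "\<dots> = (\<integral>\<^sup>+x. \<integral>\<^sup>+t. ennreal (((s + (\<Sum>i\<in>I. (x i)\<^sup>2)) + t\<^sup>2) powr (- q / 2)) \<partial>lborel \<partial>leb I)"
  proof (intro nn_integral_cong)
    fix x :: "'a \<Rightarrow> real" and t
    have "(\<Sum>i\<in>I. ((x(k := t)) i)\<^sup>2) = (\<Sum>i\<in>I. (x i)\<^sup>2)" using insert by (intro sum.cong) auto
    then have "(\<Sum>i\<in>insert k I. ((x(k := t)) i)\<^sup>2) = t\<^sup>2 + (\<Sum>i\<in>I. (x i)\<^sup>2)"
      using insert by simp
    then show "ennreal ((s + (\<Sum>i\<in>insert k I. ((x(k := t)) i)\<^sup>2)) powr (- (1 + real (card (insert k I))) / 2))
      = ennreal (((s + (\<Sum>i\<in>I. (x i)\<^sup>2)) + t\<^sup>2) powr (- q / 2))"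
      by (simp only: c q_def) (simp add: algebra_simps)
  qed
  also have "\<dots> \<le> (\<integral>\<^sup>+x. ennreal ((s + (\<Sum>i\<in>I. (x i)\<^sup>2)) powr (- (q - 1) / 2) * (pi * sqrt (2 / q))) \<partial>leb I)"
    using insert by (intro nn_integral_mono nn_integral_student_1d) (auto simp: q_def add_pos_nonneg sum_nonneg)
  also have "\<dots> = (\<integral>\<^sup>+x. ennreal (pi * sqrt (2 / q)) * ennreal ((s + (\<Sum>i\<in>I. (x i)\<^sup>2)) powr (- (1 + real (card I)) / 2)) \<partial>leb I)"
    by (intro nn_integral_cong) (simp add: ennreal_mult[symmetric] q_def m_def mult.commute)
  also have "\<dots> = ennreal (pi * sqrt (2 / q)) * (\<integral>\<^sup>+x. ennreal ((s + (\<Sum>i\<in>I. (x i)\<^sup>2)) powr (- (1 + real (card I)) / 2)) \<partial>leb I)"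
    by (rule nn_integral_cmult) measurable
  also have "\<dots> \<le> ennreal (pi * (sqrt 2 / sqrt (1 + real m))) * ennreal (s powr (- 1 / 2) * ((pi * sqrt 2) ^ card I / sqrt (fact (card I))))"
    by (intro mult_mono insert.IH insert.prems ennreal_leI mult_left_mono)
      (auto simp: q_def real_sqrt_divide intro!: divide_left_mono)
  also have "\<dots> = ennreal (s powr (- 1 / 2) * ((pi * sqrt 2) ^ card (insert k I) / sqrt (fact (card (insert k I)))))"
  proof -
    have "sqrt (fact (Suc m)) = sqrt (1 + real m) * sqrt (fact m)"
      by (simp only: fact_Suc real_sqrt_mult) simp
    then have "pi * (sqrt 2 / sqrt (1 + real m)) * (s powr (- 1 / 2) * ((pi * sqrt 2) ^ m / sqrt (fact m)))
        = s powr (- 1 / 2) * ((pi * sqrt 2) ^ Suc m / sqrt (fact (Suc m)))"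
      by (simp del: fact_Suc)
    then show ?thesis unfolding c m_def[symmetric] by (subst ennreal_mult[symmetric]) auto
  qed
  finally show ?case .
qed

text \<open>The elementary half of Stirling's formula. For n = d^2 it bounds the square root of the
  factorial below by (d / sqrt e)^n, and this is the gain of a factor d per dimension in the volume
  of the image.\<close>

lemma fact_ge_power: "(real n / exp 1) ^ n \<le> fact n"
proof (induction n)
  case (Suc n)
  have "(1 + 1 / real n) ^ n \<le> exp 1" if "n > 0"
  proof -
    have "(1 + 1 / real n) ^ n \<le> exp (1 / real n) ^ n"
      by (intro power_mono exp_ge_add_one_self) simp
    then show ?thesis using that by (simp add: exp_of_nat_mult[symmetric])
  qed
  then have "real (Suc n) ^ n \<le> exp 1 * real n ^ n"
  proof (cases "n = 0")
    case False
    then have "real (Suc n) ^ n = (1 + 1 / real n) ^ n * real n ^ n"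
      by (simp add: power_mult_distrib[symmetric] field_simps)
    then show ?thesis using \<open>n > 0 \<Longrightarrow> _\<close> False by (simp add: mult_right_mono)
  qed simp
  then have "real (Suc n) ^ Suc n / exp 1 ^ Suc n \<le> real (Suc n) * (exp 1 * real n ^ n) / exp 1 ^ Suc n"
    by (intro divide_right_mono) (auto intro!: mult_left_mono)
  also have "\<dots> = real (Suc n) * (real n / exp 1) ^ n" by (simp add: power_divide)
  also have "\<dots> \<le> real (Suc n) * fact n" by (rule mult_left_mono[OF Suc]) simp
  finally show ?case by (simp add: power_divide)
qed simp

text \<open>For an invertible \<open>A\<close> and \<delta> = 0 this is (2 pi)^(n/2) / |det A|; for
  a singular \<open>A\<close> and \<delta> = 0 it is infinite, hence the type
  \<open>ennreal\<close>.\<close>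

definition gauss_transform :: "'i set \<Rightarrow> real \<Rightarrow> ('i \<times> 'i \<Rightarrow> real) \<Rightarrow> ennreal" where
  "gauss_transform I \<delta> A = (\<integral>\<^sup>+x. ennreal (exp (- ((L2_set (lin_map I A x) I)\<^sup>2 + \<delta>\<^sup>2 * (\<Sum>i\<in>I. (x i)\<^sup>2)) / 2)) \<partial>leb I)"

lemma L2_lin_map_sq: "(L2_set (lin_map I A x) I)\<^sup>2 = (\<Sum>i\<in>I. (\<Sum>j\<in>I. A (i, j) * x j)\<^sup>2)"
  by (simp add: L2_set_def lin_map_def sum_nonneg)

lemma measurable_gauss_pair:
  "(\<lambda>(A, x). ennreal (exp (- ((L2_set (lin_map I A x) I)\<^sup>2 + \<delta>\<^sup>2 * (\<Sum>i\<in>I. (x i)\<^sup>2)) / 2)))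
    \<in> borel_measurable (leb (I \<times> I) \<Otimes>\<^sub>M leb I)"
proof -
  have a: "(\<lambda>p. fst p (i, j)) \<in> borel_measurable (leb (I \<times> I) \<Otimes>\<^sub>M leb I)" if "i \<in> I" "j \<in> I" for i j
    by (rule measurable_coord[OF measurable_fst]) (use that in simp)
  have b: "(\<lambda>p. snd p i) \<in> borel_measurable (leb (I \<times> I) \<Otimes>\<^sub>M leb I)" if "i \<in> I" for i
    by (rule measurable_coord[OF measurable_snd that])
  have [measurable]: "(\<lambda>p. \<Sum>i\<in>I. (\<Sum>j\<in>I. fst p (i, j) * snd p j)\<^sup>2) \<in> borel_measurable (leb (I \<times> I) \<Otimes>\<^sub>M leb I)"
    "(\<lambda>p. \<Sum>i\<in>I. (snd p i)\<^sup>2) \<in> borel_measurable (leb (I \<times> I) \<Otimes>\<^sub>M leb I)"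
    by (intro borel_measurable_sum borel_measurable_power borel_measurable_times a b; assumption)+
  show ?thesis unfolding L2_lin_map_sq split_beta' by measurable
qed

lemma measurable_gauss_transform: "finite I \<Longrightarrow> gauss_transform I \<delta> \<in> borel_measurable (leb (I \<times> I))"
  unfolding gauss_transform_def
  by (rule sigma_finite_measure.borel_measurable_nn_integral[OF sigma_finite_leb measurable_gauss_pair])

lemma nn_integral_gauss_quadratic:
  "(\<integral>\<^sup>+t. ennreal (exp (- r * t\<^sup>2 / 2)) \<partial>std_normal_distribution) = ennreal ((1 + r) powr (- 1 / 2))" if r: "r \<ge> 0"
proof -
  have "(\<integral>\<^sup>+t. ennreal (exp (- r * t\<^sup>2 / 2)) \<partial>std_normal_distribution)
      = (\<integral>\<^sup>+t. ennreal (std_normal_density t) * ennreal (exp (- r * t\<^sup>2 / 2)) \<partial>lborel)"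
    by (rule nn_integral_density) measurable
  also have "\<dots> = (\<integral>\<^sup>+t. ennreal (1 / sqrt (2 * pi)) * ennreal (exp (- ((1 + r) / 2) * (t - 0)\<^sup>2)) \<partial>lborel)"
    by (intro nn_integral_cong)
      (simp add: std_normal_density_def ennreal_mult[symmetric] exp_add[symmetric] add_divide_distrib algebra_simps)
  also have "\<dots> = ennreal (1 / sqrt (2 * pi)) * ennreal (sqrt (pi / ((1 + r) / 2)))"
    by (subst nn_integral_cmult, measurable) (subst nn_integral_gauss_1d, use r in simp_all)
  also have "\<dots> = ennreal ((1 + r) powr (- 1 / 2))"
    using r by (simp add: ennreal_mult[symmetric] real_sqrt_divide real_sqrt_mult powr_minus_divide powr_half_sqrt)
  finally show ?thesis .
qed

text \<open>For fixed x the vector A x is distributed like |x| times a standard Gaussian vector, so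
  the expectation is a product of equal one-dimensional integrals.\<close>

lemma nn_integral_gauss_row:
  assumes I: "finite I" "I \<noteq> {}"
  shows "(\<integral>\<^sup>+A. ennreal (exp (- (L2_set (lin_map I A x) I)\<^sup>2 / 2)) \<partial>gaussian (I \<times> I))
    = ennreal ((1 + (\<Sum>i\<in>I. (x i)\<^sup>2)) powr (- real (card I) / 2))"
proof (cases "(\<Sum>i\<in>I. (x i)\<^sup>2) = 0")
  case True
  then have "\<And>i. i \<in> I \<Longrightarrow> x i = 0" using I by (simp add: sum_nonneg_eq_0_iff)
  then have "L2_set (lin_map I A x) I = 0" for A by (simp add: L2_set_def lin_map_def)
  then show ?thesis using True prob_space.emeasure_space_1[OF prob_space_gaussian, of "I \<times> I"] by simp
next
  case False
  define r where "r = sqrt (\<Sum>i\<in>I. (x i)\<^sup>2)"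
  have r: "r > 0" "r\<^sup>2 = (\<Sum>i\<in>I. (x i)\<^sup>2)" using False by (auto simp: r_def sum_nonneg less_le)
  define u where "u = (\<lambda>i. x i / r)"
  have u: "(\<Sum>i\<in>I. (u i)\<^sup>2) = 1" using False by (simp add: u_def power_divide sum_divide_distrib[symmetric] r(2))
  define f where "f = (\<lambda>y. \<Prod>i\<in>I. ennreal (exp (- r\<^sup>2 * (y i)\<^sup>2 / 2)))"
  have fm: "f \<in> borel_measurable (leb I)" unfolding f_def by measurable
  have "(\<integral>\<^sup>+A. ennreal (exp (- (L2_set (lin_map I A x) I)\<^sup>2 / 2)) \<partial>gaussian (I \<times> I))
      = (\<integral>\<^sup>+A. f (\<lambda>k\<in>I. \<Sum>j\<in>I. u j * A (k, j)) \<partial>gaussian (I \<times> I))"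
  proof (rule nn_integral_cong)
    fix A :: "'a \<times> 'a \<Rightarrow> real"
    have "(\<Sum>j\<in>I. A (i, j) * x j) = r * (\<Sum>j\<in>I. u j * A (i, j))" for i
      using r(1) by (simp add: u_def sum_distrib_left mult.commute)
    then have "(L2_set (lin_map I A x) I)\<^sup>2 = (\<Sum>i\<in>I. r\<^sup>2 * (\<Sum>j\<in>I. u j * A (i, j))\<^sup>2)"
      by (simp add: L2_lin_map_sq power_mult_distrib)
    then show "ennreal (exp (- (L2_set (lin_map I A x) I)\<^sup>2 / 2)) = f (\<lambda>k\<in>I. \<Sum>j\<in>I. u j * A (k, j))"
      using I by (simp add: f_def prod_ennreal exp_sum[symmetric] sum_negf sum_divide_distrib)
  qed
  also have "\<dots> = (\<integral>\<^sup>+y. f y \<partial>gaussian I)"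
    by (rule nn_integral_gaussian_contract[where c = "\<lambda>j k. (k, j)"]) (use I u fm in \<open>auto intro!: inj_onI\<close>)
  also have "\<dots> = (\<Prod>i\<in>I. ennreal ((1 + r\<^sup>2) powr (- 1 / 2)))"
    unfolding f_def
    by (subst nn_integral_gaussian_prod[OF I(1)]) (simp_all only: nn_integral_gauss_quadratic zero_le_power2, measurable)
  also have "\<dots> = ennreal ((1 + r\<^sup>2) powr (- real (card I) / 2))"
  proof -
    have "0 < 1 + r\<^sup>2" by (simp add: add_pos_nonneg)
    then show ?thesis
      using powr_realpow[of "(1 + r\<^sup>2) powr (- 1 / 2)" "card I"] by (simp add: ennreal_power powr_powr)
  qed
  finally show ?thesis using r by simp
qed

text \<open>From \<delta>^2 (1 + r) \<le> exp (\<delta>^2 (1 + r)) one gets exp (- \<delta>^2 r / 2)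
  \<le> (2 / \<delta>) / sqrt (1 + r). This raises the exponent to the one for which
  \<open>nn_integral_student\<close> converges.\<close>

lemma nn_integral_gauss_transform:
  assumes I: "finite I" "I \<noteq> {}" and \<delta>: "0 < \<delta>" "\<delta> \<le> 1"
  shows "(\<integral>\<^sup>+A. gauss_transform I \<delta> A \<partial>gaussian (I \<times> I))
    \<le> ennreal (2 / \<delta> * ((pi * sqrt 2) ^ card I / sqrt (fact (card I))))"
proof -
  let ?G = "gaussian (I \<times> I)"
  define n where "n = real (card I)"
  interpret P: pair_sigma_finite "leb I" ?G
    using sigma_finite_leb[OF I(1)] prob_space_imp_sigma_finite[OF prob_space_gaussian]
    by (simp add: pair_sigma_finite_def)
  have m: "(\<lambda>(A, x). ennreal (exp (- ((L2_set (lin_map I A x) I)\<^sup>2 + \<delta>\<^sup>2 * (\<Sum>i\<in>I. (x i)\<^sup>2)) / 2)))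
    \<in> borel_measurable (?G \<Otimes>\<^sub>M leb I)"
    using measurable_gauss_pair[of I \<delta>] by (simp cong: measurable_cong_sets sets_pair_measure_cong add: sets_gaussian)
  have m': "(\<lambda>(x, A). ennreal (exp (- ((L2_set (lin_map I A x) I)\<^sup>2 + \<delta>\<^sup>2 * (\<Sum>i\<in>I. (x i)\<^sup>2)) / 2)))
    \<in> borel_measurable (leb I \<Otimes>\<^sub>M ?G)"
    using measurable_pair_swap[OF m] by (simp add: split_beta')
  have mA: "(\<lambda>A. ennreal (exp (- (L2_set (lin_map I A x) I)\<^sup>2 / 2))) \<in> borel_measurable ?G" for x
  proof -
    have "(\<lambda>A. \<Sum>i\<in>I. (\<Sum>j\<in>I. A (i, j) * x j)\<^sup>2) \<in> borel_measurable (leb (I \<times> I))"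
      by (intro borel_measurable_sum borel_measurable_power borel_measurable_times borel_measurable_const
          measurable_coord[OF measurable_ident_sets[OF refl]]) auto
    then show ?thesis unfolding L2_lin_map_sq by (simp cong: measurable_cong_sets add: sets_gaussian)
  qed
  have "(\<integral>\<^sup>+A. gauss_transform I \<delta> A \<partial>?G)
     = (\<integral>\<^sup>+x. \<integral>\<^sup>+A. ennreal (exp (- ((L2_set (lin_map I A x) I)\<^sup>2 + \<delta>\<^sup>2 * (\<Sum>i\<in>I. (x i)\<^sup>2)) / 2)) \<partial>?G \<partial>leb I)"
    unfolding gauss_transform_def by (rule P.Fubini'[OF m'])
  also have "\<dots> = (\<integral>\<^sup>+x. ennreal (exp (- \<delta>\<^sup>2 * (\<Sum>i\<in>I. (x i)\<^sup>2) / 2)) * ennreal ((1 + (\<Sum>i\<in>I. (x i)\<^sup>2)) powr (- n / 2)) \<partial>leb I)"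
  proof (rule nn_integral_cong)
    fix x :: "'a \<Rightarrow> real"
    have "(\<integral>\<^sup>+A. ennreal (exp (- ((L2_set (lin_map I A x) I)\<^sup>2 + \<delta>\<^sup>2 * (\<Sum>i\<in>I. (x i)\<^sup>2)) / 2)) \<partial>?G)
      = (\<integral>\<^sup>+A. ennreal (exp (- \<delta>\<^sup>2 * (\<Sum>i\<in>I. (x i)\<^sup>2) / 2)) * ennreal (exp (- (L2_set (lin_map I A x) I)\<^sup>2 / 2)) \<partial>?G)"
      by (intro nn_integral_cong) (simp add: ennreal_mult[symmetric] exp_add[symmetric] add_divide_distrib[symmetric])
    also have "\<dots> = ennreal (exp (- \<delta>\<^sup>2 * (\<Sum>i\<in>I. (x i)\<^sup>2) / 2)) * ennreal ((1 + (\<Sum>i\<in>I. (x i)\<^sup>2)) powr (- n / 2))"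
      unfolding n_def nn_integral_gauss_row[OF I, symmetric] by (rule nn_integral_cmult[OF mA])
    finally show "(\<integral>\<^sup>+A. ennreal (exp (- ((L2_set (lin_map I A x) I)\<^sup>2 + \<delta>\<^sup>2 * (\<Sum>i\<in>I. (x i)\<^sup>2)) / 2)) \<partial>?G)
      = ennreal (exp (- \<delta>\<^sup>2 * (\<Sum>i\<in>I. (x i)\<^sup>2) / 2)) * ennreal ((1 + (\<Sum>i\<in>I. (x i)\<^sup>2)) powr (- n / 2))" .
  qed
  also have "\<dots> \<le> (\<integral>\<^sup>+x. ennreal (2 / \<delta>) * ennreal ((1 + (\<Sum>i\<in>I. (x i)\<^sup>2)) powr (- (1 + real (card I)) / 2)) \<partial>leb I)"
  proof (rule nn_integral_mono)
    fix x :: "'a \<Rightarrow> real"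
    define r where "r = (\<Sum>i\<in>I. (x i)\<^sup>2)"
    have r: "0 \<le> r" by (simp add: r_def sum_nonneg)
    have "\<delta>\<^sup>2 * (1 + r) \<le> exp (\<delta>\<^sup>2 * (1 + r))" using exp_ge_add_one_self[of "\<delta>\<^sup>2 * (1 + r)"] by linarith
    then have "sqrt (\<delta>\<^sup>2 * (1 + r)) \<le> sqrt (exp (\<delta>\<^sup>2 * (1 + r)))" by (rule real_sqrt_le_mono)
    also have "sqrt (exp (\<delta>\<^sup>2 * (1 + r))) = exp (\<delta>\<^sup>2 * (1 + r) / 2)"
      by (rule real_sqrt_unique) (simp_all add: exp_double[symmetric])
    also have "sqrt (\<delta>\<^sup>2 * (1 + r)) = \<delta> * sqrt (1 + r)"
      using \<delta> by (simp add: real_sqrt_mult del: distrib_left_numeral)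
    finally have "\<delta> * sqrt (1 + r) \<le> exp (\<delta>\<^sup>2 / 2) * exp (\<delta>\<^sup>2 * r / 2)"
      by (simp add: exp_add[symmetric] add_divide_distrib[symmetric] distrib_left)
    also have "exp (\<delta>\<^sup>2 / 2) \<le> 2"
    proof -
      have "exp (\<delta>\<^sup>2 / 2) \<le> exp (1 / 2)" using \<delta> by (simp add: power_le_one)
      also have "\<dots> \<le> 2" using exp_bound_half[of "1/2 :: real"] by simp
      finally show ?thesis .
    qed
    finally have "\<delta> * sqrt (1 + r) * exp (- \<delta>\<^sup>2 * r / 2) \<le> 2 * exp (\<delta>\<^sup>2 * r / 2) * exp (- \<delta>\<^sup>2 * r / 2)"
      by (intro mult_right_mono) auto
    then have "\<delta> * sqrt (1 + r) * exp (- \<delta>\<^sup>2 * r / 2) \<le> 2" by (simp add: mult.assoc exp_add[symmetric])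
    then have "exp (- \<delta>\<^sup>2 * r / 2) \<le> 2 / \<delta> * (1 / sqrt (1 + r))" using \<delta> r by (simp add: field_simps)
    then have "exp (- \<delta>\<^sup>2 * r / 2) * (1 + r) powr (- n / 2) \<le> 2 / \<delta> * (1 / sqrt (1 + r)) * (1 + r) powr (- n / 2)"
      by (rule mult_right_mono) simp
    also have "\<dots> = 2 / \<delta> * (1 + r) powr (- (1 + n) / 2)"
    proof -
      have "1 / sqrt (1 + r) = (1 + r) powr (- 1 / 2)" using r by (simp add: powr_minus_divide powr_half_sqrt)
      then have "1 / sqrt (1 + r) * (1 + r) powr (- n / 2) = (1 + r) powr (- (1 + n) / 2)"
        by (simp add: powr_add[symmetric] add_divide_distrib diff_divide_distrib)
      then show ?thesis by (simp only: mult.assoc)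
    qed
    finally show "ennreal (exp (- \<delta>\<^sup>2 * (\<Sum>i\<in>I. (x i)\<^sup>2) / 2)) * ennreal ((1 + (\<Sum>i\<in>I. (x i)\<^sup>2)) powr (- n / 2))
        \<le> ennreal (2 / \<delta>) * ennreal ((1 + (\<Sum>i\<in>I. (x i)\<^sup>2)) powr (- (1 + real (card I)) / 2))"
      using \<delta> by (simp add: ennreal_mult[symmetric] ennreal_leI r_def n_def)
  qed
  also have "\<dots> = ennreal (2 / \<delta>) * (\<integral>\<^sup>+x. ennreal ((1 + (\<Sum>i\<in>I. (x i)\<^sup>2)) powr (- (1 + real (card I)) / 2)) \<partial>leb I)"
    by (rule nn_integral_cmult) measurable
  also have "\<dots> \<le> ennreal (2 / \<delta>) * ennreal ((pi * sqrt 2) ^ card I / sqrt (fact (card I)))"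
    using nn_integral_student[OF I(1), of 1] by (intro mult_left_mono) auto
  also have "\<dots> = ennreal (2 / \<delta> * ((pi * sqrt 2) ^ card I / sqrt (fact (card I))))"
    using \<delta> by (simp add: ennreal_mult[symmetric])
  finally show ?thesis .
qed

subsection \<open>Degenerate matrices\<close>

lemma cINF_le_cINF_add:
  fixes f g :: "'a \<Rightarrow> real"
  assumes "X \<noteq> {}" "bdd_below (f ` X)" "\<And>x. x \<in> X \<Longrightarrow> f x \<le> g x + D"
  shows "(INF x\<in>X. f x) \<le> (INF x\<in>X. g x) + D"
proof -
  have "(INF x\<in>X. f x) - D \<le> (INF x\<in>X. g x)"
  proof (rule cINF_greatest[OF assms(1)])
    fix x assume x: "x \<in> X"
    show "(INF x\<in>X. f x) - D \<le> g x" using cINF_lower[OF assms(2) x] assms(3)[OF x] by simp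
  qed
  then show ?thesis by simp
qed

lemma L2_lin_map_diff:
  assumes I: "finite I"
  shows "L2_set (lin_map I A x) I \<le> L2_set (lin_map I A' x) I + (\<Sum>p\<in>I \<times> I. \<bar>A p - A' p\<bar>) * L2_set x I"
proof -
  let ?D = "\<lambda>p. A p - A' p"
  have "L2_set (lin_map I A x) I = L2_set (\<lambda>i. lin_map I A' x i + lin_map I ?D x i) I"
    by (rule L2_set_cong) (auto simp: lin_map_def left_diff_distrib sum_subtractf)
  also have "\<dots> \<le> L2_set (lin_map I A' x) I + L2_set (lin_map I ?D x) I" by (rule L2_set_triangle_ineq)
  also have "L2_set (lin_map I ?D x) I \<le> sqrt (\<Sum>i\<in>I. \<Sum>j\<in>I. (?D (i, j))\<^sup>2) * L2_set x I"
    by (rule L2_lin_map_le_sqrt)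
  also have "sqrt (\<Sum>i\<in>I. \<Sum>j\<in>I. (?D (i, j))\<^sup>2) = L2_set ?D (I \<times> I)"
    by (simp add: L2_set_def sum.cartesian_product)
  also have "L2_set ?D (I \<times> I) * L2_set x I \<le> (\<Sum>p\<in>I \<times> I. \<bar>A p - A' p\<bar>) * L2_set x I"
    by (rule mult_right_mono[OF L2_set_le_sum_abs]) simp
  finally show ?thesis by simp
qed

text \<open>For the unit sphere \<open>X\<close> this is the smallest singular value. For the
  vectors with x j = 1 it would be the distance of column j from the span of the other columns;
  bounding the length of x keeps it Lipschitz in \<open>A\<close>, hence measurable.\<close>

definition stretch :: "'i set \<Rightarrow> ('i \<Rightarrow> real) set \<Rightarrow> ('i \<times> 'i \<Rightarrow> real) \<Rightarrow> real" where
  "stretch I X A = (INF x\<in>X. L2_set (lin_map I A x) I)"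

lemma stretch_le: "x \<in> X \<Longrightarrow> stretch I X A \<le> L2_set (lin_map I A x) I"
  unfolding stretch_def by (rule cINF_lower) (auto intro!: bdd_belowI[of _ 0])

lemma measurable_stretch:
  assumes I: "finite I" and X: "X \<noteq> {}" "\<And>x. x \<in> X \<Longrightarrow> L2_set x I \<le> r"
  shows "stretch I X \<in> borel_measurable (leb (I \<times> I))"
proof (rule lipschitz_measurable)
  fix A A' :: "'a \<times> 'a \<Rightarrow> real"
  have "stretch I X A \<le> stretch I X A' + r * (\<Sum>p\<in>I \<times> I. \<bar>A p - A' p\<bar>)" for A A' :: "'a \<times> 'a \<Rightarrow> real"
    unfolding stretch_def
  proof (rule cINF_le_cINF_add[OF X(1)])
    fix x assume x: "x \<in> X"
    have "(\<Sum>p\<in>I \<times> I. \<bar>A p - A' p\<bar>) * L2_set x I \<le> (\<Sum>p\<in>I \<times> I. \<bar>A p - A' p\<bar>) * r"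
      by (intro mult_left_mono X(2)[OF x] sum_nonneg) simp
    then show "L2_set (lin_map I A x) I \<le> L2_set (lin_map I A' x) I + r * (\<Sum>p\<in>I \<times> I. \<bar>A p - A' p\<bar>)"
      using L2_lin_map_diff[OF I, of A x A'] by (simp add: mult.commute)
  qed (auto intro!: bdd_belowI[of _ 0])
  from this[of A A'] this[of A' A] show "\<bar>stretch I X A - stretch I X A'\<bar> \<le> r * (\<Sum>p\<in>I \<times> I. \<bar>A p - A' p\<bar>)"
    by (simp add: abs_minus_commute abs_le_iff)
qed (use I in simp)

lemma std_normal_interval_le:
  assumes "e > 0"
  shows "emeasure std_normal_distribution {- e<..<e} \<le> ennreal e"
proof -
  have "emeasure std_normal_distribution {- e<..<e} = (\<integral>\<^sup>+t. ennreal (std_normal_density t) * indicator {- e<..<e} t \<partial>lborel)"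
    by (simp add: emeasure_density)
  also have "\<dots> \<le> (\<integral>\<^sup>+t. ennreal (1 / 2) * indicator {- e<..<e} t \<partial>lborel)"
  proof (intro nn_integral_mono mult_right_mono ennreal_leI)
    fix t :: real
    have "2\<^sup>2 \<le> 2 * pi" using pi_gt3 by simp
    then have "2 \<le> sqrt (2 * pi)" by (rule real_le_rsqrt)
    then have "1 / sqrt (2 * pi) \<le> 1 / 2" by (intro divide_left_mono) auto
    then have "1 / sqrt (2 * pi) * exp (- t\<^sup>2 / 2) \<le> 1 / 2 * 1" by (rule mult_mono) auto
    then show "std_normal_density t \<le> 1 / 2" by (simp add: std_normal_density_def)
  qed simp
  also have "\<dots> = ennreal e"
    using assms by (simp add: nn_integral_cmult_indicator ennreal_mult[symmetric] del: ennreal_half)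
  finally show ?thesis .
qed

text \<open>If \<open>A x\<close> is short although \<open>x j = 1\<close>, then column \<open>j\<close> is nearly orthogonal to a unit vector
  \<open>w\<close> which is orthogonal to all other columns and hence independent of column \<open>j\<close>.\<close>

lemma emeasure_stretch_column:
  assumes I: "finite I" and j: "j \<in> I" and e: "e > 0" and r: "r \<ge> 1"
  shows "emeasure (gaussian (I \<times> I)) {A \<in> coord_space (I \<times> I). stretch I {x. x j = 1 \<and> L2_set x I \<le> r} A < e} \<le> ennreal e"
proof -
  define X where "X = {x :: 'a \<Rightarrow> real. x j = 1 \<and> L2_set x I \<le> r}"
  have "L2_set (\<lambda>i. if i = j then 1 else 0 :: real) I = 1"
    using I j by (simp add: L2_set_def if_distrib[of "\<lambda>t. t\<^sup>2"] cong: if_cong)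
  then have X: "X \<noteq> {}" "\<And>x. x \<in> X \<Longrightarrow> L2_set x I \<le> r"
    using r by (auto simp: X_def intro!: exI[of _ "\<lambda>i. if i = j then 1 else 0"])
  have sm: "stretch I X \<in> borel_measurable (leb (I \<times> I))" by (rule measurable_stretch[OF I X])
  define E where "E = {A \<in> coord_space (I \<times> I). stretch I X A < e}"
  have E: "E \<in> sets (gaussian (I \<times> I))"
  proof -
    have "{A \<in> space (leb (I \<times> I)). stretch I X A < e} \<in> sets (leb (I \<times> I))" using sm by measurable
    then show ?thesis by (simp add: E_def sets_gaussian)
  qed
  define S T where "S = I \<times> (I - {j})" and "T = I \<times> {j}"
  have ST: "S \<union> T = I \<times> I" "S \<inter> T = {}" "finite S" "finite T" using I j by (auto simp: S_def T_def)
  have "emeasure (gaussian (I \<times> I)) E = (\<integral>\<^sup>+A. indicator E A \<partial>PiM (S \<union> T) (\<lambda>_. std_normal_distribution))"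
    using E by (simp add: ST(1) gaussian_def)
  also have "\<dots> = (\<integral>\<^sup>+x. \<integral>\<^sup>+y. indicator E (merge S T (x, y)) \<partial>gaussian T \<partial>gaussian S)"
    unfolding gaussian_def
    by (rule gauss.product_nn_integral_fold[OF ST(2-4)]) (use E in \<open>simp add: ST(1) gaussian_def\<close>)
  also have "\<dots> \<le> (\<integral>\<^sup>+x. ennreal e \<partial>gaussian S)"
  proof (rule nn_integral_mono)
    fix x :: "'a \<times> 'a \<Rightarrow> real"
    \<comment> \<open>The columns other than j are completed by a zero column to a square matrix. It
      has no inverse, and its left kernel vector depends on these columns only.\<close>
    obtain w0 where w0: "\<exists>i\<in>I. w0 i \<noteq> 0" "\<And>k. k \<in> I \<Longrightarrow> k \<noteq> j \<Longrightarrow> (\<Sum>i\<in>I. x (i, k) * w0 i) = 0"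
    proof (cases rule: square_system_cases[OF I, where A = "\<lambda>(i, k). if k = j then 0 else x (i, k)", case_names inverse singular])
      case (inverse B)
      have "(\<Sum>k\<in>I. B (j, k) * (if j = j then 0 else x (k, j))) = 1"
        using inverse(2)[OF j j] by simp
      then show thesis by simp
    next
      case (singular v w)
      show thesis
      proof (rule that[OF singular(3)])
        fix k assume "k \<in> I" "k \<noteq> j"
        then show "(\<Sum>i\<in>I. x (i, k) * w i) = 0" using singular(4)[of k] by simp
      qed
    qed
    define s where "s = L2_set w0 I"
    have "vinner I w0 w0 \<noteq> 0" using w0(1) I by (simp add: vinner_self_eq_0_iff)
    then have s: "s > 0" using L2_set_nonneg[of w0 I] by (auto simp: s_def vinner_self_L2 less_le)
    define w where "w = (\<lambda>i. w0 i / s)"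
    have w: "(\<Sum>i\<in>I. (w i)\<^sup>2) = 1"
      using s vinner_self_L2[of I w0]
      by (simp add: w_def power_divide sum_divide_distrib[symmetric] s_def[symmetric] vinner_def power2_eq_square)
    have wk: "(\<Sum>i\<in>I. x (i, k) * w i) = 0" if "k \<in> I" "k \<noteq> j" for k
      using w0(2)[OF that] by (simp add: w_def sum_divide_distrib[symmetric])
    have wL: "L2_set w I = 1" using w by (simp add: L2_set_def)
    let ?Y = "\<lambda>y. \<Sum>i\<in>I. w i * y (i, j)"
    have "(\<integral>\<^sup>+y. indicator E (merge S T (x, y)) \<partial>gaussian T) \<le> (\<integral>\<^sup>+y. indicator {- e<..<e} (?Y y) \<partial>gaussian T)"
    proof (rule nn_integral_mono)
      fix y :: "'a \<times> 'a \<Rightarrow> real"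
      have "?Y y \<in> {- e<..<e}" if "merge S T (x, y) \<in> E"
      proof -
        let ?A = "merge S T (x, y)"
        have A: "?A (i, k) = (if k = j then y (i, k) else x (i, k))" if "i \<in> I" "k \<in> I" for i k
          using that by (simp add: merge_def S_def T_def)
        have "stretch I X ?A < e" using that by (simp add: E_def)
        then obtain v where v: "v \<in> X" "L2_set (lin_map I ?A v) I < e"
          unfolding stretch_def using X by (subst (asm) cINF_less_iff) (auto intro!: bdd_belowI[of _ 0])
        have "vinner I (lin_map I ?A v) w = vinner I v (lin_map I (\<lambda>(i, k). ?A (k, i)) w)" by (rule lin_map_adjoint)
        also have "\<dots> = (\<Sum>k\<in>I. if k = j then ?Y y else 0)"
          unfolding vinner_def
        proof (rule sum.cong[OF refl])
          fix k assume k: "k \<in> I"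
          have "lin_map I (\<lambda>(i, k). ?A (k, i)) w k = (\<Sum>i\<in>I. (if k = j then y (i, k) else x (i, k)) * w i)"
            using k by (simp add: lin_map_def A)
          also have "\<dots> = (if k = j then ?Y y else 0)" using wk[OF k] by (simp add: mult.commute)
          finally show "v k * lin_map I (\<lambda>(i, k). ?A (k, i)) w k = (if k = j then ?Y y else 0)"
            using v(1) by (simp add: X_def)
        qed
        also have "\<dots> = ?Y y" using I j by simp
        finally have "\<bar>?Y y\<bar> \<le> L2_set (lin_map I ?A v) I * L2_set w I"
          using vinner_cauchy_schwarz[of I "lin_map I ?A v" w] by simp
        then have "\<bar>?Y y\<bar> < e" using v(2) wL by simp
        then show ?thesis by auto
      qed
      then show "indicator E (merge S T (x, y)) \<le> (indicator {- e<..<e} (?Y y) :: ennreal)"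
        by (auto simp: indicator_def)
    qed
    also have "\<dots> = (\<integral>\<^sup>+t. indicator {- e<..<e} t \<partial>distr (gaussian T) borel ?Y)"
    proof (rule nn_integral_distr[symmetric])
      have "(\<lambda>y. y (i, j)) \<in> borel_measurable (gaussian T)" if "i \<in> I" for i
        using measurable_component_singleton[of "(i, j)" T "\<lambda>_. std_normal_distribution"] that
        by (simp add: gaussian_def T_def)
      then show "?Y \<in> borel_measurable (gaussian T)" by measurable
    qed simp
    also have "distr (gaussian T) borel ?Y = std_normal_distribution"
      by (rule distributed_gaussian_linear[OF I]) (use w in \<open>auto simp: T_def intro!: inj_onI\<close>)
    also have "(\<integral>\<^sup>+t. indicator {- e<..<e} t \<partial>std_normal_distribution) \<le> ennreal e"
      using std_normal_interval_le[OF e] by simp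
    finally show "(\<integral>\<^sup>+y. indicator E (merge S T (x, y)) \<partial>gaussian T) \<le> ennreal e" .
  qed
  also have "\<dots> = ennreal e" using prob_space.emeasure_space_1[OF prob_space_gaussian, of S] by simp
  finally show ?thesis unfolding E_def X_def .
qed

text \<open>The two factors sqrt n belong together: a vector divided by its largest coordinate, in
  absolute value, has length at most sqrt n, so outside this set it is stretched by at least
  \<delta> relative to its length.\<close>

definition degenerate :: "'i set \<Rightarrow> real \<Rightarrow> ('i \<times> 'i \<Rightarrow> real) set" where
  "degenerate I \<delta> = (\<Union>j\<in>I. {A \<in> coord_space (I \<times> I).
     stretch I {x. x j = 1 \<and> L2_set x I \<le> sqrt (real (card I))} A < \<delta> * sqrt (real (card I))})"

lemma stretch_sets:
  assumes I: "finite I" and j: "j \<in> I"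
  shows "{A \<in> coord_space (I \<times> I). stretch I {x. x j = 1 \<and> L2_set x I \<le> sqrt (real (card I))} A < t}
    \<in> sets (gaussian (I \<times> I))"
proof -
  let ?X = "{x :: 'a \<Rightarrow> real. x j = 1 \<and> L2_set x I \<le> sqrt (real (card I))}"
  have n: "1 \<le> sqrt (real (card I))" using I j by (auto simp: Suc_le_eq card_gt_0_iff)
  have "L2_set (\<lambda>i. if i = j then 1 else 0 :: real) I = 1"
    using I j by (simp add: L2_set_def if_distrib[of "\<lambda>t. t\<^sup>2"] cong: if_cong)
  then have X: "?X \<noteq> {}"
    using n by (auto intro!: exI[of _ "\<lambda>i. if i = j then 1 else 0"])
  have "stretch I ?X \<in> borel_measurable (leb (I \<times> I))"
    by (rule measurable_stretch[OF I X, of "sqrt (real (card I))"]) simp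
  then have "{A \<in> space (leb (I \<times> I)). stretch I ?X A < t} \<in> sets (leb (I \<times> I))" by measurable
  then show ?thesis by (simp add: sets_gaussian)
qed

lemma degenerate_sets: "finite I \<Longrightarrow> degenerate I \<delta> \<in> sets (gaussian (I \<times> I))"
  unfolding degenerate_def by (intro sets.finite_UN stretch_sets)

lemma emeasure_degenerate:
  assumes I: "finite I" and \<delta>: "\<delta> > 0"
  shows "emeasure (gaussian (I \<times> I)) (degenerate I \<delta>) \<le> ennreal (real (card I) * (\<delta> * sqrt (real (card I))))"
proof -
  let ?n = "real (card I)"
  have "emeasure (gaussian (I \<times> I)) (degenerate I \<delta>) \<le> (\<Sum>j\<in>I. emeasure (gaussian (I \<times> I))
     {A \<in> coord_space (I \<times> I). stretch I {x. x j = 1 \<and> L2_set x I \<le> sqrt ?n} A < \<delta> * sqrt ?n})"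
    unfolding degenerate_def
    by (intro emeasure_subadditive_finite[OF I]) (use stretch_sets[OF I] in auto)
  also have "\<dots> \<le> (\<Sum>j\<in>I. ennreal (\<delta> * sqrt ?n))"
  proof (rule sum_mono)
    fix j assume j: "j \<in> I"
    then have n: "1 \<le> ?n" using I by (auto simp: Suc_le_eq card_gt_0_iff)
    then show "emeasure (gaussian (I \<times> I)) {A \<in> coord_space (I \<times> I).
        stretch I {x. x j = 1 \<and> L2_set x I \<le> sqrt ?n} A < \<delta> * sqrt ?n} \<le> ennreal (\<delta> * sqrt ?n)"
      using \<delta> j by (intro emeasure_stretch_column[OF I]) auto
  qed
  also have "\<dots> = ennreal (?n * (\<delta> * sqrt ?n))" using \<delta> by (simp add: ennreal_mult ennreal_of_nat_eq_real_of_nat)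
  finally show ?thesis .
qed

text \<open>Normalise x at a coordinate j of largest absolute value; the result is one of the test
  vectors of column j.\<close>

lemma not_degenerate_stretch:
  assumes I: "finite I" and A: "A \<in> coord_space (I \<times> I)" "A \<notin> degenerate I \<delta>"
  shows "\<delta> * L2_set x I \<le> L2_set (lin_map I A x) I"
proof (cases "L2_set x I = 0")
  case False
  then have Ine: "I \<noteq> {}" by auto
  have "Max ((\<lambda>i. \<bar>x i\<bar>) ` I) \<in> (\<lambda>i. \<bar>x i\<bar>) ` I" using I Ine by (intro Max_in) auto
  then obtain j where j: "j \<in> I" "\<bar>x j\<bar> = Max ((\<lambda>i. \<bar>x i\<bar>) ` I)" by auto
  have le: "\<bar>x i\<bar> \<le> \<bar>x j\<bar>" if "i \<in> I" for i unfolding j(2) using that I by (intro Max_ge) auto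
  let ?n = "real (card I)"
  have L2: "L2_set x I \<le> sqrt ?n * \<bar>x j\<bar>"
  proof -
    have "(\<Sum>i\<in>I. (x i)\<^sup>2) \<le> (\<Sum>i\<in>I. (x j)\<^sup>2)" by (intro sum_mono) (use le in \<open>simp add: abs_le_square_iff[symmetric]\<close>)
    then have "L2_set x I \<le> sqrt (?n * (x j)\<^sup>2)" unfolding L2_set_def by (intro real_sqrt_le_mono) simp
    then show ?thesis by (simp add: real_sqrt_mult)
  qed
  have xj: "x j \<noteq> 0"
  proof
    assume "x j = 0"
    then have "L2_set x I \<le> 0" using L2 by simp
    then show False using False L2_set_nonneg[of x I] by simp
  qed
  define y where "y = (\<lambda>i. (1 / x j) * x i)"
  have sc: "L2_set (\<lambda>i. c * z i) I = \<bar>c\<bar> * L2_set z I" for c z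
    by (simp add: L2_set_def power_mult_distrib sum_distrib_left[symmetric] real_sqrt_mult)
  have "L2_set y I \<le> sqrt ?n" unfolding y_def sc using L2 xj by (simp add: abs_divide divide_le_eq)
  then have y: "y \<in> {x. x j = 1 \<and> L2_set x I \<le> sqrt ?n}" using xj by (simp add: y_def)
  have "\<not> stretch I {x. x j = 1 \<and> L2_set x I \<le> sqrt ?n} A < \<delta> * sqrt ?n"
    using A j(1) unfolding degenerate_def by blast
  then have "\<delta> * sqrt ?n \<le> L2_set (lin_map I A y) I" using stretch_le[OF y, of I A] by simp
  also have "L2_set (lin_map I A y) I = L2_set (\<lambda>i. (1 / x j) * lin_map I A x i) I"
    by (rule L2_set_cong) (auto simp: lin_map_def y_def sum_divide_distrib)
  also have "\<dots> = L2_set (lin_map I A x) I / \<bar>x j\<bar>" unfolding sc by (simp add: abs_divide)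
  finally have "\<delta> * sqrt ?n * \<bar>x j\<bar> \<le> L2_set (lin_map I A x) I" using xj by (simp add: le_divide_eq)
  moreover have "\<delta> * L2_set x I \<le> \<delta> * sqrt ?n * \<bar>x j\<bar>" if "\<delta> \<ge> 0"
    using mult_left_mono[OF L2 that] by (simp add: mult.assoc)
  moreover have "\<delta> * L2_set x I \<le> L2_set (lin_map I A x) I" if "\<delta> < 0"
  proof -
    have "\<delta> * L2_set x I \<le> 0" using that L2_set_nonneg[of x I] by (simp add: mult_nonpos_nonneg)
    then show ?thesis using L2_set_nonneg[of "lin_map I A x" I] by linarith
  qed
  ultimately show ?thesis by linarith
qed simp

lemma inverse_or_kernel:
  assumes I: "finite I"
  shows "(\<exists>B. inverse_mat_on I A B) \<or> ((\<exists>v. L2_set v I = 1 \<and> L2_set (lin_map I A v) I = 0) \<and>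
    (\<exists>w. (\<exists>i\<in>I. w i \<noteq> 0) \<and> (\<forall>x. vinner I w (lin_map I A x) = 0)))"
proof (cases rule: square_system_cases[OF I, where A = A, case_names inverse singular])
  case (inverse B)
  then have "inverse_mat_on I A B" by (simp add: inverse_mat_on_def)
  then show ?thesis by blast
next
  case (singular v w)
  have "vinner I v v \<noteq> 0" using singular(1) I by (simp add: vinner_self_eq_0_iff)
  then have s: "L2_set v I > 0" using L2_set_nonneg[of v I] by (auto simp: vinner_self_L2 less_le)
  define u where "u = (\<lambda>i. (1 / L2_set v I) * v i)"
  have "vinner I u u = 1" unfolding u_def vinner_scale_left vinner_scale_right vinner_self_L2
    using s by (simp add: power2_eq_square)
  then have u: "L2_set u I = 1" by (rule L2_set_eq_1)
  have "lin_map I A u i = 0" if "i \<in> I" for i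
    using singular(2)[OF that] that by (simp add: lin_map_def u_def sum_divide_distrib[symmetric])
  then have "L2_set (lin_map I A u) I = 0" by (simp add: L2_set_def)
  moreover have "vinner I w (lin_map I A x) = 0" for x
  proof -
    have "vinner I w (lin_map I A x) = vinner I x (lin_map I (\<lambda>(i, j). A (j, i)) w)"
      using lin_map_adjoint[of I A x w] by (simp add: vinner_commute)
    also have "\<dots> = 0" using singular(4) by (simp add: vinner_def lin_map_def)
    finally show ?thesis .
  qed
  ultimately show ?thesis using u singular(3) by blast
qed

lemma stretch_pos_inverse:
  assumes I: "finite I" and d: "\<delta> > 0" "\<And>x. \<delta> * L2_set x I \<le> L2_set (lin_map I A x) I"
  shows "\<exists>B. inverse_mat_on I A B"
proof (rule ccontr)
  assume "\<nexists>B. inverse_mat_on I A B"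
  then obtain v where "L2_set v I = 1" "L2_set (lin_map I A v) I = 0" using inverse_or_kernel[OF I, of A] by blast
  then show False using d(2)[of v] d(1) by simp
qed

text \<open>Invertibility means that the smallest stretch on the unit sphere is positive, and the
  smallest stretch is measurable. The added 1 in \<open>c\<close> keeps the reciprocal of the norm
  bound for the inverse meaningful.\<close>

lemma invertible_sets:
  assumes I: "finite I" "I \<noteq> {}"
  shows "{A \<in> coord_space (I \<times> I). \<exists>B. inverse_mat_on I A B} \<in> sets (leb (I \<times> I))"
proof -
  define X where "X = {x :: 'a \<Rightarrow> real. L2_set x I = 1}"
  obtain i0 where i0: "i0 \<in> I" using I by blast
  have "L2_set (\<lambda>i. if i = i0 then 1 else 0 :: real) I = 1"
    using I i0 by (simp add: L2_set_def if_distrib[of "\<lambda>t. t\<^sup>2"] cong: if_cong)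
  then have X: "X \<noteq> {}" unfolding X_def by blast
  have "(\<exists>B. inverse_mat_on I A B) \<longleftrightarrow> 0 < stretch I X A" for A
  proof
    assume "\<exists>B. inverse_mat_on I A B"
    then obtain B where B: "inverse_mat_on I A B" by blast
    define c where "c = sqrt (\<Sum>i\<in>I. \<Sum>j\<in>I. (B (i, j))\<^sup>2) + 1"
    have c: "c > 0" by (simp add: c_def add_nonneg_pos sum_nonneg)
    have "1 / c \<le> stretch I X A" unfolding stretch_def
    proof (rule cINF_greatest[OF X])
      fix x assume x: "x \<in> X"
      have "1 = L2_set (lin_map I B (lin_map I A x)) I"
      proof -
        have "L2_set x I = L2_set (lin_map I B (lin_map I A x)) I"
          by (rule L2_set_cong) (auto simp: inverse_mat_on_lin_map[OF I(1) inverse_mat_on_commute[OF B]])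
        then show ?thesis using x by (simp add: X_def)
      qed
      also have "\<dots> \<le> (c - 1) * L2_set (lin_map I A x) I" unfolding c_def using L2_lin_map_le_sqrt[of I B] by simp
      also have "\<dots> \<le> c * L2_set (lin_map I A x) I" by (intro mult_right_mono) auto
      finally show "1 / c \<le> L2_set (lin_map I A x) I" using c by (simp add: divide_le_eq mult.commute)
    qed
    moreover have "0 < 1 / c" using c by simp
    ultimately show "0 < stretch I X A" by (rule less_le_trans[rotated])
  next
    assume p: "0 < stretch I X A"
    show "\<exists>B. inverse_mat_on I A B"
    proof (rule ccontr)
      assume "\<nexists>B. inverse_mat_on I A B"
      then obtain v where v: "L2_set v I = 1" "L2_set (lin_map I A v) I = 0" using inverse_or_kernel[OF I(1), of A] by blast
      then have "v \<in> X" by (simp add: X_def)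
      from stretch_le[OF this, of I A] show False using p v by simp
    qed
  qed
  moreover have "stretch I X \<in> borel_measurable (leb (I \<times> I))"
    by (rule measurable_stretch[OF I(1) X, of 1]) (simp add: X_def)
  then have "{A \<in> space (leb (I \<times> I)). 0 < stretch I X A} \<in> sets (leb (I \<times> I))" by measurable
  ultimately show ?thesis by simp
qed

text \<open>Substituting sqrt 2 x doubles the exponent |A x|^2 / 2. One half is kept and the other
  dominates \<delta>^2 |x|^2 / 2; the Jacobian is the factor sqrt 2 per dimension.\<close>

lemma gauss_transform_regularize:
  assumes I: "finite I" and d: "\<delta> > 0" "\<And>x. \<delta> * L2_set x I \<le> L2_set (lin_map I A x) I"
  shows "gauss_transform I 0 A \<le> ennreal (sqrt 2 ^ card I) * gauss_transform I \<delta> A"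
proof -
  define f where "f = (\<lambda>x. ennreal (exp (- ((L2_set (lin_map I A x) I)\<^sup>2) / 2)))"
  have f: "f \<in> borel_measurable (leb I)" unfolding f_def L2_lin_map_sq by measurable
  have "gauss_transform I 0 A = (\<integral>\<^sup>+x. f x \<partial>leb I)" by (simp add: gauss_transform_def f_def)
  also have "\<dots> = ennreal (\<bar>sqrt 2\<bar> ^ card I) * (\<integral>\<^sup>+x. f (\<lambda>i\<in>I. 0 + sqrt 2 * x i) \<partial>leb I)"
    by (rule nn_integral_leb_affine[OF I _ f]) simp
  also have "\<dots> \<le> ennreal (\<bar>sqrt 2\<bar> ^ card I) * gauss_transform I \<delta> A"
    unfolding gauss_transform_def
  proof (intro mult_left_mono nn_integral_mono)
    fix x
    have "(L2_set (lin_map I A (\<lambda>i\<in>I. 0 + sqrt 2 * x i)) I)\<^sup>2 = 2 * (L2_set (lin_map I A x) I)\<^sup>2"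
      unfolding L2_lin_map_sq sum_distrib_left
    proof (rule sum.cong[OF refl])
      fix i assume i: "i \<in> I"
      have "(\<Sum>j\<in>I. A (i, j) * (\<lambda>i\<in>I. 0 + sqrt 2 * x i) j) = sqrt 2 * (\<Sum>j\<in>I. A (i, j) * x j)"
        by (simp add: sum_distrib_left mult_ac)
      then show "(\<Sum>j\<in>I. A (i, j) * (\<lambda>i\<in>I. 0 + sqrt 2 * x i) j)\<^sup>2 = 2 * (\<Sum>j\<in>I. A (i, j) * x j)\<^sup>2"
        by (simp add: power_mult_distrib)
    qed
    moreover have "\<delta>\<^sup>2 * (\<Sum>i\<in>I. (x i)\<^sup>2) \<le> (L2_set (lin_map I A x) I)\<^sup>2"
      using power_mono[OF d(2)[of x], of 2] d(1) by (simp add: power_mult_distrib L2_set_def sum_nonneg)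
    ultimately show "f (\<lambda>i\<in>I. 0 + sqrt 2 * x i) \<le> ennreal (exp (- ((L2_set (lin_map I A x) I)\<^sup>2 + \<delta>\<^sup>2 * (\<Sum>i\<in>I. (x i)\<^sup>2)) / 2))"
      unfolding f_def by (intro ennreal_leI) simp
  qed simp
  finally show ?thesis by simp
qed

section \<open>Volumes of linear images\<close>

lemma lin_map_image_sets:
  assumes I: "finite I" and AB: "inverse_mat_on I A B" and L: "L \<in> sets (leb I)"
  shows "lin_map I A ` L \<in> sets (leb I)"
proof -
  have Ls: "L \<subseteq> coord_space I" using sets.sets_into_space[OF L] by simp
  have "lin_map I A ` L = {y \<in> space (leb I). lin_map I B y \<in> L}"
  proof safe
    fix x assume x: "x \<in> L"
    show "lin_map I A x \<in> space (leb I)" by simp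
    have "lin_map I B (lin_map I A x) = x"
      by (rule coord_space_eqI[of _ I]) (use x Ls inverse_mat_on_lin_map[OF I inverse_mat_on_commute[OF AB]] in auto)
    then show "lin_map I B (lin_map I A x) \<in> L" using x by simp
  next
    fix y assume y: "y \<in> space (leb I)" "lin_map I B y \<in> L"
    have "y = lin_map I A (lin_map I B y)"
      by (rule coord_space_eqI[of _ I]) (use y inverse_mat_on_lin_map[OF I AB] in auto)
    then show "y \<in> lin_map I A ` L" using y(2) by blast
  qed
  also have "\<dots> = lin_map I B -` L \<inter> space (leb I)" by auto
  also have "\<dots> \<in> sets (leb I)" by (rule measurable_sets[OF measurable_lin_map L])
  finally show ?thesis .
qed

text \<open>The ratio identity, applied to the indicator of the image of \<open>L\<close> and to a
  Gaussian function whose integral is known.\<close>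

lemma volume_lin_map:
  assumes I: "finite I" and AB: "inverse_mat_on I A B" and L: "L \<in> sets (leb I)"
  shows "emeasure (leb I) L * ennreal (sqrt (2 * pi) ^ card I) = emeasure (leb I) (lin_map I A ` L) * gauss_transform I 0 A"
proof -
  have Ls: "L \<subseteq> coord_space I" using sets.sets_into_space[OF L] by simp
  define g where "g = (\<lambda>x. ennreal (exp (- (1 / 2) * (\<Sum>i\<in>I. (x i - 0)\<^sup>2))))"
  have g: "g \<in> borel_measurable (leb I)" unfolding g_def by measurable
  have AL: "lin_map I A ` L \<in> sets (leb I)" by (rule lin_map_image_sets[OF I AB L])
  have ind: "indicator (lin_map I A ` L) (lin_map I A x) = (indicator L x :: ennreal)" if x: "x \<in> coord_space I" for x
  proof -
    have "x \<in> L" if "y \<in> L" "lin_map I A x = lin_map I A y" for y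
    proof -
      have "x = y"
      proof (rule coord_space_eqI[OF x])
        show "y \<in> coord_space I" using that(1) Ls by blast
        show "x i = y i" if "i \<in> I" for i
          using inverse_mat_on_lin_map[OF I inverse_mat_on_commute[OF AB] that, of x]
            inverse_mat_on_lin_map[OF I inverse_mat_on_commute[OF AB] that, of y]
            \<open>lin_map I A x = lin_map I A y\<close> by simp
      qed
      then show ?thesis using that by simp
    qed
    then show ?thesis by (auto simp: indicator_def)
  qed
  have "(\<integral>\<^sup>+x. indicator (lin_map I A ` L) (lin_map I A x) \<partial>leb I) * (\<integral>\<^sup>+x. g x \<partial>leb I)
      = (\<integral>\<^sup>+x. indicator (lin_map I A ` L) x \<partial>leb I) * (\<integral>\<^sup>+x. g (lin_map I A x) \<partial>leb I)"
    by (rule nn_integral_lin_map_ratio[OF I AB _ g]) (use AL in simp)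
  moreover have "(\<integral>\<^sup>+x. indicator (lin_map I A ` L) (lin_map I A x) \<partial>leb I) = (\<integral>\<^sup>+x. indicator L x \<partial>leb I)"
    by (rule nn_integral_cong) (simp add: ind)
  moreover have "(\<integral>\<^sup>+x. g x \<partial>leb I) = ennreal (sqrt (2 * pi) ^ card I)"
    unfolding g_def by (subst nn_integral_gauss_leb[OF I]) (simp_all add: mult.commute)
  moreover have "(\<integral>\<^sup>+x. g (lin_map I A x) \<partial>leb I) = gauss_transform I 0 A"
    unfolding gauss_transform_def g_def
    by (rule nn_integral_cong) (simp add: L2_set_def sum_nonneg)
  ultimately show ?thesis using L AL by simp
qed

lemma hyperplane_null:
  assumes I: "finite I" and k: "k \<in> I" "w k \<noteq> 0"
  shows "{y \<in> coord_space I. vinner I w y = 0} \<in> null_sets (leb I)"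
proof -
  define J where "J = I - {k}"
  have J: "finite J" "k \<notin> J" "insert k J = I" using I k by (auto simp: J_def)
  define H where "H = {y \<in> coord_space I. vinner I w y = 0}"
  have vm: "(\<lambda>y. vinner I w y) \<in> borel_measurable (leb I)" unfolding vinner_def by measurable
  have H: "H \<in> sets (leb I)"
  proof -
    have "{y \<in> space (leb I). vinner I w y = 0} \<in> sets (leb I)" using vm by measurable
    then show ?thesis by (simp add: H_def)
  qed
  have "emeasure (leb I) H = (\<integral>\<^sup>+y. indicator H y \<partial>leb (insert k J))" using H by (simp add: J(3))
  also have "\<dots> = (\<integral>\<^sup>+x. \<integral>\<^sup>+t. indicator H (x(k := t)) \<partial>lborel \<partial>leb J)"
    by (rule leb.product_nn_integral_insert[OF J(1,2)]) (use H J(3) in simp)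
  also have "\<dots> = (\<integral>\<^sup>+x. 0 \<partial>leb J)"
  proof (rule nn_integral_cong)
    fix x :: "'a \<Rightarrow> real"
    define t0 where "t0 = - (\<Sum>i\<in>J. w i * x i) / w k"
    have "indicator H (x(k := t)) \<le> (indicator {t0} t :: ennreal)" for t
    proof -
      have "t = t0" if "x(k := t) \<in> H"
      proof -
        have "(\<Sum>i\<in>J. w i * (x(k := t)) i) = (\<Sum>i\<in>J. w i * x i)" using J by (intro sum.cong) auto
        moreover have "(\<Sum>i\<in>insert k J. w i * (x(k := t)) i) = 0" using that unfolding H_def vinner_def J(3) by blast
        ultimately have "w k * t + (\<Sum>i\<in>J. w i * x i) = 0" using J(1,2) by simp
        then show ?thesis using k by (simp add: t0_def field_simps)
      qed
      then show ?thesis by (auto simp: indicator_def)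
    qed
    then have "(\<integral>\<^sup>+t. indicator H (x(k := t)) \<partial>lborel) \<le> (\<integral>\<^sup>+t. indicator {t0} t \<partial>lborel)" by (rule nn_integral_mono)
    also have "\<dots> = 0" by simp
    finally show "(\<integral>\<^sup>+t. indicator H (x(k := t)) \<partial>lborel) = 0" by simp
  qed
  finally show ?thesis using H unfolding H_def by (intro null_setsI) auto
qed

lemma volume_lin_map_singular:
  assumes I: "finite I" and A: "\<nexists>B. inverse_mat_on I A B"
  shows "lebesgue_vol I (vscale I c ` lin_map I A ` L) = 0"
proof -
  obtain w where w: "\<exists>i\<in>I. w i \<noteq> 0" "\<forall>x. vinner I w (lin_map I A x) = 0"
    using inverse_or_kernel[OF I, of A] A by blast
  then obtain k where k: "k \<in> I" "w k \<noteq> 0" by blast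
  have "vinner I w (vscale I c (lin_map I A x)) = 0" for x
  proof -
    have "vinner I w (vscale I c (lin_map I A x)) = vinner I w (\<lambda>i. c * lin_map I A x i)"
      by (rule vinner_cong) (simp_all add: vscale_def)
    then show ?thesis using w(2) by (simp add: vinner_scale_right)
  qed
  then have sub: "vscale I c ` lin_map I A ` L \<subseteq> {y \<in> coord_space I. vinner I w y = 0}" by auto
  \<comment> \<open>The image lies in a null hyperplane. If it is not measurable,
    \<open>measure\<close> assigns it 0 by convention.\<close>
  show ?thesis unfolding lebesgue_vol_def
  proof (cases "vscale I c ` lin_map I A ` L \<in> sets (leb I)")
    case True
    then have "vscale I c ` lin_map I A ` L \<in> null_sets (leb I)"
      by (rule null_sets_subset[OF hyperplane_null[where w = w, OF I k] _ sub])
    then show "measure (leb I) (vscale I c ` lin_map I A ` L) = 0" by (rule measure_eq_0_null_sets)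
  qed (simp add: measure_notin_sets)
qed

subsection \<open>Norm and volume of the random body\<close>

lemma vscale_image_sets:
  assumes c: "c \<noteq> 0" and S: "S \<in> sets (leb I)"
  shows "vscale I c ` S \<in> sets (leb I)"
    and "x \<in> coord_space I \<Longrightarrow> vscale I c x \<in> vscale I c ` S \<longleftrightarrow> x \<in> S"
proof -
  have Ss: "S \<subseteq> coord_space I" using sets.sets_into_space[OF S] by simp
  have inv: "vscale I (1 / c) (vscale I c x) = x" "vscale I c (vscale I (1 / c) x) = x" if "x \<in> coord_space I" for x
    using that c by (auto intro!: coord_space_eqI[of _ I] simp: vscale_def)
  have "vscale I c ` S = (\<lambda>x. \<lambda>i\<in>I. 0 + (1 / c) * x i) -` S \<inter> space (leb I)"
  proof (intro equalityI subsetI)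
    fix y assume "y \<in> vscale I c ` S"
    then obtain x where x: "x \<in> S" "y = vscale I c x" by blast
    have "(\<lambda>i\<in>I. 0 + (1 / c) * y i) = vscale I (1 / c) (vscale I c x)" by (simp add: vscale_def x(2))
    also have "\<dots> = x" using inv(1) x(1) Ss by blast
    finally show "y \<in> (\<lambda>x. \<lambda>i\<in>I. 0 + (1 / c) * x i) -` S \<inter> space (leb I)" using x by simp
  next
    fix x assume "x \<in> (\<lambda>x. \<lambda>i\<in>I. 0 + (1 / c) * x i) -` S \<inter> space (leb I)"
    then have x: "(\<lambda>i\<in>I. 0 + (1 / c) * x i) \<in> S" "x \<in> coord_space I" by simp_all
    have "(\<lambda>i\<in>I. 0 + (1 / c) * x i) = vscale I (1 / c) x" by (simp add: vscale_def)
    then show "x \<in> vscale I c ` S" using x inv(2)[of x] by (intro image_eqI[of _ _ "vscale I (1 / c) x"]) simp_all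
  qed
  also have "\<dots> \<in> sets (leb I)" by (rule measurable_sets[OF measurable_affine S])
  finally show "vscale I c ` S \<in> sets (leb I)" .
  show "vscale I c x \<in> vscale I c ` S \<longleftrightarrow> x \<in> S" if x: "x \<in> coord_space I"
  proof
    assume "vscale I c x \<in> vscale I c ` S"
    then obtain y where y: "y \<in> S" "vscale I c x = vscale I c y" by blast
    then show "x \<in> S" using inv(1)[OF x] inv(1)[of y] Ss by auto
  qed blast
qed

lemma volume_vscale:
  assumes I: "finite I" and c: "c \<noteq> 0" and S: "S \<in> sets (leb I)"
  shows "emeasure (leb I) (vscale I c ` S) = ennreal (\<bar>c\<bar> ^ card I) * emeasure (leb I) S"
proof -
  note cS = vscale_image_sets[OF c S]
  have "emeasure (leb I) (vscale I c ` S) = (\<integral>\<^sup>+x. indicator (vscale I c ` S) x \<partial>leb I)" using cS(1) by simp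
  also have "\<dots> = ennreal (\<bar>c\<bar> ^ card I) * (\<integral>\<^sup>+x. indicator (vscale I c ` S) (\<lambda>i\<in>I. 0 + c * x i) \<partial>leb I)"
    by (rule nn_integral_leb_affine[OF I c]) (use cS(1) in simp)
  also have "(\<integral>\<^sup>+x. indicator (vscale I c ` S) (\<lambda>i\<in>I. 0 + c * x i) \<partial>leb I) = (\<integral>\<^sup>+x. indicator S x \<partial>leb I)"
  proof (rule nn_integral_cong)
    fix x assume x: "x \<in> space (leb I)"
    have "(\<lambda>i\<in>I. 0 + c * x i) = vscale I c x" by (simp add: vscale_def)
    then show "indicator (vscale I c ` S) (\<lambda>i\<in>I. 0 + c * x i) = (indicator S x :: ennreal)"
      using cS(2)[of x] x by (simp add: indicator_def)
  qed
  finally show ?thesis using S by simp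
qed

lemma schatten_inf_lipschitz:
  assumes d: "d > 0"
  shows "schatten_inf d T \<le> schatten_inf d T' + (\<Sum>p\<in>mat_idx d. \<bar>T p - T' p\<bar>)"
proof -
  obtain v where v: "L2_set v {..<d} = 1" "L2_set (lin_map {..<d} T v) {..<d} = schatten_inf d T"
    using schatten_inf_attained[OF d] by blast
  have "schatten_inf d T \<le> L2_set (lin_map {..<d} T' v) {..<d} + (\<Sum>p\<in>mat_idx d. \<bar>T p - T' p\<bar>) * L2_set v {..<d}"
    unfolding v(2)[symmetric] by (rule L2_lin_map_diff) simp
  then show ?thesis using schatten_inf_upper[of d T' v] v(1) by simp
qed

lemma schatten_inf_eq_0:
  assumes d: "d > 0" and z: "schatten_inf d T \<le> 0" and p: "p \<in> mat_idx d"
  shows "T p = 0"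
proof -
  have z0: "schatten_inf d T = 0" using schatten_inf_nonneg[OF d, of T] z by simp
  have "vinner (mat_idx d) T T \<le> schatten_inf d T * (\<Sum>i<d. singular_vector d T i)"
    by (rule trace_duality[OF schatten_inf_upper])
  then have "vinner (mat_idx d) T T = 0" using z0 vinner_self_nonneg[of "mat_idx d" T] by simp
  then have "\<forall>i\<in>mat_idx d. T i = 0" by (subst (asm) vinner_self_eq_0_iff) simp
  then show ?thesis using p by blast
qed

text \<open>The indicator of the ball is dominated by exp (a (\<rho> - |x - c|^2)). The choice a = n
  / (2 \<rho>) minimises the resulting bound and gives the correct order of the volume radius
  without the Gamma function.\<close>

lemma emeasure_ball_le:
  assumes I: "finite I" "I \<noteq> {}" and \<rho>: "\<rho> > 0"
  shows "emeasure (leb I) {x \<in> coord_space I. (\<Sum>i\<in>I. (x i - c i)\<^sup>2) \<le> \<rho>}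
    \<le> ennreal ((exp (1 / 2) * sqrt (2 * pi * \<rho> / real (card I))) ^ card I)"
proof -
  define n where "n = real (card I)"
  have n: "n > 0" using I by (simp add: n_def card_gt_0_iff)
  define a where "a = n / (2 * \<rho>)"
  have a: "a > 0" using n \<rho> by (simp add: a_def)
  let ?B = "{x \<in> coord_space I. (\<Sum>i\<in>I. (x i - c i)\<^sup>2) \<le> \<rho>}"
  have B: "?B \<in> sets (leb I)"
  proof -
    have "{x \<in> space (leb I). (\<Sum>i\<in>I. (x i - c i)\<^sup>2) \<le> \<rho>} \<in> sets (leb I)" by measurable
    then show ?thesis by simp
  qed
  have "emeasure (leb I) ?B = (\<integral>\<^sup>+x. indicator ?B x \<partial>leb I)" using B by simp
  also have "\<dots> \<le> (\<integral>\<^sup>+x. ennreal (exp (n / 2)) * ennreal (exp (- a * (\<Sum>i\<in>I. (x i - c i)\<^sup>2))) \<partial>leb I)"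
  proof (rule nn_integral_mono)
    fix x
    have "1 \<le> exp (n / 2) * exp (- a * (\<Sum>i\<in>I. (x i - c i)\<^sup>2))" if "x \<in> ?B"
    proof -
      have "a * (\<Sum>i\<in>I. (x i - c i)\<^sup>2) \<le> a * \<rho>" using that a by (intro mult_left_mono) auto
      also have "a * \<rho> = n / 2" using \<rho> by (simp add: a_def)
      finally show ?thesis by (simp add: exp_add[symmetric])
    qed
    then show "indicator ?B x \<le> ennreal (exp (n / 2)) * ennreal (exp (- a * (\<Sum>i\<in>I. (x i - c i)\<^sup>2)))"
      by (auto simp: indicator_def ennreal_mult[symmetric])
  qed
  also have "\<dots> = ennreal (exp (n / 2)) * ennreal (sqrt (pi / a) ^ card I)"
    by (subst nn_integral_cmult, measurable) (subst nn_integral_gauss_leb[OF I(1) a], rule refl)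
  also have "\<dots> = ennreal ((exp (1 / 2) * sqrt (2 * pi * \<rho> / n)) ^ card I)"
  proof -
    have "exp (n / 2) = exp (1 / 2) ^ card I" by (simp add: exp_of_nat_mult[symmetric] n_def)
    moreover have "pi / a = 2 * pi * \<rho> / n" using \<rho> n by (simp add: a_def)
    ultimately show ?thesis by (simp add: ennreal_mult'[symmetric] power_mult_distrib)
  qed
  finally show ?thesis by (simp add: n_def)
qed

definition net_base :: real where
  "net_base = 3 * 2 ^ 16"

text \<open>With D = d / \<tau>(u) the squared radius of the covering balls is 16 d / \<tau>(u)^2.
  Divided by the dimension d^2 this leaves 16 / (\<tau>(u)^2 d), and the number of balls contributes
  \<open>net_base\<close> squared per dimension.\<close>

lemma volume_unit_ball_le:
  assumes d: "d > 0" and N: "associated_norm d N \<tau>"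
  shows "lebesgue_vol (mat_idx d) (unit_ball (mat_idx d) N)
    \<le> (net_base\<^sup>2 * (exp (1 / 2) * sqrt (32 * pi)) / (\<tau> (ones d) * sqrt (real d))) ^ d\<^sup>2"
proof -
  let ?I = "mat_idx d"
  have card: "card ?I = d\<^sup>2" by (simp add: power2_eq_square)
  have I: "finite ?I" "?I \<noteq> {}" using d by auto
  have tau: "\<tau> (ones d) > 0"
    using one_symmetric_norm_ones_pos[OF _ d] N by (simp add: associated_norm_def)
  define D where "D = real d / \<tau> (ones d)"
  have D: "D > 0" using d tau by (simp add: D_def)
  define \<rho> where "\<rho> = 16 * D\<^sup>2 / real d"
  have \<rho>: "\<rho> > 0" using D d by (simp add: \<rho>_def)
  define Bl where "Bl = (\<lambda>c. {T \<in> coord_space ?I. (\<Sum>p\<in>?I. (T p - c p)\<^sup>2) \<le> \<rho>})"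
  have BlS: "Bl c \<in> sets (leb ?I)" for c
  proof -
    have "{T \<in> space (leb ?I). (\<Sum>p\<in>?I. (T p - c p)\<^sup>2) \<le> \<rho>} \<in> sets (leb ?I)" by measurable
    then show ?thesis by (simp add: Bl_def)
  qed
  have sub: "unit_ball ?I N \<subseteq> (\<Union>c\<in>trace_centers d D. Bl c)"
  proof
    fix T assume T: "T \<in> unit_ball ?I N"
    then have Tc: "T \<in> coord_space ?I" "N T \<le> 1" by (auto simp: unit_ball_def)
    have "(\<Sum>i<d. singular_vector d T i) \<le> D * N T" unfolding D_def by (rule trace_norm_le[OF N Tc(1) d])
    also have "\<dots> \<le> D" using Tc(2) D by simp
    finally obtain c where "c \<in> trace_centers d D" "(\<Sum>p\<in>?I. (T p - c p)\<^sup>2) \<le> 16 * D\<^sup>2 / real d"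
      using trace_centers_cover[OF d] by blast
    then show "T \<in> (\<Union>c\<in>trace_centers d D. Bl c)" using Tc(1) by (auto simp: Bl_def \<rho>_def)
  qed
  define q where "q = exp (1 / 2) * sqrt (32 * pi) / (\<tau> (ones d) * sqrt (real d))"
  have q: "exp (1 / 2) * sqrt (2 * pi * \<rho> / real (card ?I)) = q"
  proof -
    have "2 * pi * \<rho> / real (card ?I) = 32 * pi / ((\<tau> (ones d))\<^sup>2 * real d)"
      using d tau by (simp add: card \<rho>_def D_def power2_eq_square field_simps)
    then show ?thesis using tau by (simp add: q_def real_sqrt_divide real_sqrt_mult)
  qed
  have q0: "0 \<le> q" using tau by (simp add: q_def)
  have "emeasure (leb ?I) (unit_ball ?I N) \<le> emeasure (leb ?I) (\<Union>c\<in>trace_centers d D. Bl c)"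
    by (rule emeasure_mono[OF sub]) (intro sets.finite_UN finite_trace_centers BlS)
  also have "\<dots> \<le> (\<Sum>c\<in>trace_centers d D. emeasure (leb ?I) (Bl c))"
    by (rule emeasure_subadditive_finite[OF finite_trace_centers]) (use BlS in auto)
  also have "\<dots> \<le> (\<Sum>c\<in>trace_centers d D. ennreal (q ^ card ?I))"
    unfolding Bl_def q[symmetric] by (intro sum_mono emeasure_ball_le I \<rho>)
  also have "\<dots> = ennreal (real (card (trace_centers d D)) * q ^ card ?I)"
    using q0 by (simp add: ennreal_mult ennreal_of_nat_eq_real_of_nat)
  also have "\<dots> \<le> ennreal (net_base ^ (2 * d\<^sup>2) * q ^ d\<^sup>2)"
    unfolding card net_base_def using q0 by (intro ennreal_leI mult_right_mono card_trace_centers) auto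
  also have "net_base ^ (2 * d\<^sup>2) * q ^ d\<^sup>2 = (net_base\<^sup>2 * q) ^ d\<^sup>2"
    by (simp add: power_mult power_mult_distrib)
  finally have "measure (leb ?I) (unit_ball ?I N) \<le> (net_base\<^sup>2 * q) ^ d\<^sup>2"
    unfolding measure_def by (rule enn2real_leI[rotated]) (simp add: q0)
  then show ?thesis by (simp add: lebesgue_vol_def q_def)
qed

section \<open>The operator norm of the random matrix\<close>

locale matrix_body = sym_body "mat_idx d" L for d :: nat and L +
  assumes d: "d \<ge> 2"
begin

abbreviation "J \<equiv> mat_idx d"

definition opn :: "((nat \<times> nat) \<times> (nat \<times> nat) \<Rightarrow> real) \<Rightarrow> real" where
  "opn A = op_norm J (body_norm J L) (schatten_inf d) (lin_map J A)"

lemma d0: "d > 0" using d by simp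

lemma card_J: "card J = d\<^sup>2" by (simp add: power2_eq_square)

lemma opn_SUP: "opn A = (SUP x\<in>L. schatten_inf d (lin_map J A x))"
  by (simp add: opn_def op_norm_def unit_ball_norm_L)

lemma schatten_lin_map_diff:
  assumes B: "\<forall>y\<in>L. \<forall>i\<in>J. \<bar>y i\<bar> \<le> B" and x: "x \<in> L"
  shows "schatten_inf d (lin_map J A x) \<le> schatten_inf d (lin_map J A' x) + B * (\<Sum>q\<in>J \<times> J. \<bar>A q - A' q\<bar>)"
proof -
  have "(\<Sum>p\<in>J. \<bar>lin_map J A x p - lin_map J A' x p\<bar>) \<le> (\<Sum>p\<in>J. \<Sum>k\<in>J. \<bar>A (p, k) - A' (p, k)\<bar> * B)"
  proof (rule sum_mono)
    fix p assume p: "p \<in> J"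
    have xb: "\<bar>x k\<bar> \<le> B" if "k \<in> J" for k using B x that by blast
    have "\<bar>lin_map J A x p - lin_map J A' x p\<bar> = \<bar>\<Sum>k\<in>J. (A (p, k) - A' (p, k)) * x k\<bar>"
      using p by (simp add: lin_map_def left_diff_distrib sum_subtractf)
    also have "\<dots> \<le> (\<Sum>k\<in>J. \<bar>A (p, k) - A' (p, k)\<bar> * B)"
      by (rule order_trans[OF sum_abs], unfold abs_mult) (intro sum_mono mult_left_mono xb abs_ge_zero)
    finally show "\<bar>lin_map J A x p - lin_map J A' x p\<bar> \<le> (\<Sum>k\<in>J. \<bar>A (p, k) - A' (p, k)\<bar> * B)" .
  qed
  also have "\<dots> = B * (\<Sum>q\<in>J \<times> J. \<bar>A q - A' q\<bar>)"
    by (simp add: sum.cartesian_product sum_distrib_left mult.commute case_prod_beta)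
  finally show ?thesis using schatten_inf_lipschitz[OF d0, of "lin_map J A x" "lin_map J A' x"] by simp
qed

lemma schatten_inf_zero: "schatten_inf d (lin_map J (\<lambda>_. 0) x) = 0"
proof -
  obtain v where "L2_set (lin_map {..<d} (lin_map J (\<lambda>_. 0) x) v) {..<d} = schatten_inf d (lin_map J (\<lambda>_. 0) x)"
    using schatten_inf_attained[OF d0, of "lin_map J (\<lambda>_. 0) x"] by blast
  then show ?thesis by (simp add: L2_set_def lin_map_def)
qed

lemma opn_bdd: "bdd_above ((\<lambda>x. schatten_inf d (lin_map J A x)) ` L)"
proof -
  obtain B where B: "\<forall>y\<in>L. \<forall>i\<in>J. \<bar>y i\<bar> \<le> B" using bounded by metis
  show ?thesis
    by (rule bdd_aboveI2[of _ _ "B * (\<Sum>q\<in>J \<times> J. \<bar>A q - 0\<bar>)"])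
      (use schatten_lin_map_diff[OF B, of _ A "\<lambda>_. 0"] in \<open>simp add: schatten_inf_zero\<close>)
qed

lemma schatten_le_opn: "x \<in> L \<Longrightarrow> schatten_inf d (lin_map J A x) \<le> opn A"
  unfolding opn_SUP by (rule cSUP_upper[OF _ opn_bdd])

lemma L_ne: "L \<noteq> {}" using zero_in by blast

lemma opn_nonneg: "0 \<le> opn A"
  using order_trans[OF schatten_inf_nonneg[OF d0] schatten_le_opn[OF zero_in]] .

lemma measurable_opn: "opn \<in> borel_measurable (leb (J \<times> J))"
proof -
  obtain B where B: "\<forall>y\<in>L. \<forall>i\<in>J. \<bar>y i\<bar> \<le> B" using bounded by metis
  have le: "opn A \<le> opn A' + B * (\<Sum>q\<in>J \<times> J. \<bar>A q - A' q\<bar>)" for A A'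
    unfolding opn_SUP[of A]
  proof (rule cSUP_least[OF L_ne])
    fix x assume x: "x \<in> L"
    show "schatten_inf d (lin_map J A x) \<le> opn A' + B * (\<Sum>q\<in>J \<times> J. \<bar>A q - A' q\<bar>)"
      using schatten_lin_map_diff[OF B x, of A A'] schatten_le_opn[OF x, of A'] by linarith
  qed
  show ?thesis
  proof (rule lipschitz_measurable)
    fix A A' :: "(nat \<times> nat) \<times> (nat \<times> nat) \<Rightarrow> real"
    show "\<bar>opn A - opn A'\<bar> \<le> B * (\<Sum>q\<in>J \<times> J. \<bar>A q - A' q\<bar>)"
      using le[of A A'] le[of A' A] by (simp add: abs_minus_commute abs_le_iff)
  qed simp
qed

definition contract :: "((nat \<times> nat) \<times> (nat \<times> nat) \<Rightarrow> real) \<Rightarrow> (nat \<times> nat \<Rightarrow> real) \<Rightarrow> nat \<times> nat \<Rightarrow> real" where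
  "contract A u = (\<lambda>k\<in>J. \<Sum>p\<in>J. u p * A (p, k))"

lemma opn_le:
  assumes c: "\<And>u v. u \<in> net d \<Longrightarrow> v \<in> net d \<Longrightarrow> supp (contract A (tensor u v)) \<le> c"
  shows "opn A \<le> 2 * c"
  unfolding opn_SUP
proof (rule cSUP_least[OF L_ne], rule schatten_inf_le_net[OF d0])
  fix x u v assume x: "x \<in> L" and uv: "u \<in> net d" "v \<in> net d"
  have "vinner {..<d} u (lin_map {..<d} (lin_map J A x) v) = vinner J (lin_map J A x) (tensor u v)"
    by (rule vinner_tensor[symmetric])
  also have "\<dots> = vinner J x (lin_map J (\<lambda>(i, j). A (j, i)) (tensor u v))" by (rule lin_map_adjoint)
  also have "\<dots> = vinner J (contract A (tensor u v)) x"
    by (subst vinner_commute, rule vinner_cong) (auto simp: contract_def lin_map_def mult.commute)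
  also have "\<dots> \<le> supp (contract A (tensor u v))" by (rule supp_upper[OF x])
  finally show "vinner {..<d} u (lin_map {..<d} (lin_map J A x) v) \<le> c" using c[OF uv] by linarith
qed

lemma opn_pos:
  assumes "inverse_mat_on J A B"
  shows "opn A > 0"
proof (rule ccontr)
  assume "\<not> opn A > 0"
  then have o: "opn A \<le> 0" by simp
  obtain r where r: "r > 0" "\<And>y. y \<in> coord_space J \<Longrightarrow> (\<And>i. i \<in> J \<Longrightarrow> \<bar>y i\<bar> \<le> r) \<Longrightarrow> y \<in> L"
    using inner_box by blast
  define x where "x = (\<lambda>i\<in>J. r)"
  have x: "x \<in> L" by (rule r(2)) (use r(1) in \<open>auto simp: x_def\<close>)
  have "lin_map J A x p = 0" if "p \<in> J" for p
    by (rule schatten_inf_eq_0[OF d0 _ that]) (use schatten_le_opn[OF x, of A] o in linarith)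
  then have "lin_map J B (lin_map J A x) i = 0" if "i \<in> J" for i using that by (simp add: lin_map_def)
  moreover have "(0, 0) \<in> J" using d0 by simp
  ultimately show False
    using inverse_mat_on_lin_map[OF I inverse_mat_on_commute[OF assms], of "(0, 0)" x] r(1) by (simp add: x_def)
qed

text \<open>The inclusion holds for every matrix, so probability enters only through the volume
  ratio.\<close>

lemma random_body_subset:
  assumes N: "unitary_invariant_norm d N" "associated_norm d N \<tau>"
  shows "random_body d \<tau> L A \<subseteq> unit_ball J N"
proof
  fix y assume "y \<in> random_body d \<tau> L A"
  then obtain x where x: "x \<in> L" "y = vscale J (1 / \<tau> (ones d) * (1 / opn A)) (lin_map J A x)"
    by (auto simp: random_body_def Let_def opn_def)
  have tau: "\<tau> (ones d) > 0"
    using one_symmetric_norm_ones_pos[OF _ d0] N(2) by (simp add: associated_norm_def)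
  have nN: "norm_on J N" using N(1) by (simp add: unitary_invariant_norm_def)
  have "N y = \<bar>1 / \<tau> (ones d) * (1 / opn A)\<bar> * N (lin_map J A x)"
    unfolding x(2) using nN lin_map_coord_space unfolding norm_on_def by blast
  also have "\<dots> \<le> \<bar>1 / \<tau> (ones d) * (1 / opn A)\<bar> * (opn A * \<tau> (ones d))"
  proof (rule mult_left_mono)
    have "N (lin_map J A x) \<le> schatten_inf d (lin_map J A x) * \<tau> (ones d)"
      by (rule norm_le_schatten_inf[OF N(2) lin_map_coord_space d0])
    also have "\<dots> \<le> opn A * \<tau> (ones d)" using tau by (intro mult_right_mono schatten_le_opn x) auto
    finally show "N (lin_map J A x) \<le> opn A * \<tau> (ones d)" .
  qed simp
  \<comment> \<open>If \<open>opn A\<close> is 0, the scaling factor is 0 by the convention for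
    division and the product vanishes.\<close>
  also have "\<dots> \<le> 1" using tau opn_nonneg[of A] by (cases "opn A = 0") (simp_all add: abs_mult)
  finally show "y \<in> unit_ball J N" by (simp add: unit_ball_def x(2))
qed

text \<open>The exponential Markov inequality together with \<open>laplace_bound\<close>, since for
  a unit vector u the contraction is a standard Gaussian vector. Tensors of net points may be
  shorter than 1: they are normalised, which only enlarges the event because the support function is
  homogeneous and nonnegative. For u = 0 the event is empty, as 0 \<le> c.\<close>

lemma support_tail:
  assumes R: "\<And>y. y \<in> L \<Longrightarrow> L2_set y J \<le> R" and l: "0 \<le> l" and c: "0 \<le> c" and u: "L2_set u J \<le> 1"
  shows "{A \<in> coord_space (J \<times> J). c < supp (contract A u)} \<in> sets (gaussian (J \<times> J))"
    and "emeasure (gaussian (J \<times> J)) {A \<in> coord_space (J \<times> J). c < supp (contract A u)}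
      \<le> ennreal (exp (- l * c + 5 / 2 * (l * ell J (polar J L) + l\<^sup>2 * R\<^sup>2)))"
proof -
  interpret S: gaussian_support J L supp R
    by unfold_locales (use I supp_upper supp_attained supp_nonneg R in auto)
  have cm: "contract' \<in> gaussian (J \<times> J) \<rightarrow>\<^sub>M leb J" if "contract' = (\<lambda>A. contract A w)" for contract' w
    unfolding that contract_def by (rule measurable_contract) simp
  have ms: "{A \<in> coord_space (J \<times> J). c < supp (contract A w)} \<in> sets (gaussian (J \<times> J))" for w
  proof -
    have "(\<lambda>A. supp (contract A w)) \<in> borel_measurable (gaussian (J \<times> J))"
      by (rule measurable_compose[OF cm[OF refl] S.F_measurable])
    then have "{A \<in> space (gaussian (J \<times> J)). c < supp (contract A w)} \<in> sets (gaussian (J \<times> J))" by measurable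
    then show ?thesis by simp
  qed
  show "{A \<in> coord_space (J \<times> J). c < supp (contract A u)} \<in> sets (gaussian (J \<times> J))" by (rule ms)
  have E: "(LINT x|gaussian J. supp x) = ell J (polar J L)"
    unfolding ell_def by (rule Bochner_Integration.integral_cong) (simp_all add: body_norm_polar)
  define b where "b = ennreal (exp (- l * c + 5 / 2 * (l * ell J (polar J L) + l\<^sup>2 * R\<^sup>2)))"
  have unit: "emeasure (gaussian (J \<times> J)) {A \<in> coord_space (J \<times> J). c < supp (contract A w)} \<le> b"
    if w: "L2_set w J = 1" for w
  proof -
    define h where "h = (\<lambda>x. ennreal (exp (- l * c)) * ennreal (exp (l * supp x)))"
    have h: "h \<in> borel_measurable (leb J)" unfolding h_def using S.F_measurable by measurable
    have "emeasure (gaussian (J \<times> J)) {A \<in> coord_space (J \<times> J). c < supp (contract A w)}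
        = (\<integral>\<^sup>+A. indicator {A \<in> coord_space (J \<times> J). c < supp (contract A w)} A \<partial>gaussian (J \<times> J))"
      using ms by simp
    also have "\<dots> \<le> (\<integral>\<^sup>+A. h (\<lambda>k\<in>J. \<Sum>p\<in>J. w p * A (p, k)) \<partial>gaussian (J \<times> J))"
    proof (rule nn_integral_mono)
      fix A
      have "1 \<le> exp (- l * c) * exp (l * supp (contract A w))" if "c < supp (contract A w)"
        using that l by (simp add: exp_add[symmetric] mult_left_mono)
      then show "indicator {A \<in> coord_space (J \<times> J). c < supp (contract A w)} A \<le> h (\<lambda>k\<in>J. \<Sum>p\<in>J. w p * A (p, k))"
        unfolding contract_def[symmetric] h_def by (auto simp: indicator_def ennreal_mult[symmetric])
    qed
    also have "\<dots> = (\<integral>\<^sup>+x. h x \<partial>gaussian J)"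
      by (rule nn_integral_gaussian_contract[where c = "\<lambda>p k. (p, k)"])
        (use I Ine w h in \<open>auto simp: L2_set_def intro!: inj_onI\<close>)
    also have "\<dots> = ennreal (exp (- l * c)) * (\<integral>\<^sup>+x. ennreal (exp (l * supp x)) \<partial>gaussian J)"
      unfolding h_def
    proof (rule nn_integral_cmult)
      have "(\<lambda>x. ennreal (exp (l * supp x))) \<in> borel_measurable (leb J)" using S.F_measurable by measurable
      then show "(\<lambda>x. ennreal (exp (l * supp x))) \<in> borel_measurable (gaussian J)"
        by (simp cong: measurable_cong_sets)
    qed
    also have "\<dots> \<le> ennreal (exp (- l * c)) * ennreal (exp (5 / 2 * (l * ell J (polar J L) + l\<^sup>2 * R\<^sup>2)))"
      using S.laplace_bound[OF l] unfolding E by (intro mult_left_mono) auto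
    also have "\<dots> = b" unfolding b_def exp_add by (rule ennreal_mult'[symmetric]) simp
    finally show ?thesis .
  qed
  show "emeasure (gaussian (J \<times> J)) {A \<in> coord_space (J \<times> J). c < supp (contract A u)} \<le> b"
  proof (cases "L2_set u J = 0")
    case True
    then have "vinner J u u = 0" by (simp add: vinner_self_L2)
    then have "\<forall>p\<in>J. u p = 0" by (subst (asm) vinner_self_eq_0_iff) simp
    then have "(\<Sum>p\<in>J. u p * A (p, k)) = 0" for A k by (intro sum.neutral ballI) (simp only: mult_zero_left)
    then have "supp (contract A u) = supp (\<lambda>_. 0)" for A by (intro S.F_cong) (simp add: contract_def)
    then have e: "{A \<in> coord_space (J \<times> J). c < supp (contract A u)} = {}" using S.F_zero c by auto
    show ?thesis unfolding e by simp
  next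
    case False
    define r where "r = L2_set u J"
    have r: "0 < r" "r \<le> 1" using False u L2_set_nonneg[of u J] by (auto simp: r_def less_le)
    define w where "w = (\<lambda>p. u p / r)"
    have "L2_set w J = (1 / r) * L2_set u J"
      using r by (simp add: w_def L2_set_right_distrib[symmetric] divide_inverse mult.commute)
    then have w: "L2_set w J = 1" using r by (simp add: r_def)
    have "supp (contract A u) \<le> supp (contract A w)" for A
    proof -
      have "supp (contract A u) = supp (\<lambda>k. r * contract A w k)"
        using r(1) by (intro S.F_cong) (simp add: contract_def w_def sum_distrib_left)
      also have "\<dots> = r * supp (contract A w)" using r by (intro S.F_scale) simp
      also have "\<dots> \<le> 1 * supp (contract A w)" using r by (intro mult_right_mono supp_nonneg) auto
      finally show ?thesis by simp
    qed
    then have "{A \<in> coord_space (J \<times> J). c < supp (contract A u)} \<subseteq> {A \<in> coord_space (J \<times> J). c < supp (contract A w)}"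
      by (auto intro: less_le_trans)
    from emeasure_mono[OF this ms] unit[OF w] show ?thesis by (rule order_trans)
  qed
qed

end

text \<open>The inverse gives |x| \<le> c |A x|, so the integrand is dominated by a Gaussian.
  Finiteness justifies passing to \<open>enn2real\<close>.\<close>

lemma gauss_transform_finite:
  assumes I: "finite I" and AB: "inverse_mat_on I A B"
  shows "gauss_transform I 0 A < \<infinity>"
proof -
  define c where "c = sqrt (\<Sum>i\<in>I. \<Sum>j\<in>I. (B (i, j))\<^sup>2) + 1"
  have c: "c > 0" by (simp add: c_def add_nonneg_pos sum_nonneg)
  have L: "L2_set x I \<le> c * L2_set (lin_map I A x) I" for x
  proof -
    have "L2_set x I = L2_set (lin_map I B (lin_map I A x)) I"
      by (rule L2_set_cong) (auto simp: inverse_mat_on_lin_map[OF I inverse_mat_on_commute[OF AB]])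
    also have "\<dots> \<le> (c - 1) * L2_set (lin_map I A x) I" unfolding c_def using L2_lin_map_le_sqrt[of I B] by simp
    also have "\<dots> \<le> c * L2_set (lin_map I A x) I" by (intro mult_right_mono) auto
    finally show ?thesis .
  qed
  define a where "a = 1 / (2 * c\<^sup>2)"
  have a: "a > 0" using c by (simp add: a_def)
  have "gauss_transform I 0 A \<le> (\<integral>\<^sup>+x. ennreal (exp (- a * (\<Sum>i\<in>I. (x i - 0)\<^sup>2))) \<partial>leb I)"
    unfolding gauss_transform_def
  proof (intro nn_integral_mono ennreal_leI)
    fix x
    have "(L2_set x I)\<^sup>2 \<le> (c * L2_set (lin_map I A x) I)\<^sup>2" by (rule power_mono[OF L]) simp
    then have "a * (\<Sum>i\<in>I. (x i)\<^sup>2) \<le> a * (c\<^sup>2 * (L2_set (lin_map I A x) I)\<^sup>2)"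
      using a by (intro mult_left_mono) (simp_all add: L2_set_def sum_nonneg power_mult_distrib)
    also have "\<dots> = (L2_set (lin_map I A x) I)\<^sup>2 / 2" using c by (simp add: a_def)
    finally show "exp (- ((L2_set (lin_map I A x) I)\<^sup>2 + 0\<^sup>2 * (\<Sum>i\<in>I. (x i)\<^sup>2)) / 2) \<le> exp (- a * (\<Sum>i\<in>I. (x i - 0)\<^sup>2))"
      by simp
  qed
  also have "\<dots> < \<infinity>" unfolding nn_integral_gauss_leb[OF I a] by simp
  finally show ?thesis .
qed

lemma power_powr_inverse: "0 \<le> x \<Longrightarrow> m > 0 \<Longrightarrow> (x ^ m) powr (1 / real m) = (x :: real)"
  by (cases "x = 0") (simp_all add: powr_realpow[symmetric] powr_powr)

text \<open>Per unit of d the exponent has to pay 2 ln \<open>net_base\<close> for the pairs of net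
  points, 5 / 2 * 4 for the mean, 5 / 2 for the quadratic term and 2 for the probability exp (- 2
  d); the last three add up to 14.5.\<close>

definition tail_const :: real where
  "tail_const = 15 + 2 * ln net_base"

lemma net_base_gt_1: "net_base > 1"
  by (simp add: net_base_def)

section \<open>Combining the estimates\<close>

context matrix_body
begin

lemma volume_image:
  assumes AB: "inverse_mat_on J A B" and vL: "lebesgue_vol J L > 0"
  defines "j \<equiv> enn2real (gauss_transform J 0 A)"
  shows "0 < j" "gauss_transform J 0 A = ennreal j"
    "emeasure (leb J) (lin_map J A ` L) = ennreal (lebesgue_vol J L * sqrt (2 * pi) ^ d\<^sup>2 / j)"
proof -
  have g: "gauss_transform J 0 A = ennreal j"
    using gauss_transform_finite[OF I AB] by (simp add: j_def less_top)
  have eL: "emeasure (leb J) L = ennreal (lebesgue_vol J L)"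
    unfolding lebesgue_vol_def using emeasure_L_finite by (intro emeasure_eq_ennreal_measure) simp
  define s where "s = lebesgue_vol J L * sqrt (2 * pi) ^ d\<^sup>2"
  have s: "s > 0" using vL by (simp add: s_def)
  have eq: "ennreal s = emeasure (leb J) (lin_map J A ` L) * ennreal j"
    using volume_lin_map[OF I AB L_sets] vL unfolding eL g card_J s_def by (simp add: ennreal_mult)
  have "j \<noteq> 0" using eq s by auto
  then show j: "0 < j" by (simp add: j_def less_le)
  show "gauss_transform J 0 A = ennreal j" by (rule g)
  have "emeasure (leb J) (lin_map J A ` L) = emeasure (leb J) (lin_map J A ` L) * (ennreal j * ennreal (1 / j))"
    using j by (simp add: ennreal_mult[symmetric])
  also have "\<dots> = ennreal s * ennreal (1 / j)" unfolding eq by (simp only: mult.assoc)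
  also have "\<dots> = ennreal (s / j)" using s j by (simp add: ennreal_mult[symmetric])
  finally show "emeasure (leb J) (lin_map J A ` L) = ennreal (lebesgue_vol J L * sqrt (2 * pi) ^ d\<^sup>2 / j)"
    by (simp add: s_def)
qed

text \<open>The volume of the random body as an explicit measurable function of the matrix;
  \<open>t\<close> stands for \<tau>(u). The value 0 at singular matrices is the true volume of the
  body there.\<close>

definition body_volume :: "real \<Rightarrow> ((nat \<times> nat) \<times> (nat \<times> nat) \<Rightarrow> real) \<Rightarrow> real" where
  "body_volume t A = (if \<exists>B. inverse_mat_on J A B
     then (1 / t * (1 / opn A)) ^ d\<^sup>2 * (lebesgue_vol J L * sqrt (2 * pi) ^ d\<^sup>2 / enn2real (gauss_transform J 0 A)) else 0)"

lemma volume_random_body: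
  assumes t: "\<tau> (ones d) > 0" and vL: "lebesgue_vol J L > 0"
  shows "lebesgue_vol J (random_body d \<tau> L A) = body_volume (\<tau> (ones d)) A"
proof -
  define c where "c = 1 / \<tau> (ones d) * (1 / opn A)"
  have rb: "random_body d \<tau> L A = vscale J c ` lin_map J A ` L"
    by (simp add: random_body_def Let_def c_def opn_def)
  show ?thesis
  proof (cases "\<exists>B. inverse_mat_on J A B")
    case False
    then show ?thesis unfolding rb using volume_lin_map_singular[OF I False] by (simp add: body_volume_def)
  next
    case True
    then obtain B where B: "inverse_mat_on J A B" by blast
    have c: "c > 0" using t opn_pos[OF B] by (simp add: c_def)
    have "emeasure (leb J) (random_body d \<tau> L A)
        = ennreal (c ^ d\<^sup>2) * ennreal (lebesgue_vol J L * sqrt (2 * pi) ^ d\<^sup>2 / enn2real (gauss_transform J 0 A))"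
      unfolding rb using c volume_vscale[OF I _ lin_map_image_sets[OF I B L_sets], of c] volume_image(3)[OF B vL]
      by (simp only: card_J abs_of_pos)
    also have "\<dots> = ennreal (body_volume (\<tau> (ones d)) A)"
      using c True by (simp add: body_volume_def c_def ennreal_mult'[symmetric])
    finally show ?thesis
      unfolding lebesgue_vol_def measure_def using t opn_nonneg[of A] vL by (simp add: body_volume_def lebesgue_vol_def)
  qed
qed

lemma measurable_body_volume: "body_volume t \<in> borel_measurable (leb (J \<times> J))"
proof -
  note measurable_opn[measurable] measurable_gauss_transform[OF I, measurable]
  have [measurable]: "Measurable.pred (leb (J \<times> J)) (\<lambda>A. \<exists>B. inverse_mat_on J A B)"
    using invertible_sets[OF I Ine] by (simp add: pred_def)
  show ?thesis unfolding body_volume_def by measurable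
qed

text \<open>The second bound is what makes the mean of the support function negligible against its
  deviation.\<close>

lemma ln_dim: "ln (real (d\<^sup>2)) > 0" "ln (real (d\<^sup>2)) \<le> 4 * sqrt (real d)"
proof -
  have "ln (real d) = 2 * ln (sqrt (real d))" using d by (simp add: ln_sqrt)
  also have "\<dots> \<le> 2 * (sqrt (real d) - 1)" using d by (intro mult_left_mono ln_le_minus_one) auto
  finally show "ln (real (d\<^sup>2)) \<le> 4 * sqrt (real d)" using d by (simp add: ln_realpow)
  show "ln (real (d\<^sup>2)) > 0" using d by (simp add: ln_realpow)
qed

lemma dim_le: "2 * real d \<le> real (d\<^sup>2)"
  using d by (simp add: power2_eq_square)

lemma emeasure_large_opn:
  assumes C0: "C0 > 0" and pos: "rudelson_position J C0 L"
  defines "R \<equiv> C0 * (real d / ln (real (d\<^sup>2)))"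
  defines "c \<equiv> tail_const * sqrt (real d) * R"
  obtains E where "E \<in> sets (gaussian (J \<times> J))" "emeasure (gaussian (J \<times> J)) E \<le> ennreal (exp (- 2 * real d))"
    "\<And>A. A \<in> coord_space (J \<times> J) \<Longrightarrow> A \<notin> E \<Longrightarrow> opn A \<le> 2 * c"
proof -
  let ?G = "gaussian (J \<times> J)"
  have R0: "R > 0" using C0 d ln_dim by (simp add: R_def)
  have sq: "sqrt (real (d\<^sup>2)) = real d" by (simp add: real_sqrt_power)
  have RL: "L2_set y J \<le> R" if "y \<in> L" for y
    using L2_le_op_norm[OF that] pos unfolding rudelson_position_def Let_def card_J sq R_def by linarith
  have ell: "ell J (polar J L) \<le> C0 * real d"
    using pos unfolding rudelson_position_def Let_def card_J sq by blast
  \<comment> \<open>This parameter makes both l c and l^2 R^2 multiples of d, while the mean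
    contributes at most sqrt d * ln (d^2) \<le> 4 d.\<close>
  define l where "l = sqrt (real d) / R"
  have l: "l > 0" using R0 d by (simp add: l_def)
  have lnK: "ln net_base > 0" using net_base_gt_1 by simp
  have c0: "0 \<le> c" using R0 lnK by (simp add: c_def tail_const_def)
  define b where "b = exp (- l * c + 5 / 2 * (l * ell J (polar J L) + l\<^sup>2 * R\<^sup>2))"
  define F where "F = (\<lambda>(u, v). {A \<in> coord_space (J \<times> J). c < supp (contract A (tensor u v))})"
  have tl: "L2_set (tensor u v) J \<le> 1" if "u \<in> net d" "v \<in> net d" for u v
    unfolding L2_tensor using mult_mono[OF net_L2[OF that(1)] net_L2[OF that(2)]] by simp
  have Fs: "F p \<in> sets ?G" "emeasure ?G (F p) \<le> ennreal b" if "p \<in> net d \<times> net d" for p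
    using that support_tail[OF RL less_imp_le[OF l] c0 tl] unfolding F_def b_def by auto
  have fin: "finite (net d \<times> net d)" by (intro finite_cartesian_product finite_net)
  define E where "E = (\<Union>p\<in>net d \<times> net d. F p)"
  show thesis
  proof (rule that)
    show "E \<in> sets ?G" unfolding E_def by (intro sets.finite_UN fin Fs)
    have "emeasure ?G E \<le> (\<Sum>p\<in>net d \<times> net d. emeasure ?G (F p))"
      unfolding E_def by (rule emeasure_subadditive_finite[OF fin]) (use Fs in blast)
    also have "\<dots> \<le> (\<Sum>p\<in>net d \<times> net d. ennreal b)" by (intro sum_mono Fs)
    also have "\<dots> = ennreal (real (card (net d)) * real (card (net d)) * b)"
      by (simp add: card_cartesian_product ennreal_mult ennreal_of_nat_eq_real_of_nat b_def)
    also have "\<dots> \<le> ennreal (net_base ^ d * net_base ^ d * b)"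
      unfolding net_base_def by (intro ennreal_leI mult_right_mono mult_mono card_net) (auto simp: b_def)
    also have "\<dots> \<le> ennreal (exp (- 2 * real d))"
    proof (rule ennreal_leI)
      have K: "net_base ^ d = exp (real d * ln net_base)"
        using net_base_gt_1 by (simp add: exp_of_nat_mult)
      have lc: "l * c = tail_const * real d" using R0 d by (simp add: l_def c_def)
      have lR: "l\<^sup>2 * R\<^sup>2 = real d" using R0 by (simp add: l_def power_divide)
      have "l * ell J (polar J L) \<le> l * (C0 * real d)" using ell l by (intro mult_left_mono) auto
      also have "\<dots> = sqrt (real d) * ln (real (d\<^sup>2))" using C0 d ln_dim by (simp add: l_def R_def)
      also have "\<dots> \<le> sqrt (real d) * (4 * sqrt (real d))" by (intro mult_left_mono ln_dim) simp
      also have "\<dots> = 4 * real d" by simp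
      finally have le: "l * ell J (polar J L) \<le> 4 * real d" .
      have "net_base ^ d * net_base ^ d * b = exp (2 * real d * ln net_base - l * c + 5 / 2 * (l * ell J (polar J L) + l\<^sup>2 * R\<^sup>2))"
        unfolding K b_def exp_add[symmetric] by (simp add: algebra_simps)
      also have "\<dots> \<le> exp (- 2 * real d)"
        unfolding exp_le_cancel_iff lc lR tail_const_def using le by (simp add: algebra_simps)
      finally show "net_base ^ d * net_base ^ d * b \<le> exp (- 2 * real d)" .
    qed
    finally show "emeasure ?G E \<le> ennreal (exp (- 2 * real d))" .
    fix A assume A: "A \<in> coord_space (J \<times> J)" "A \<notin> E"
    show "opn A \<le> 2 * c"
    proof (rule opn_le)
      fix u v assume "u \<in> net d" "v \<in> net d"
      then show "supp (contract A (tensor u v)) \<le> c" using A unfolding E_def F_def by force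
    qed
  qed
qed

text \<open>Put n = d^2. With \<delta> = exp (- 3 n) the degenerate matrices have probability at
  most exp (- n), and Markov's inequality for the damped transform allows another exp (- n). In
  \<open>j0\<close> the factors per dimension are e from Markov, e^3 from 1 / \<delta>, pi sqrt 2
  from the expected transform, sqrt 2 from the regularisation, and sqrt e / d from the
  factorial.\<close>

lemma emeasure_small_det:
  defines "j0 \<equiv> 2 * pi * exp 4 * sqrt (exp 1) / real d"
  obtains E where "E \<in> sets (gaussian (J \<times> J))" "emeasure (gaussian (J \<times> J)) E \<le> ennreal (2 * exp (- 2 * real d))"
    "\<And>A. A \<in> coord_space (J \<times> J) \<Longrightarrow> A \<notin> E \<Longrightarrow>
       (\<exists>B. inverse_mat_on J A B) \<and> gauss_transform J 0 A \<le> ennreal (2 * j0 ^ d\<^sup>2)"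
proof -
  let ?G = "gaussian (J \<times> J)"
  define m where "m = d\<^sup>2"
  have m: "m > 0" "card J = m" using d0 by (auto simp: m_def card_J)
  define \<delta> where "\<delta> = exp (- 3 * real m)"
  have \<delta>: "0 < \<delta>" "\<delta> \<le> 1" by (auto simp: \<delta>_def)
  define W where "W = 2 / \<delta> * ((pi * sqrt 2) ^ m / sqrt (fact m))"
  have W: "W > 0" using \<delta> by (simp add: W_def)
  define k where "k = exp (- real m) / W"
  have k: "k > 0" using W by (simp add: k_def)
  have gm[measurable]: "gauss_transform J \<delta> \<in> borel_measurable ?G"
    using measurable_gauss_transform[OF I, of \<delta>] by (simp cong: measurable_cong_sets)
  define F where "F = {A \<in> space ?G. 1 \<le> ennreal k * gauss_transform J \<delta> A}"
  have F: "F \<in> sets ?G" unfolding F_def by measurable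
  have em: "exp (- real m) \<le> exp (- 2 * real d)" using dim_le by (simp add: m_def)
  show thesis
  proof (rule that[of "F \<union> degenerate J \<delta>"])
    show "F \<union> degenerate J \<delta> \<in> sets ?G" using F degenerate_sets[OF I, of \<delta>] by simp
    have "emeasure ?G F \<le> ennreal k * (\<integral>\<^sup>+A. gauss_transform J \<delta> A * indicator (space ?G) A \<partial>?G)"
      unfolding F_def by (rule nn_integral_Markov_inequality[OF _ sets.top]) measurable
    also have "\<dots> = ennreal k * (\<integral>\<^sup>+A. gauss_transform J \<delta> A \<partial>?G)"
      by (intro arg_cong[where f = "\<lambda>t. ennreal k * t"] nn_integral_cong) simp
    also have "\<dots> \<le> ennreal k * ennreal W"
      using nn_integral_gauss_transform[OF I Ine \<delta>] unfolding m(2) W_def by (intro mult_left_mono) auto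
    also have "\<dots> = ennreal (exp (- real m))" using k W by (simp add: ennreal_mult[symmetric] k_def)
    finally have eF: "emeasure ?G F \<le> ennreal (exp (- 2 * real d))" using em by (meson ennreal_leI order_trans)
    have "real m * (\<delta> * sqrt (real m)) \<le> exp (real m) * (exp (- 3 * real m) * exp (real m))"
    proof (intro mult_mono)
      show "real m \<le> exp (real m)" using exp_ge_add_one_self[of "real m"] by linarith
      have "sqrt (real m) \<le> real m" using m(1) by (intro real_le_lsqrt) (auto simp: power2_eq_square)
      then show "sqrt (real m) \<le> exp (real m)" using exp_ge_add_one_self[of "real m"] by linarith
    qed (auto simp: \<delta>_def)
    also have "\<dots> = exp (- real m)" by (simp add: exp_add[symmetric])
    finally have "emeasure ?G (degenerate J \<delta>) \<le> ennreal (exp (- 2 * real d))"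
      using emeasure_degenerate[OF I \<delta>(1)] em unfolding m(2) by (meson ennreal_leI order_trans)
    then have "emeasure ?G (F \<union> degenerate J \<delta>) \<le> ennreal (exp (- 2 * real d)) + ennreal (exp (- 2 * real d))"
      using eF by (intro order_trans[OF emeasure_subadditive[OF F degenerate_sets[OF I]]] add_mono)
    then show "emeasure ?G (F \<union> degenerate J \<delta>) \<le> ennreal (2 * exp (- 2 * real d))"
      by (simp add: ennreal_plus[symmetric] del: ennreal_plus)
    fix A assume A: "A \<in> coord_space (J \<times> J)" "A \<notin> F \<union> degenerate J \<delta>"
    have st: "\<delta> * L2_set x J \<le> L2_set (lin_map J A x) J" for x
      using not_degenerate_stretch[OF I A(1)] A(2) by blast
    have "ennreal k * gauss_transform J \<delta> A \<le> 1" using A by (auto simp: F_def not_le)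
    then have "ennreal (1 / k) * (ennreal k * gauss_transform J \<delta> A) \<le> ennreal (1 / k) * 1" by (rule mult_left_mono) simp
    then have g: "gauss_transform J \<delta> A \<le> ennreal (1 / k)"
      using k by (simp add: mult.assoc[symmetric] ennreal_mult[symmetric])
    have "gauss_transform J 0 A \<le> ennreal (sqrt 2 ^ m) * ennreal (1 / k)"
      using order_trans[OF gauss_transform_regularize[OF I \<delta>(1) st] mult_left_mono[OF g]] unfolding m(2) by simp
    also have "\<dots> = ennreal (sqrt 2 ^ m * (1 / k))" using k by (simp add: ennreal_mult[symmetric])
    also have "\<dots> \<le> ennreal (2 * j0 ^ m)"
    proof (rule ennreal_leI)
      have "(real m / exp 1) ^ m \<le> fact m" by (rule fact_ge_power)
      then have "sqrt ((real m / exp 1) ^ m) \<le> sqrt (fact m)" by (rule real_sqrt_le_mono)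
      moreover have "sqrt ((real m / exp 1) ^ m) = (real d / sqrt (exp 1)) ^ m"
        by (simp add: real_sqrt_power real_sqrt_divide m_def)
      ultimately have f: "(real d / sqrt (exp 1)) ^ m \<le> sqrt (fact m)" by simp
      have p: "0 < (real d / sqrt (exp 1)) ^ m" using d0 by simp
      have e1: "1 / exp (- real m) = exp 1 ^ m" "1 / \<delta> = exp 3 ^ m"
        by (simp_all add: \<delta>_def exp_minus exp_of_nat_mult[symmetric] inverse_eq_divide mult.commute)
      have "sqrt 2 ^ m * (1 / k) = sqrt 2 ^ m * (exp 1 ^ m * (2 * (exp 3 ^ m * ((pi * sqrt 2) ^ m / sqrt (fact m)))))"
        unfolding e1[symmetric] by (simp add: k_def W_def)
      also have "\<dots> \<le> sqrt 2 ^ m * (exp 1 ^ m * (2 * (exp 3 ^ m * ((pi * sqrt 2) ^ m / (real d / sqrt (exp 1)) ^ m))))"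
        by (intro mult_left_mono divide_left_mono f mult_pos_pos p) auto
      also have "\<dots> = 2 * (sqrt 2 * (exp 1 * (exp 3 * (pi * sqrt 2 / (real d / sqrt (exp 1)))))) ^ m"
        by (simp add: power_mult_distrib power_divide)
      also have "sqrt 2 * (exp 1 * (exp 3 * (pi * sqrt 2 / (real d / sqrt (exp 1))))) = j0"
      proof -
        have "exp 4 = exp 1 * exp (3 :: real)" by (simp add: exp_add[symmetric])
        then show ?thesis by (simp add: j0_def)
      qed
      finally show "sqrt 2 ^ m * (1 / k) \<le> 2 * j0 ^ m" .
    qed
    finally show "(\<exists>B. inverse_mat_on J A B) \<and> gauss_transform J 0 A \<le> ennreal (2 * j0 ^ d\<^sup>2)"
      using stretch_pos_inverse[OF I \<delta>(1) st] by (simp add: m_def)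
  qed
qed

lemma volume_rudelson:
  assumes C0: "C0 > 0" and pos: "rudelson_position J C0 L"
  shows "1 / 2 \<le> (2 * (C0 * real d * ln (real (d\<^sup>2))) / sqrt (2 * pi)) ^ d\<^sup>2 * lebesgue_vol J L"
    and "lebesgue_vol J L > 0"
proof -
  define b where "b = C0 * real d * ln (real (d\<^sup>2))"
  have b: "b > 0" using C0 d0 ln_dim by (simp add: b_def)
  have "ell J L \<le> b"
    using pos unfolding rudelson_position_def Let_def card_J b_def by (simp add: real_sqrt_power)
  from volume_lower[OF b this] show v: "1 / 2 \<le> (2 * b / sqrt (2 * pi)) ^ d\<^sup>2 * lebesgue_vol J L"
    by (simp only: card_J)
  show "lebesgue_vol J L > 0"
  proof (rule ccontr)
    assume "\<not> lebesgue_vol J L > 0"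
    then have "(2 * b / sqrt (2 * pi)) ^ d\<^sup>2 * lebesgue_vol J L \<le> 0" using b by (simp add: mult_nonneg_nonpos)
    then show False using v by simp
  qed
qed

lemma body_volume_lower:
  assumes C0: "C0 > 0" and pos: "rudelson_position J C0 L" and t: "t > 0"
    and inv: "\<exists>B. inverse_mat_on J A B"
    and g: "gauss_transform J 0 A \<le> ennreal (2 * (2 * pi * exp 4 * sqrt (exp 1) / real d) ^ d\<^sup>2)"
    and o: "opn A \<le> 2 * (tail_const * sqrt (real d) * (C0 * (real d / ln (real (d\<^sup>2)))))"
  shows "(1 / (16 * tail_const * C0\<^sup>2 * exp 4 * sqrt (exp 1) * t * real d * sqrt (real d))) ^ d\<^sup>2 \<le> body_volume t A"
proof -
  define m where "m = d\<^sup>2"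
  have m: "m > 0" using d0 by (simp add: m_def)
  define s where "s = sqrt (2 * pi)"
  have s: "s > 0" "s * s = 2 * pi" by (auto simp: s_def)
  define ld where "ld = ln (real (d\<^sup>2))"
  have ld: "ld > 0" using ln_dim by (simp add: ld_def)
  define b where "b = C0 * real d * ld"
  have b: "b > 0" using C0 d0 ld by (simp add: b_def)
  have v: "1 / 2 \<le> (2 * b / s) ^ m * lebesgue_vol J L"
    using volume_rudelson(1)[OF C0 pos] by (simp only: b_def s_def ld_def m_def)
  have bp: "0 < (2 * b / s) ^ m" using b s by simp
  have vL: "lebesgue_vol J L > 0" by (rule volume_rudelson(2)[OF C0 pos])
  have vL': "1 / 2 / (2 * b / s) ^ m \<le> lebesgue_vol J L" using v bp by (simp add: divide_le_eq mult.commute)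
  obtain B where B: "inverse_mat_on J A B" using inv by blast
  define j where "j = enn2real (gauss_transform J 0 A)"
  note vi = volume_image[OF B vL, folded j_def]
  define j0 where "j0 = 2 * pi * exp 4 * sqrt (exp 1) / real d"
  have j0: "j0 > 0" using d0 by (simp add: j0_def)
  have jle: "j \<le> 2 * j0 ^ m" using g j0 unfolding vi(2) j0_def[symmetric] m_def[symmetric] by simp
  have tc: "tail_const > 0" using net_base_gt_1 by (simp add: tail_const_def add_pos_pos)
  define c where "c = tail_const * sqrt (real d) * (C0 * (real d / ld))"
  have c: "c > 0" using tc C0 d0 ld by (simp add: c_def)
  have op: "0 < opn A" "opn A \<le> 2 * c" using opn_pos[OF B] o by (auto simp: c_def ld_def)
  have "1 / (16 * tail_const * C0\<^sup>2 * exp 4 * sqrt (exp 1) * t * real d * sqrt (real d))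
      = 1 / 4 * (1 / t * (1 / (2 * c)) * (1 / (2 * b / s) * (s / j0)))"
  proof -
    have cb: "c * b = tail_const * C0\<^sup>2 * sqrt (real d) * real d * real d"
      using ld by (simp add: c_def b_def power2_eq_square)
    have "1 / 4 * (1 / t * (1 / (2 * c)) * (1 / (2 * b / s) * (s / j0))) = (s * s) / (16 * t * (c * b) * j0)"
      using b c s by (simp add: field_simps)
    also have "\<dots> = 1 / (16 * tail_const * C0\<^sup>2 * exp 4 * sqrt (exp 1) * t * real d * sqrt (real d))"
      unfolding s(2) cb j0_def using d0 by (simp add: field_simps)
    finally show ?thesis ..
  qed
  then have "(1 / (16 * tail_const * C0\<^sup>2 * exp 4 * sqrt (exp 1) * t * real d * sqrt (real d))) ^ m
      = (1 / 4) ^ m * ((1 / t * (1 / (2 * c))) ^ m * ((1 / (2 * b / s)) ^ m * (s / j0) ^ m))"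
    by (simp only: power_mult_distrib)
  \<comment> \<open>One factor 1 / 4 suffices to absorb the 1 / 2 of the volume bound for
    \<open>L\<close> and the 2 in front of the power of \<open>j0\<close>; the spare power is
    discarded because m \<ge> 1.\<close>
  also have "\<dots> \<le> 1 / 4 * ((1 / t * (1 / (2 * c))) ^ m * ((1 / (2 * b / s)) ^ m * (s / j0) ^ m))"
    using m power_decreasing[of 1 m "1/4 :: real"] t c b s j0 by (intro mult_right_mono) auto
  also have "\<dots> = (1 / t * (1 / (2 * c))) ^ m * (1 / 2 / (2 * b / s) ^ m * s ^ m / (2 * j0 ^ m))"
    by (simp add: power_divide power_one_over)
  also have "\<dots> \<le> (1 / t * (1 / opn A)) ^ m * (lebesgue_vol J L * s ^ m / j)"
  proof (rule mult_mono)
    show "(1 / t * (1 / (2 * c))) ^ m \<le> (1 / t * (1 / opn A)) ^ m"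
      using t c op by (intro power_mono mult_left_mono divide_left_mono) auto
    show "1 / 2 / (2 * b / s) ^ m * s ^ m / (2 * j0 ^ m) \<le> lebesgue_vol J L * s ^ m / j"
      by (rule frac_le[OF _ mult_right_mono[OF vL'] vi(1) jle]) (use vL s in auto)
  qed (use t op b s j0 in auto)
  also have "\<dots> = body_volume t A" unfolding body_volume_def m_def j_def s_def using inv by (simp only: if_True)
  finally show "(1 / (16 * tail_const * C0\<^sup>2 * exp 4 * sqrt (exp 1) * t * real d * sqrt (real d))) ^ d\<^sup>2 \<le> body_volume t A"
    by (simp add: m_def)
qed

text \<open>The constant is the product of the numerical factors in
  \<open>volume_unit_ball_le\<close> and \<open>body_volume_lower\<close>. Failure occurs with
  probability at most 3 exp (- 2 d), which leaves room for the strict inequality.\<close>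

lemma random_body_probability:
  assumes C0: "C0 > 0" and pos: "rudelson_position J C0 L"
    and N: "unitary_invariant_norm d N" "associated_norm d N \<tau>"
  defines "C \<equiv> net_base\<^sup>2 * (exp (1 / 2) * sqrt (32 * pi)) * (16 * tail_const * C0\<^sup>2 * exp 4 * sqrt (exp 1))"
  shows "measure (gaussian (J \<times> J)) {A \<in> space (gaussian (J \<times> J)).
         random_body d \<tau> L A \<subseteq> unit_ball J N \<and> 0 < lebesgue_vol J (random_body d \<tau> L A) \<and>
         lebesgue_vol J (unit_ball J N) powr (1 / real (d\<^sup>2)) /
           lebesgue_vol J (random_body d \<tau> L A) powr (1 / real (d\<^sup>2)) \<le> C * real d}
      > 1 - 2 * exp (- real d)"
proof -
  let ?G = "gaussian (J \<times> J)"
  interpret prob_space ?G by (rule prob_space_gaussian)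
  define t where "t = \<tau> (ones d)"
  have t: "t > 0" unfolding t_def using one_symmetric_norm_ones_pos[OF _ d0] N(2) by (simp add: associated_norm_def)
  define m where "m = d\<^sup>2"
  have m: "m > 0" using d0 by (simp add: m_def)
  have tc: "tail_const > 0" using net_base_gt_1 by (simp add: tail_const_def add_pos_pos)
  obtain E1 where E1: "E1 \<in> events" "emeasure ?G E1 \<le> ennreal (exp (- 2 * real d))"
    "\<And>A. A \<in> coord_space (J \<times> J) \<Longrightarrow> A \<notin> E1 \<Longrightarrow> opn A \<le> 2 * (tail_const * sqrt (real d) * (C0 * (real d / ln (real (d\<^sup>2)))))"
    using emeasure_large_opn[OF C0 pos] by blast
  obtain E2 where E2: "E2 \<in> events" "emeasure ?G E2 \<le> ennreal (2 * exp (- 2 * real d))"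
    "\<And>A. A \<in> coord_space (J \<times> J) \<Longrightarrow> A \<notin> E2 \<Longrightarrow> (\<exists>B. inverse_mat_on J A B) \<and>
      gauss_transform J 0 A \<le> ennreal (2 * (2 * pi * exp 4 * sqrt (exp 1) / real d) ^ d\<^sup>2)"
    using emeasure_small_det by blast
  \<comment> \<open>Since d \<ge> 2, e is at most 1 / 3, so that 3 e^2 < 2 e.\<close>
  define e where "e = exp (- real d)"
  have e: "0 < e" "e < 2 / 3" 
  proof -
    have "3 \<le> exp (real d)" using exp_ge_add_one_self[of "real d"] d by linarith
    then show "e < 2 / 3" by (simp add: e_def exp_minus field_simps)
  qed (simp add: e_def)
  have ee: "exp (- (2 * real d)) = e * e" by (simp add: e_def exp_add[symmetric])
  have p1: "prob E1 \<le> e * e" using E1(2) by (simp add: emeasure_eq_measure ee)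
  have p2: "prob E2 \<le> 2 * (e * e)" using E2(2) by (simp add: emeasure_eq_measure ee e)
  have "e * e * 3 < e * 2" using e by (simp add: mult.assoc mult_strict_left_mono)
  then have small: "prob (E1 \<union> E2) < 2 * e" using p1 p2 measure_Un_le[OF E1(1) E2(1)] by simp
  define K where "K = 16 * tail_const * C0\<^sup>2 * exp 4 * sqrt (exp 1)"
  have K: "K > 0" using tc C0 by (simp add: K_def)
  define V where "V = 1 / (K * t * real d * sqrt (real d))"
  have V: "V > 0" using K t d0 by (simp add: V_def)
  define C1 where "C1 = net_base\<^sup>2 * (exp (1 / 2) * sqrt (32 * pi))"
  have C1: "C1 > 0" using net_base_gt_1 by (simp add: C1_def)
  define vB where "vB = lebesgue_vol J (unit_ball J N)"
  have vB: "vB \<le> (C1 / (t * sqrt (real d))) ^ m" "0 \<le> vB"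
    using volume_unit_ball_le[OF d0 N(2)] by (simp_all only: vB_def C1_def t_def m_def) (simp add: lebesgue_vol_def)
  have vr: "lebesgue_vol J (random_body d \<tau> L A) = body_volume t A" for A
    unfolding t_def by (rule volume_random_body[where \<tau> = \<tau>, OF t[unfolded t_def] volume_rudelson(2)[OF C0 pos]])
  \<comment> \<open>\<open>T\<close> is the event of the statement in terms of
    \<open>body_volume\<close>, where its measurability is visible. Its positivity condition
    excludes singular matrices, for which the quotient would be 0 by the convention for
    division.\<close>
  define T where "T = {A \<in> space ?G. 0 < body_volume t A \<and> vB powr (1 / real m) / body_volume t A powr (1 / real m) \<le> C * real d}"
  have Tset: "T \<in> events"
  proof -
    have [measurable]: "body_volume t \<in> borel_measurable ?G"
      using measurable_body_volume by (simp cong: measurable_cong_sets)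
    show ?thesis unfolding T_def by measurable
  qed
  have "space ?G - (E1 \<union> E2) \<subseteq> T"
  proof
    fix A assume A: "A \<in> space ?G - (E1 \<union> E2)"
    then have Ac: "A \<in> coord_space (J \<times> J)" "A \<notin> E1" "A \<notin> E2" by auto
    have low: "V ^ m \<le> body_volume t A"
      using body_volume_lower[OF C0 pos t _ _ E1(3)[OF Ac(1,2)]] E2(3)[OF Ac(1,3)]
      by (simp only: V_def K_def m_def)
    then have bv: "0 < body_volume t A" using V by (meson less_le_trans zero_less_power)
    have "vB powr (1 / real m) \<le> ((C1 / (t * sqrt (real d))) ^ m) powr (1 / real m)"
      using vB by (intro powr_mono2) auto
    also have "\<dots> = C1 / (t * sqrt (real d))" using C1 t m by (intro power_powr_inverse) auto
    finally have u: "vB powr (1 / real m) \<le> C1 / (t * sqrt (real d))" .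
    have "V = (V ^ m) powr (1 / real m)" using V m by (intro power_powr_inverse[symmetric]) auto
    also have "\<dots> \<le> body_volume t A powr (1 / real m)" using low V by (intro powr_mono2) auto
    finally have lo: "V \<le> body_volume t A powr (1 / real m)" .
    have "vB powr (1 / real m) / body_volume t A powr (1 / real m) \<le> C1 / (t * sqrt (real d)) / V"
      by (rule frac_le[OF _ u V lo]) (use C1 t in auto)
    \<comment> \<open>The upper bound for the ball is proportional to 1 / (t sqrt d) and
      \<open>V\<close> to 1 / (t d sqrt d): the norm enters only through t, which cancels, and one
      factor d survives.\<close>
    also have "\<dots> = C * real d"
      using t d0 by (simp add: V_def C_def C1_def[symmetric] K_def[symmetric])
    finally show "A \<in> T" using A bv by (simp add: T_def)
  qed
  then have "prob (space ?G - (E1 \<union> E2)) \<le> prob T" by (rule finite_measure_mono[OF _ Tset])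
  moreover have "prob (space ?G - (E1 \<union> E2)) = 1 - prob (E1 \<union> E2)"
    by (rule prob_compl) (use E1 E2 in simp)
  ultimately have "1 - 2 * e < prob T" using small by simp
  moreover have "{A \<in> space ?G. random_body d \<tau> L A \<subseteq> unit_ball J N \<and> 0 < lebesgue_vol J (random_body d \<tau> L A) \<and>
         lebesgue_vol J (unit_ball J N) powr (1 / real (d\<^sup>2)) /
           lebesgue_vol J (random_body d \<tau> L A) powr (1 / real (d\<^sup>2)) \<le> C * real d} = T"
    using random_body_subset[OF N] unfolding vr vB_def[symmetric] m_def[symmetric] T_def by blast
  ultimately show ?thesis by (simp only: e_def)
qed

end

theorem theorem4p4:
  fixes C0 :: real
  assumes "C0 > 0"
  shows "\<exists>C>0. \<forall>(d::nat) N \<tau> L.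
    2 \<le> d \<longrightarrow>
    unitary_invariant_norm d N \<longrightarrow>
    associated_norm d N \<tau> \<longrightarrow>
    convex_body (mat_idx d) L \<longrightarrow>
    centrally_symmetric (mat_idx d) L \<longrightarrow>
    rudelson_position (mat_idx d) C0 L \<longrightarrow>
    measure (gaussian (mat_idx d \<times> mat_idx d))
      {A \<in> space (gaussian (mat_idx d \<times> mat_idx d)).
         random_body d \<tau> L A \<subseteq> unit_ball (mat_idx d) N \<and>
         0 < lebesgue_vol (mat_idx d) (random_body d \<tau> L A) \<and>
         lebesgue_vol (mat_idx d) (unit_ball (mat_idx d) N) powr (1 / real (d\<^sup>2)) /
           lebesgue_vol (mat_idx d) (random_body d \<tau> L A) powr (1 / real (d\<^sup>2)) \<le> C * real d}
      > 1 - 2 * exp (- real d)"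
proof (intro exI conjI allI impI)
  let ?C = "net_base\<^sup>2 * (exp (1 / 2) * sqrt (32 * pi)) * (16 * tail_const * C0\<^sup>2 * exp 4 * sqrt (exp 1))"
  have "tail_const > 0" using net_base_gt_1 by (simp add: tail_const_def add_pos_pos)
  then show "?C > 0" using assms net_base_gt_1 by simp
  fix d :: nat and N \<tau> L
  assume "2 \<le> d" and N: "unitary_invariant_norm d N" "associated_norm d N \<tau>"
    and L: "convex_body (mat_idx d) L" "centrally_symmetric (mat_idx d) L" "rudelson_position (mat_idx d) C0 L"
  moreover have "{..<d} \<noteq> {}" using \<open>2 \<le> d\<close> lessThan_empty_iff[of d] by linarith
  ultimately interpret matrix_body d L by unfold_locales auto
  show "measure (gaussian (mat_idx d \<times> mat_idx d))
      {A \<in> space (gaussian (mat_idx d \<times> mat_idx d)).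
         random_body d \<tau> L A \<subseteq> unit_ball (mat_idx d) N \<and>
         0 < lebesgue_vol (mat_idx d) (random_body d \<tau> L A) \<and>
         lebesgue_vol (mat_idx d) (unit_ball (mat_idx d) N) powr (1 / real (d\<^sup>2)) /
           lebesgue_vol (mat_idx d) (random_body d \<tau> L A) powr (1 / real (d\<^sup>2)) \<le> ?C * real d}
      > 1 - 2 * exp (- real d)"
    by (rule random_body_probability[OF assms L(3) N])
qed

end
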